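(* If $A\,|\,B$ is a D2 extension of rings, then $\mathcal{C}:=A\otimes_RT$, with its canonical structure (described in the context), is a Galois $A$-coring. If $A_B$ is moreover balanced or faithfully flat, then $B=A^{\mathrm{co}\,\mathcal{C}}$.
   Context: Rings are associative and unital; a ring extension $A\,|\,B$ means a ring $A$ with a subring $B$ containing $1_A$. $R=C_A(B)$ is the centralizer, $S=\mathrm{End}({}_BA_B)$ the ring of $B$-$B$-bimodule endomorphisms of $A$, and $T=(A\otimes_BA)^B=\{t\in A\otimes_BA: bt=tb\ \forall b\in B\}$. Write $t=t^1\otimes t^2\in T$, suppressing summation. $T$ is a ring with product $tt'=t'^1t^1\otimes t^2t'^2$ and unit $1_T=1\otimes1$, and an $R$-$R$-bimodule via $r\cdot t\cdot r'=rt^1\otimes t^2r'$. $A\,|\,B$ is D2 if $A\otimes_BA$ is isomorphic to a direct summand of a finite direct sum of copies of the natural bimodule $A$, both as $B$-$A$-bimodules (left D2) and as $A$-$B$-bimodules (right D2). Right D2 is equivalent to the existence of a right D2 quasibase: finitely many $\gamma_j\in S$, $u_j\in T$ with $a\otimes_Ba'=\sum_ja\gamma_j(a')u_j$ for all $a,a'\in A$. Fix one. $T$ is a right bialgebroid over $R$ with the ring structure given by the product $tt'=t'^1t^1\otimes t^2t'^2$ and unit $1_T=1\otimes1$, the $R$-$R$-bimodule structure $r\cdot t\cdot r'=rt^1\otimes t^2r'$, coproduct $\Delta_T(t)=t_{(1)}\otimes_Rt_{(2)}=\sum_j(t^1\otimes_B\gamma_j(t^2))\otimes_Ru_j$ and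 counit $\varepsilon_T(t)=t^1t^2$. Canonical structure on $\mathcal{C}=A\otimes_RT$: define $\rho:A\to A\otimes_RT$ by $\rho(a)=a_{(0)}\otimes a_{(1)}=\sum_j\gamma_j(a)\otimes u_j$. The $A$-$A$-bimodule structure is $a\cdot(a'\otimes t)=aa'\otimes t$ and $(a\otimes t)\cdot a'=aa'_{(0)}\otimes ta'_{(1)}$; the coproduct is $\Delta_{\mathcal{C}}(a\otimes t)=(a\otimes t_{(1)})\otimes_A(1_A\otimes t_{(2)})$; the counit is $\varepsilon_{\mathcal{C}}(a\otimes t)=a\varepsilon_T(t)=at^1t^2$; the distinguished element is $x=1_A\otimes1_T$. An $A$-coring is an $A$-$A$-bimodule $\mathcal{C}$ with $A$-$A$-bimodule maps $\Delta_{\mathcal{C}}:\mathcal{C}\to\mathcal{C}\otimes_A\mathcal{C}$ (coassociative) and $\varepsilon_{\mathcal{C}}:\mathcal{C}\to A$ (counital). An element $x\in\mathcal{C}$ is grouplike if $\Delta_{\mathcal{C}}(x)=x\otimes_Ax$ and $\varepsilon_{\mathcal{C}}(x)=1$. Saying that $\mathcal{C}$ is a Galois $A$-coring (for $A\,|\,B$) means that $\mathcal{C}$ is an $A$-coring, $x$ is grouplike with $bx=xb$ for all $b\in B$, and the map $\mathrm{can}:A\otimes_BA\to\mathcal{C}$, $\mathrm{can}(a\otimes a')=axa'=aa'_{(0)}\otimes_Ra'_{(1)}$, is an isomorphism of $A$-corings, where $A\otimes_BA$ has the Sweedler coring structure: coproduct $a\otimes a'\mapsto(a\otimes1)\otimes_A(1\otimes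 a')$, counit $a\otimes a'\mapsto aa'$, grouplike $1\otimes1$. The coinvariants are $A^{\mathrm{co}\,\mathcal{C}}=\{a\in A:\rho(a)=a\otimes1_T\}=\{a\in A: ax=xa\}$. $A_B$ is balanced if every endomorphism of $A$ as a left module over $\mathrm{End}(A_B)$ is right multiplication by an element of $B$. *)

theory Defs
  imports "HOL-Algebra.Algebra"
begin

section \<open>Modules and bimodules over noncommutative rings\<close>

text \<open>The library locale \<^locale>\<open>module\<close> requires a commutative base ring; the record is reused here.
  Scalar rings are parameters of the predicates and not part of the module record, so that
  restriction of scalars along a subring needs no new record. As for the library record
  \<^term>\<open>module.smult\<close>, the fields \<^term>\<open>monoid.mult\<close> and \<^term>\<open>one\<close> of a module carry no meaning.\<close>

record ('l, 'm, 'r) bimodule = "('l, 'm) module" +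
  rsmult :: "['m, 'r] \<Rightarrow> 'm" (infixl \<open>\<bullet>\<index>\<close> 70)

locale left_module = K?: ring K + M?: abelian_group M
  for K :: "('k, 'p) ring_scheme" (structure) and M :: "('k, 'm, 'q) module_scheme" (structure) +
  assumes lsmult_closed: "\<lbrakk>k \<in> carrier K; x \<in> carrier M\<rbrakk> \<Longrightarrow> k \<odot>\<^bsub>M\<^esub> x \<in> carrier M"
    and lsmult_add_scalar: "\<lbrakk>k \<in> carrier K; k' \<in> carrier K; x \<in> carrier M\<rbrakk>
      \<Longrightarrow> (k \<oplus>\<^bsub>K\<^esub> k') \<odot>\<^bsub>M\<^esub> x = k \<odot>\<^bsub>M\<^esub> x \<oplus>\<^bsub>M\<^esub> k' \<odot>\<^bsub>M\<^esub> x"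
    and lsmult_add: "\<lbrakk>k \<in> carrier K; x \<in> carrier M; y \<in> carrier M\<rbrakk>
      \<Longrightarrow> k \<odot>\<^bsub>M\<^esub> (x \<oplus>\<^bsub>M\<^esub> y) = k \<odot>\<^bsub>M\<^esub> x \<oplus>\<^bsub>M\<^esub> k \<odot>\<^bsub>M\<^esub> y"
    and lsmult_assoc: "\<lbrakk>k \<in> carrier K; k' \<in> carrier K; x \<in> carrier M\<rbrakk>
      \<Longrightarrow> (k \<otimes>\<^bsub>K\<^esub> k') \<odot>\<^bsub>M\<^esub> x = k \<odot>\<^bsub>M\<^esub> (k' \<odot>\<^bsub>M\<^esub> x)"
    and lsmult_one: "x \<in> carrier M \<Longrightarrow> \<one>\<^bsub>K\<^esub> \<odot>\<^bsub>M\<^esub> x = x"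

locale right_module = K?: ring K + M?: abelian_group M
  for K :: "('k, 'p) ring_scheme" (structure) and M :: "('l, 'm, 'k, 'q) bimodule_scheme" (structure) +
  assumes rsmult_closed: "\<lbrakk>x \<in> carrier M; k \<in> carrier K\<rbrakk> \<Longrightarrow> x \<bullet>\<^bsub>M\<^esub> k \<in> carrier M"
    and rsmult_add_scalar: "\<lbrakk>x \<in> carrier M; k \<in> carrier K; k' \<in> carrier K\<rbrakk>
      \<Longrightarrow> x \<bullet>\<^bsub>M\<^esub> (k \<oplus>\<^bsub>K\<^esub> k') = x \<bullet>\<^bsub>M\<^esub> k \<oplus>\<^bsub>M\<^esub> x \<bullet>\<^bsub>M\<^esub> k'"
    and rsmult_add: "\<lbrakk>x \<in> carrier M; y \<in> carrier M; k \<in> carrier K\<rbrakk>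
      \<Longrightarrow> (x \<oplus>\<^bsub>M\<^esub> y) \<bullet>\<^bsub>M\<^esub> k = x \<bullet>\<^bsub>M\<^esub> k \<oplus>\<^bsub>M\<^esub> y \<bullet>\<^bsub>M\<^esub> k"
    and rsmult_assoc: "\<lbrakk>x \<in> carrier M; k \<in> carrier K; k' \<in> carrier K\<rbrakk>
      \<Longrightarrow> x \<bullet>\<^bsub>M\<^esub> (k \<otimes>\<^bsub>K\<^esub> k') = (x \<bullet>\<^bsub>M\<^esub> k) \<bullet>\<^bsub>M\<^esub> k'"
    and rsmult_one: "x \<in> carrier M \<Longrightarrow> x \<bullet>\<^bsub>M\<^esub> \<one>\<^bsub>K\<^esub> = x"

locale bimodule = L?: left_module L M + R?: right_module R M
  for L :: "('l, 'p) ring_scheme" (structure) and R :: "('r, 'p2) ring_scheme" (structure)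
    and M :: "('l, 'm, 'r, 'q) bimodule_scheme" (structure) +
  assumes bimodule_assoc: "\<lbrakk>l \<in> carrier L; x \<in> carrier M; r \<in> carrier R\<rbrakk>
      \<Longrightarrow> (l \<odot>\<^bsub>M\<^esub> x) \<bullet>\<^bsub>M\<^esub> r = l \<odot>\<^bsub>M\<^esub> (x \<bullet>\<^bsub>M\<^esub> r)"

definition left_module_hom ::
    "('k, 'p) ring_scheme \<Rightarrow> ('k, 'm, 'q) module_scheme \<Rightarrow> ('k, 'n, 's) module_scheme \<Rightarrow> ('m \<Rightarrow> 'n) set" where
  "left_module_hom K M N = {f \<in> hom (add_monoid M) (add_monoid N).
     \<forall>k\<in>carrier K. \<forall>x\<in>carrier M. f (k \<odot>\<^bsub>M\<^esub> x) = k \<odot>\<^bsub>N\<^esub> f x}"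

definition right_module_hom ::
    "('k, 'p) ring_scheme \<Rightarrow> ('l, 'm, 'k, 'q) bimodule_scheme \<Rightarrow> ('l2, 'n, 'k, 's) bimodule_scheme
      \<Rightarrow> ('m \<Rightarrow> 'n) set" where
  "right_module_hom K M N = {f \<in> hom (add_monoid M) (add_monoid N).
     \<forall>k\<in>carrier K. \<forall>x\<in>carrier M. f (x \<bullet>\<^bsub>M\<^esub> k) = f x \<bullet>\<^bsub>N\<^esub> k}"

definition bimodule_hom ::
    "('l, 'p) ring_scheme \<Rightarrow> ('r, 'p2) ring_scheme \<Rightarrow> ('l, 'm, 'r, 'q) bimodule_scheme
      \<Rightarrow> ('l, 'n, 'r, 's) bimodule_scheme \<Rightarrow> ('m \<Rightarrow> 'n) set" where
  "bimodule_hom L R M N = left_module_hom L M N \<inter> right_module_hom R M N"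

definition bimodule_iso ::
    "('l, 'p) ring_scheme \<Rightarrow> ('r, 'p2) ring_scheme \<Rightarrow> ('l, 'm, 'r, 'q) bimodule_scheme
      \<Rightarrow> ('l, 'n, 'r, 's) bimodule_scheme \<Rightarrow> ('m \<Rightarrow> 'n) set" where
  "bimodule_iso L R M N = {f \<in> bimodule_hom L R M N. bij_betw f (carrier M) (carrier N)}"

text \<open>The ring \<open>A\<close> as the natural bimodule over itself (and, restricting scalars, over its subrings).\<close>

definition regular :: "('a, 'p) ring_scheme \<Rightarrow> ('a, 'a, 'a) bimodule" where
  "regular A = \<lparr>carrier = carrier A, monoid.mult = monoid.mult A, one = one A,
     ring.zero = ring.zero A, ring.add = ring.add A, smult = monoid.mult A, rsmult = monoid.mult A\<rparr>"

definition bimodule_power :: "nat \<Rightarrow> ('l, 'm, 'r, 'q) bimodule_scheme \<Rightarrow> ('l, nat \<Rightarrow> 'm, 'r) bimodule" where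
  "bimodule_power n M = \<lparr>carrier = (\<Pi>\<^sub>E i\<in>{..<n}. carrier M), monoid.mult = undefined, one = undefined,
     ring.zero = (\<lambda>i\<in>{..<n}. \<zero>\<^bsub>M\<^esub>), ring.add = (\<lambda>x y. \<lambda>i\<in>{..<n}. x i \<oplus>\<^bsub>M\<^esub> y i),
     smult = (\<lambda>l x. \<lambda>i\<in>{..<n}. l \<odot>\<^bsub>M\<^esub> x i), rsmult = (\<lambda>x r. \<lambda>i\<in>{..<n}. x i \<bullet>\<^bsub>M\<^esub> r)\<rparr>"

definition subbimodule ::
    "('l, 'p) ring_scheme \<Rightarrow> ('r, 'p2) ring_scheme \<Rightarrow> 'm set \<Rightarrow> ('l, 'm, 'r, 'q) bimodule_scheme \<Rightarrow> bool" where
  "subbimodule L R P M \<longleftrightarrow> subgroup P (add_monoid M) \<and>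
     (\<forall>l\<in>carrier L. \<forall>x\<in>P. l \<odot>\<^bsub>M\<^esub> x \<in> P) \<and> (\<forall>r\<in>carrier R. \<forall>x\<in>P. x \<bullet>\<^bsub>M\<^esub> r \<in> P)"

definition direct_summand ::
    "('l, 'p) ring_scheme \<Rightarrow> ('r, 'p2) ring_scheme \<Rightarrow> 'm set \<Rightarrow> ('l, 'm, 'r, 'q) bimodule_scheme \<Rightarrow> bool" where
  "direct_summand L R P M \<longleftrightarrow> subbimodule L R P M \<and>
     (\<exists>Q. subbimodule L R Q M \<and> P \<inter> Q = {\<zero>\<^bsub>M\<^esub>} \<and> P <+>\<^bsub>M\<^esub> Q = carrier M)"


section \<open>Tensor products over noncommutative rings\<close>

text \<open>\<open>M \<otimes>\<^sub>K N\<close> is the free abelian group on \<open>M \<times> N\<close> modulo the biadditivity and \<open>K\<close>-balancing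
  relations; its elements are cosets.\<close>

type_synonym ('m, 'n) tens = "('m \<times> 'n \<Rightarrow>\<^sub>0 int) set"

definition tensor_relators ::
    "('k, 'p) ring_scheme \<Rightarrow> ('l, 'm, 'k, 'q) bimodule_scheme \<Rightarrow> ('k, 'n, 's) module_scheme
      \<Rightarrow> ('m \<times> 'n \<Rightarrow>\<^sub>0 int) set" where
  "tensor_relators K M N =
     {frag_of (x \<oplus>\<^bsub>M\<^esub> x', y) - frag_of (x, y) - frag_of (x', y) | x x' y.
        x \<in> carrier M \<and> x' \<in> carrier M \<and> y \<in> carrier N} \<union>
     {frag_of (x, y \<oplus>\<^bsub>N\<^esub> y') - frag_of (x, y) - frag_of (x, y') | x y y'.
        x \<in> carrier M \<and> y \<in> carrier N \<and> y' \<in> carrier N} \<union>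
     {frag_of (x \<bullet>\<^bsub>M\<^esub> k, y) - frag_of (x, k \<odot>\<^bsub>N\<^esub> y) | x k y.
        x \<in> carrier M \<and> k \<in> carrier K \<and> y \<in> carrier N}"

definition tensor_kernel ::
    "('k, 'p) ring_scheme \<Rightarrow> ('l, 'm, 'k, 'q) bimodule_scheme \<Rightarrow> ('k, 'n, 's) module_scheme
      \<Rightarrow> ('m \<times> 'n \<Rightarrow>\<^sub>0 int) set" where
  "tensor_kernel K M N = generate (free_Abelian_group (carrier M \<times> carrier N)) (tensor_relators K M N)"

definition tensor_group ::
    "('k, 'p) ring_scheme \<Rightarrow> ('l, 'm, 'k, 'q) bimodule_scheme \<Rightarrow> ('k, 'n, 's) module_scheme
      \<Rightarrow> ('m, 'n) tens ring" where
  "tensor_group K M N =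
     (let Q = free_Abelian_group (carrier M \<times> carrier N) Mod tensor_kernel K M N
      in \<lparr>carrier = carrier Q, monoid.mult = undefined, one = undefined,
          ring.zero = one Q, ring.add = monoid.mult Q\<rparr>)"

definition pure_tensor ::
    "('k, 'p) ring_scheme \<Rightarrow> ('l, 'm, 'k, 'q) bimodule_scheme \<Rightarrow> ('k, 'n, 's) module_scheme
      \<Rightarrow> 'm \<Rightarrow> 'n \<Rightarrow> ('m, 'n) tens" where
  "pure_tensor K M N x y =
     tensor_kernel K M N #>\<^bsub>free_Abelian_group (carrier M \<times> carrier N)\<^esub> frag_of (x, y)"

text \<open>\<open>tensor_lift G f\<close> is the additive map into \<open>G\<close> with \<open>x \<otimes> y \<mapsto> f x y\<close>, for \<open>f\<close> biadditive and balanced: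
  the additive extension of \<open>f\<close> to the free abelian group is constant on each coset (see
  \<open>tensor_lift_pure\<close> and \<open>tensor_lift_hom\<close> below).\<close>

definition additive_extension :: "('g, 'p) ring_scheme \<Rightarrow> ('m \<Rightarrow> 'n \<Rightarrow> 'g) \<Rightarrow> ('m \<times> 'n \<Rightarrow>\<^sub>0 int) \<Rightarrow> 'g" where
  "additive_extension G f c =
     (\<Oplus>\<^bsub>G\<^esub> p\<in>Poly_Mapping.keys c. add_pow G (poly_mapping.lookup c p) (f (fst p) (snd p)))"

definition tensor_lift :: "('g, 'p) ring_scheme \<Rightarrow> ('m \<Rightarrow> 'n \<Rightarrow> 'g) \<Rightarrow> ('m, 'n) tens \<Rightarrow> 'g" where
  "tensor_lift G f t = the_elem (additive_extension G f ` t)"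

lemma additive_extension_hom:
  assumes G: "abelian_group G" and f: "\<And>x y. x \<in> U \<Longrightarrow> y \<in> V \<Longrightarrow> f x y \<in> carrier G"
  shows "additive_extension G f \<in> hom (free_Abelian_group (U \<times> V)) (add_monoid G)"
    and "\<And>x y. x \<in> U \<Longrightarrow> y \<in> V \<Longrightarrow> additive_extension G f (frag_of (x, y)) = f x y"
proof -
  interpret G: abelian_group G by (rule G)
  have pw: "add_pow G ((k::int)) (f (fst p) (snd p)) \<in> carrier G" if "p \<in> U \<times> V" for k p
    using that f by (auto simp: add_pow_def intro!: G.add.int_pow_closed[unfolded add_pow_def])
  have ext: "additive_extension G f c =
      (\<Oplus>\<^bsub>G\<^esub> p\<in>S. add_pow G (poly_mapping.lookup c p) (f (fst p) (snd p)))"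
    if "Poly_Mapping.keys c \<subseteq> S" "S \<subseteq> U \<times> V" "finite S" for c S
    unfolding additive_extension_def
  proof (rule G.add.finprod_mono_neutral_cong_left[unfolded finsum_def[symmetric]])
    fix p assume "p \<in> S - Poly_Mapping.keys c"
    then have "poly_mapping.lookup c p = 0" by (simp add: in_keys_iff)
    then show "add_pow G (poly_mapping.lookup c p) (f (fst p) (snd p)) = \<zero>\<^bsub>G\<^esub>"
      by (simp add: add_pow_def int_pow_def)
  qed (use that pw in auto)
  show "additive_extension G f \<in> hom (free_Abelian_group (U \<times> V)) (add_monoid G)"
  proof (rule homI)
    fix c d
    assume "c \<in> carrier (free_Abelian_group (U \<times> V))" "d \<in> carrier (free_Abelian_group (U \<times> V))"
    then have c: "Poly_Mapping.keys c \<subseteq> U \<times> V" and d: "Poly_Mapping.keys d \<subseteq> U \<times> V" by auto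
    let ?S = "Poly_Mapping.keys c \<union> Poly_Mapping.keys d"
    have S: "?S \<subseteq> U \<times> V" "finite ?S" using c d by auto
    have "additive_extension G f (c + d) =
        (\<Oplus>\<^bsub>G\<^esub> p\<in>?S. add_pow G (poly_mapping.lookup (c + d) p) (f (fst p) (snd p)))"
      using ext[of "c + d" ?S] S Poly_Mapping.keys_add[of c d] by blast
    also have "\<dots> = (\<Oplus>\<^bsub>G\<^esub> p\<in>?S. add_pow G (poly_mapping.lookup c p) (f (fst p) (snd p))
        \<oplus>\<^bsub>G\<^esub> add_pow G (poly_mapping.lookup d p) (f (fst p) (snd p)))"
    proof (rule G.finsum_cong', goal_cases)
      case (2) then show ?case using pw S by (auto intro!: G.add.m_closed)
    next
      case (3 p)
      then have "f (fst p) (snd p) \<in> carrier G" using S f by (auto simp: mem_Times_iff)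
      then show ?case using G.add.int_pow_mult[of "f (fst p) (snd p)"]
        by (simp add: add_pow_def Poly_Mapping.lookup_add)
    qed auto
    also have "\<dots> = additive_extension G f c \<oplus>\<^bsub>G\<^esub> additive_extension G f d"
      using S pw ext[of c ?S] ext[of d ?S] by (subst G.finsum_addf) auto
    finally show "additive_extension G f (c \<otimes>\<^bsub>free_Abelian_group (U \<times> V)\<^esub> d)
        = additive_extension G f c \<otimes>\<^bsub>add_monoid G\<^esub> additive_extension G f d" by simp
  qed (use pw in \<open>auto simp: additive_extension_def intro!: G.finsum_closed\<close>)
  show "additive_extension G f (frag_of (x, y)) = f x y" if "x \<in> U" "y \<in> V" for x y
    using f[OF that] G.add.int_pow_1[of "f x y"] G.finsum_singleton
    by (simp add: additive_extension_def add_pow_def G.finsum_insert)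
qed

lemma tensor_relators_closed:
  assumes "right_module K M" and "left_module K N"
  shows "tensor_relators K M N \<subseteq> carrier (free_Abelian_group (carrier M \<times> carrier N))"
proof -
  interpret M: right_module K M by fact
  interpret N: left_module K N by fact
  let ?F = "free_Abelian_group (carrier M \<times> carrier N)"
  have d: "c - e \<in> carrier ?F" if "c \<in> carrier ?F" "e \<in> carrier ?F" for c e
    using that keys_diff[of c e] by auto
  have g: "frag_of (x, y) \<in> carrier ?F" if "x \<in> carrier M" "y \<in> carrier N" for x y
    using that by simp
  show ?thesis unfolding tensor_relators_def
    by (auto simp del: carrier_free_Abelian_group_iff simp: M.rsmult_closed N.lsmult_closed intro!: d g)
qed

lemma tensor_lift:
  assumes M: "right_module K M" and N: "left_module K N" and G: "abelian_group G"
    and f: "\<And>x y. \<lbrakk>x \<in> carrier M; y \<in> carrier N\<rbrakk> \<Longrightarrow> f x y \<in> carrier G"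
    and addl: "\<And>x x' y. \<lbrakk>x \<in> carrier M; x' \<in> carrier M; y \<in> carrier N\<rbrakk>
      \<Longrightarrow> f (x \<oplus>\<^bsub>M\<^esub> x') y = f x y \<oplus>\<^bsub>G\<^esub> f x' y"
    and addr: "\<And>x y y'. \<lbrakk>x \<in> carrier M; y \<in> carrier N; y' \<in> carrier N\<rbrakk>
      \<Longrightarrow> f x (y \<oplus>\<^bsub>N\<^esub> y') = f x y \<oplus>\<^bsub>G\<^esub> f x y'"
    and bal: "\<And>x k y. \<lbrakk>x \<in> carrier M; k \<in> carrier K; y \<in> carrier N\<rbrakk>
      \<Longrightarrow> f (x \<bullet>\<^bsub>M\<^esub> k) y = f x (k \<odot>\<^bsub>N\<^esub> y)"
  shows tensor_lift_hom: "tensor_lift G f \<in> hom (add_monoid (tensor_group K M N)) (add_monoid G)"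
    and tensor_lift_pure: "\<And>x y. \<lbrakk>x \<in> carrier M; y \<in> carrier N\<rbrakk>
      \<Longrightarrow> tensor_lift G f (pure_tensor K M N x y) = f x y"
proof -
  interpret G: abelian_group G by (rule G)
  interpret M: right_module K M by (rule M)
  interpret N: left_module K N by (rule N)
  let ?F = "free_Abelian_group (carrier M \<times> carrier N)"
  let ?H = "tensor_kernel K M N"
  let ?h = "additive_extension G f"
  interpret F: comm_group ?F by (rule abelian_free_Abelian_group)
  interpret h: group_hom ?F "add_monoid G" ?h
    using additive_extension_hom(1)[OF G, where f = f, of "carrier M" "carrier N"] f
    by (auto simp: group_hom_def group_hom_axioms_def G.a_group)
  have hf: "?h (frag_of (x, y)) = f x y" if "x \<in> carrier M" "y \<in> carrier N" for x y
    using additive_extension_hom(2)[OF G, where f = f, of "carrier M" "carrier N"] f that by blast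
  have hd: "?h (c - d) = ?h c \<ominus>\<^bsub>G\<^esub> ?h d" if "c \<in> carrier ?F" "d \<in> carrier ?F" for c d
  proof -
    have "c - d = c \<otimes>\<^bsub>?F\<^esub> inv\<^bsub>?F\<^esub> d" using that by simp
    then have "?h (c - d) = ?h c \<otimes>\<^bsub>add_monoid G\<^esub> inv\<^bsub>add_monoid G\<^esub> ?h d"
      using that h.hom_mult h.hom_inv F.inv_closed by metis
    then show ?thesis by (simp add: a_minus_def a_inv_def)
  qed
  have sub: "tensor_relators K M N \<subseteq> carrier ?F"
    by (rule tensor_relators_closed[OF M N])
  have minF: "c - d \<in> carrier ?F" if "c \<in> carrier ?F" "d \<in> carrier ?F" for c d
    using that keys_diff[of c d] by auto
  have c1: "a \<oplus>\<^bsub>G\<^esub> b \<ominus>\<^bsub>G\<^esub> a \<ominus>\<^bsub>G\<^esub> b = \<zero>\<^bsub>G\<^esub>" if "a \<in> carrier G" "b \<in> carrier G" for a b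
    using that G.a_lcomm[of b "\<ominus>\<^bsub>G\<^esub> a" "\<ominus>\<^bsub>G\<^esub> b"]
    by (simp_all add: a_minus_def G.a_assoc G.r_neg)
  have c2: "a \<ominus>\<^bsub>G\<^esub> a = \<zero>\<^bsub>G\<^esub>" if "a \<in> carrier G" for a
    using that by (simp add: a_minus_def G.r_neg)
  have rel: "?h r = \<zero>\<^bsub>G\<^esub>" if "r \<in> tensor_relators K M N" for r
    using that unfolding tensor_relators_def
    by (auto simp: hd hf minF addl addr bal f c1 c2 M.rsmult_closed N.lsmult_closed
        simp del: carrier_free_Abelian_group_iff minus_frag_cmul)
  have "tensor_relators K M N \<subseteq> kernel ?F (add_monoid G) ?h"
    using sub rel by (auto simp: kernel_def simp del: carrier_free_Abelian_group_iff)
  then have ker: "?H \<subseteq> kernel ?F (add_monoid G) ?h"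
    unfolding tensor_kernel_def using F.generate_subgroup_incl h.subgroup_kernel by blast
  have "subgroup ?H ?F" unfolding tensor_kernel_def using F.generate_is_subgroup sub by blast
  then have zero: "\<one>\<^bsub>?F\<^esub> \<in> ?H" and HF: "?H \<subseteq> carrier ?F" and nrm: "?H \<lhd> ?F"
    using subgroup.one_closed subgroup.subset F.subgroup_imp_normal by blast+
  have coset: "tensor_lift G f (?H #>\<^bsub>?F\<^esub> c) = ?h c" if c: "c \<in> carrier ?F" for c
  proof -
    have "?h ` (?H #>\<^bsub>?F\<^esub> c) = {?h c}"
    proof
      show "?h ` (?H #>\<^bsub>?F\<^esub> c) \<subseteq> {?h c}"
      proof
        fix z assume "z \<in> ?h ` (?H #>\<^bsub>?F\<^esub> c)"
        then obtain k where k: "k \<in> ?H" "z = ?h (k \<otimes>\<^bsub>?F\<^esub> c)" by (auto simp: r_coset_def)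
        then have kF: "k \<in> carrier ?F" and "?h k = \<zero>\<^bsub>G\<^esub>" using ker HF by (auto simp: kernel_def)
        moreover have "?h (k \<otimes>\<^bsub>?F\<^esub> c) = ?h k \<oplus>\<^bsub>G\<^esub> ?h c" using h.hom_mult[OF kF c] by simp
        ultimately show "z \<in> {?h c}" using k h.hom_closed[OF c] by simp
      qed
      have "c \<in> ?H #>\<^bsub>?F\<^esub> c" using zero c by (force simp: r_coset_def)
      then show "{?h c} \<subseteq> ?h ` (?H #>\<^bsub>?F\<^esub> c)" by blast
    qed
    then show ?thesis unfolding tensor_lift_def by (metis the_elem_eq)
  qed
  show "tensor_lift G f (pure_tensor K M N x y) = f x y" if "x \<in> carrier M" "y \<in> carrier N" for x y
    using coset[of "frag_of (x, y)"] hf[OF that] that by (simp add: pure_tensor_def)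
  show "tensor_lift G f \<in> hom (add_monoid (tensor_group K M N)) (add_monoid G)"
  proof (rule homI)
    fix s assume "s \<in> carrier (add_monoid (tensor_group K M N))"
    then obtain c where "c \<in> carrier ?F" "s = ?H #>\<^bsub>?F\<^esub> c"
      by (auto simp: tensor_group_def Let_def carrier_FactGroup RCOSETS_def)
    then show "tensor_lift G f s \<in> carrier (add_monoid G)" using coset h.hom_closed by metis
  next
    fix s t assume "s \<in> carrier (add_monoid (tensor_group K M N))" "t \<in> carrier (add_monoid (tensor_group K M N))"
    then obtain c d where c: "c \<in> carrier ?F" "s = ?H #>\<^bsub>?F\<^esub> c" and d: "d \<in> carrier ?F" "t = ?H #>\<^bsub>?F\<^esub> d"
      by (auto simp: tensor_group_def Let_def carrier_FactGroup RCOSETS_def)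
    have "s \<otimes>\<^bsub>add_monoid (tensor_group K M N)\<^esub> t = ?H #>\<^bsub>?F\<^esub> (c \<otimes>\<^bsub>?F\<^esub> d)"
      using normal.rcos_sum[OF nrm c(1) d(1)] c d by (simp add: tensor_group_def Let_def)
    then show "tensor_lift G f (s \<otimes>\<^bsub>add_monoid (tensor_group K M N)\<^esub> t)
        = tensor_lift G f s \<otimes>\<^bsub>add_monoid G\<^esub> tensor_lift G f t"
      using coset h.hom_mult[OF c(1) d(1)] c d F.m_closed[OF c(1) d(1)] by metis
  qed
qed

lemma abelian_group_tensor_group:
  assumes "right_module K M" and "left_module K N"
  shows "abelian_group (tensor_group K M N)"
proof -
  let ?F = "free_Abelian_group (carrier M \<times> carrier N)"
  interpret F: comm_group ?F by (rule abelian_free_Abelian_group)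
  have "subgroup (tensor_kernel K M N) ?F"
    unfolding tensor_kernel_def using F.generate_is_subgroup tensor_relators_closed[OF assms] by blast
  then have "comm_group (?F Mod tensor_kernel K M N)" by (rule F.abelian_FactGroup)
  moreover have "?F Mod tensor_kernel K M N = add_monoid (tensor_group K M N)"
    by (simp add: tensor_group_def Let_def FactGroup_def)
  ultimately have "comm_group (add_monoid (tensor_group K M N))" by simp
  then show ?thesis
    by (auto intro!: abelian_group.intro abelian_monoid.intro abelian_group_axioms.intro
        simp: comm_group_def)
qed

text \<open>For an \<open>L\<close>-\<open>K\<close>-bimodule \<open>M\<close> and a \<open>K\<close>-\<open>R\<close>-bimodule \<open>N\<close>, the \<open>L\<close>-\<open>R\<close>-bimodule \<open>M \<otimes>\<^sub>K N\<close>.\<close>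

definition tensor ::
    "('k, 'p) ring_scheme \<Rightarrow> ('l, 'm, 'k, 'q) bimodule_scheme \<Rightarrow> ('k, 'n, 'r, 's) bimodule_scheme
      \<Rightarrow> ('l, ('m, 'n) tens, 'r) bimodule" where
  "tensor K M N =
     (let G = tensor_group K M N
      in \<lparr>carrier = carrier G, monoid.mult = undefined, one = undefined,
          ring.zero = ring.zero G, ring.add = ring.add G,
          smult = (\<lambda>l. tensor_lift G (\<lambda>x y. pure_tensor K M N (l \<odot>\<^bsub>M\<^esub> x) y)),
          rsmult = (\<lambda>t r. tensor_lift G (\<lambda>x y. pure_tensor K M N x (y \<bullet>\<^bsub>N\<^esub> r)) t)\<rparr>)"

definition tensor_map ::
    "('k, 'p) ring_scheme \<Rightarrow> ('l, 'm', 'k, 'q) bimodule_scheme \<Rightarrow> ('k, 'n', 's) module_scheme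
      \<Rightarrow> ('m \<Rightarrow> 'm') \<Rightarrow> ('n \<Rightarrow> 'n') \<Rightarrow> ('m, 'n) tens \<Rightarrow> ('m', 'n') tens" where
  "tensor_map K M' N' f g = tensor_lift (tensor_group K M' N') (\<lambda>x y. pure_tensor K M' N' (f x) (g y))"

definition tensor_assoc ::
    "('j, 'p) ring_scheme \<Rightarrow> ('k, 'p2) ring_scheme \<Rightarrow> ('l, 'm, 'j, 'q) bimodule_scheme
      \<Rightarrow> ('j, 'n, 'k, 's) bimodule_scheme \<Rightarrow> ('k, 'o, 'r, 'w) bimodule_scheme
      \<Rightarrow> (('m, 'n) tens, 'o) tens \<Rightarrow> ('m, ('n, 'o) tens) tens" where
  "tensor_assoc J K M N P =
     (let H = tensor J M (tensor K N P)
      in tensor_lift H (\<lambda>t z. tensor_lift H (\<lambda>x y. pure_tensor J M (tensor K N P) x (pure_tensor K N P y z)) t))"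


section \<open>Corings\<close>

record ('a, 'm) coring = "('a, 'm, 'a) bimodule" +
  comult :: "'m \<Rightarrow> ('m, 'm) tens"
  counit :: "'m \<Rightarrow> 'a"

locale coring = bimodule A A C
  for A :: "('a, 'p) ring_scheme" (structure) and C :: "('a, 'm, 'q) coring_scheme" (structure) +
  assumes comult_hom: "comult C \<in> bimodule_hom A A C (tensor A C C)"
    and counit_hom: "counit C \<in> bimodule_hom A A C (regular A)"
    and coassoc: "c \<in> carrier C \<Longrightarrow>
      tensor_assoc A A C C C (tensor_map A (tensor A C C) C (comult C) (\<lambda>d. d) (comult C c))
      = tensor_map A C (tensor A C C) (\<lambda>d. d) (comult C) (comult C c)"
    and counit_left: "c \<in> carrier C \<Longrightarrow>
      tensor_lift C (\<lambda>d d'. counit C d \<odot>\<^bsub>C\<^esub> d') (comult C c) = c"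
    and counit_right: "c \<in> carrier C \<Longrightarrow>
      tensor_lift C (\<lambda>d d'. d \<bullet>\<^bsub>C\<^esub> counit C d') (comult C c) = c"

definition grouplike :: "('a, 'p) ring_scheme \<Rightarrow> ('a, 'm, 'q) coring_scheme \<Rightarrow> 'm \<Rightarrow> bool" where
  "grouplike A C x \<longleftrightarrow> x \<in> carrier C \<and> comult C x = pure_tensor A C C x x \<and> counit C x = \<one>\<^bsub>A\<^esub>"

definition coring_iso ::
    "('a, 'p) ring_scheme \<Rightarrow> ('a, 'm, 'q) coring_scheme \<Rightarrow> ('a, 'n, 's) coring_scheme \<Rightarrow> ('m \<Rightarrow> 'n) set" where
  "coring_iso A C D = {f \<in> bimodule_iso A A C D.
     (\<forall>c\<in>carrier C. comult D (f c) = tensor_map A D D f f (comult C c)) \<and>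
     (\<forall>c\<in>carrier C. counit D (f c) = counit C c)}"


section \<open>Ring extensions\<close>

text \<open>Throughout, \<open>B\<close> is the carrier of a subring of \<open>A\<close>.\<close>

abbreviation subring_of :: "('a, 'p) ring_scheme \<Rightarrow> 'a set \<Rightarrow> ('a, 'p) ring_scheme" where
  "subring_of A B \<equiv> A\<lparr>carrier := B\<rparr>"

definition tensor_square :: "('a, 'p) ring_scheme \<Rightarrow> 'a set \<Rightarrow> ('a, ('a, 'a) tens, 'a) bimodule" where
  "tensor_square A B = tensor (subring_of A B) (regular A) (regular A)"

definition square_tensor :: "('a, 'p) ring_scheme \<Rightarrow> 'a set \<Rightarrow> 'a \<Rightarrow> 'a \<Rightarrow> ('a, 'a) tens" where
  "square_tensor A B = pure_tensor (subring_of A B) (regular A) (regular A)"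

definition left_D2 :: "('a, 'p) ring_scheme \<Rightarrow> 'a set \<Rightarrow> bool" where
  "left_D2 A B \<longleftrightarrow> (\<exists>n P. direct_summand (subring_of A B) A P (bimodule_power n (regular A)) \<and>
     bimodule_iso (subring_of A B) A (tensor_square A B) ((bimodule_power n (regular A))\<lparr>carrier := P\<rparr>) \<noteq> {})"

definition right_D2 :: "('a, 'p) ring_scheme \<Rightarrow> 'a set \<Rightarrow> bool" where
  "right_D2 A B \<longleftrightarrow> (\<exists>n P. direct_summand A (subring_of A B) P (bimodule_power n (regular A)) \<and>
     bimodule_iso A (subring_of A B) (tensor_square A B) ((bimodule_power n (regular A))\<lparr>carrier := P\<rparr>) \<noteq> {})"

definition D2_extension :: "('a, 'p) ring_scheme \<Rightarrow> 'a set \<Rightarrow> bool" where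
  "D2_extension A B \<longleftrightarrow> left_D2 A B \<and> right_D2 A B"

definition centralizer :: "('a, 'p) ring_scheme \<Rightarrow> 'a set \<Rightarrow> 'a set" where
  "centralizer A B = {a \<in> carrier A. \<forall>b\<in>B. a \<otimes>\<^bsub>A\<^esub> b = b \<otimes>\<^bsub>A\<^esub> a}"

definition bimodule_End :: "('a, 'p) ring_scheme \<Rightarrow> 'a set \<Rightarrow> ('a \<Rightarrow> 'a) set" where
  "bimodule_End A B = bimodule_hom (subring_of A B) (subring_of A B) (regular A) (regular A)"

text \<open>\<open>T = (A \<otimes>\<^sub>B A)\<^sup>B\<close>, both as an \<open>R\<close>-\<open>R\<close>-bimodule for \<open>R = centralizer A B\<close> (with the actions
  \<open>r \<cdot> t \<cdot> r' = r t\<^sup>1 \<otimes> t\<^sup>2 r'\<close> inherited from \<open>A \<otimes>\<^sub>B A\<close>) and as a ring. The product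
  \<open>t t' = t'\<^sup>1 t\<^sup>1 \<otimes> t\<^sup>2 t'\<^sup>2 = t'\<^sup>1 \<cdot> t \<cdot> t'\<^sup>2\<close> is lifted over \<open>t'\<close>, the expression being
  balanced in \<open>t'\<close> because \<open>t\<close> commutes with \<open>B\<close>.\<close>

definition T_ring :: "('a, 'p) ring_scheme \<Rightarrow> 'a set \<Rightarrow> ('a, ('a, 'a) tens, 'a) bimodule" where
  "T_ring A B = (let Q = tensor_square A B in
     Q\<lparr>carrier := {t \<in> carrier Q. \<forall>b\<in>B. b \<odot>\<^bsub>Q\<^esub> t = t \<bullet>\<^bsub>Q\<^esub> b},
       monoid.mult := (\<lambda>t t'. tensor_lift Q (\<lambda>x y. (x \<odot>\<^bsub>Q\<^esub> t) \<bullet>\<^bsub>Q\<^esub> y) t'),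
       one := square_tensor A B \<one>\<^bsub>A\<^esub> \<one>\<^bsub>A\<^esub>\<rparr>)"

definition right_D2_quasibase ::
    "('a, 'p) ring_scheme \<Rightarrow> 'a set \<Rightarrow> nat \<Rightarrow> (nat \<Rightarrow> 'a \<Rightarrow> 'a) \<Rightarrow> (nat \<Rightarrow> ('a, 'a) tens) \<Rightarrow> bool" where
  "right_D2_quasibase A B n \<gamma> u \<longleftrightarrow>
     (\<forall>j<n. \<gamma> j \<in> bimodule_End A B) \<and> (\<forall>j<n. u j \<in> carrier (T_ring A B)) \<and>
     (\<forall>a\<in>carrier A. \<forall>a'\<in>carrier A. square_tensor A B a a' =
        (\<Oplus>\<^bsub>tensor_square A B\<^esub> j\<in>{..<n}. (a \<otimes>\<^bsub>A\<^esub> \<gamma> j a') \<odot>\<^bsub>tensor_square A B\<^esub> u j))"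

definition T_counit :: "('a, 'p) ring_scheme \<Rightarrow> ('a, 'a) tens \<Rightarrow> 'a" where
  "T_counit A = tensor_lift A (\<lambda>x y. x \<otimes>\<^bsub>A\<^esub> y)"

definition T_comult ::
    "('a, 'p) ring_scheme \<Rightarrow> 'a set \<Rightarrow> nat \<Rightarrow> (nat \<Rightarrow> 'a \<Rightarrow> 'a) \<Rightarrow> (nat \<Rightarrow> ('a, 'a) tens)
      \<Rightarrow> ('a, 'a) tens \<Rightarrow> (('a, 'a) tens, ('a, 'a) tens) tens" where
  "T_comult A B n \<gamma> u t =
     (let R = subring_of A (centralizer A B); T = T_ring A B
      in \<Oplus>\<^bsub>tensor R T T\<^esub> j\<in>{..<n}.
           pure_tensor R T T (tensor_lift (tensor_square A B) (\<lambda>x y. square_tensor A B x (\<gamma> j y)) t) (u j))"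

text \<open>\<open>A \<otimes>\<^sub>R T\<close> with its tensor product structure of an \<open>A\<close>-\<open>R\<close>-bimodule. The canonical coring below
  has the same underlying left \<open>A\<close>-module but its own right action by \<open>A\<close>.\<close>

definition A_tensor_T :: "('a, 'p) ring_scheme \<Rightarrow> 'a set \<Rightarrow> ('a, ('a, ('a, 'a) tens) tens, 'a) bimodule" where
  "A_tensor_T A B = tensor (subring_of A (centralizer A B)) (regular A) (T_ring A B)"

definition AT_tensor :: "('a, 'p) ring_scheme \<Rightarrow> 'a set \<Rightarrow> 'a \<Rightarrow> ('a, 'a) tens \<Rightarrow> ('a, ('a, 'a) tens) tens" where
  "AT_tensor A B = pure_tensor (subring_of A (centralizer A B)) (regular A) (T_ring A B)"

definition coaction ::
    "('a, 'p) ring_scheme \<Rightarrow> 'a set \<Rightarrow> nat \<Rightarrow> (nat \<Rightarrow> 'a \<Rightarrow> 'a) \<Rightarrow> (nat \<Rightarrow> ('a, 'a) tens)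
      \<Rightarrow> 'a \<Rightarrow> ('a, ('a, 'a) tens) tens" where
  "coaction A B n \<gamma> u a = (\<Oplus>\<^bsub>A_tensor_T A B\<^esub> j\<in>{..<n}. AT_tensor A B (\<gamma> j a) (u j))"

definition canonical_bimodule ::
    "('a, 'p) ring_scheme \<Rightarrow> 'a set \<Rightarrow> nat \<Rightarrow> (nat \<Rightarrow> 'a \<Rightarrow> 'a) \<Rightarrow> (nat \<Rightarrow> ('a, 'a) tens)
      \<Rightarrow> ('a, ('a, ('a, 'a) tens) tens, 'a) bimodule" where
  "canonical_bimodule A B n \<gamma> u = (A_tensor_T A B)\<lparr>rsmult :=
     (\<lambda>c a'. tensor_lift (A_tensor_T A B)
        (\<lambda>a t. tensor_lift (A_tensor_T A B)
           (\<lambda>a'0 a'1. AT_tensor A B (a \<otimes>\<^bsub>A\<^esub> a'0) (t \<otimes>\<^bsub>T_ring A B\<^esub> a'1)) (coaction A B n \<gamma> u a')) c)\<rparr>"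

definition canonical_coring ::
    "('a, 'p) ring_scheme \<Rightarrow> 'a set \<Rightarrow> nat \<Rightarrow> (nat \<Rightarrow> 'a \<Rightarrow> 'a) \<Rightarrow> (nat \<Rightarrow> ('a, 'a) tens)
      \<Rightarrow> ('a, ('a, ('a, 'a) tens) tens) coring" where
  "canonical_coring A B n \<gamma> u =
     (let C = canonical_bimodule A B n \<gamma> u
      in bimodule.extend C (coring.fields
        (tensor_lift (tensor A C C) (\<lambda>a t. tensor_lift (tensor A C C)
           (\<lambda>t1 t2. pure_tensor A C C (AT_tensor A B a t1) (AT_tensor A B \<one>\<^bsub>A\<^esub> t2)) (T_comult A B n \<gamma> u t)))
        (tensor_lift A (\<lambda>a t. a \<otimes>\<^bsub>A\<^esub> T_counit A t))))"

definition canonical_element :: "('a, 'p) ring_scheme \<Rightarrow> 'a set \<Rightarrow> ('a, ('a, 'a) tens) tens" where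
  "canonical_element A B = AT_tensor A B \<one>\<^bsub>A\<^esub> \<one>\<^bsub>T_ring A B\<^esub>"

definition coinvariants ::
    "('a, 'p) ring_scheme \<Rightarrow> 'a set \<Rightarrow> nat \<Rightarrow> (nat \<Rightarrow> 'a \<Rightarrow> 'a) \<Rightarrow> (nat \<Rightarrow> ('a, 'a) tens) \<Rightarrow> 'a set" where
  "coinvariants A B n \<gamma> u = {a \<in> carrier A. coaction A B n \<gamma> u a = AT_tensor A B a \<one>\<^bsub>T_ring A B\<^esub>}"

definition Sweedler_coring :: "('a, 'p) ring_scheme \<Rightarrow> 'a set \<Rightarrow> ('a, ('a, 'a) tens) coring" where
  "Sweedler_coring A B =
     (let Q = tensor_square A B
      in bimodule.extend Q (coring.fields
        (tensor_lift (tensor A Q Q)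
           (\<lambda>a a'. pure_tensor A Q Q (square_tensor A B a \<one>\<^bsub>A\<^esub>) (square_tensor A B \<one>\<^bsub>A\<^esub> a')))
        (tensor_lift A (\<lambda>a a'. a \<otimes>\<^bsub>A\<^esub> a'))))"

definition can_map :: "('a, 'm, 'q) coring_scheme \<Rightarrow> 'm \<Rightarrow> ('a, 'a) tens \<Rightarrow> 'm" where
  "can_map C x = tensor_lift C (\<lambda>a a'. (a \<odot>\<^bsub>C\<^esub> x) \<bullet>\<^bsub>C\<^esub> a')"

definition Galois_coring ::
    "('a, 'p) ring_scheme \<Rightarrow> 'a set \<Rightarrow> ('a, 'm, 'q) coring_scheme \<Rightarrow> 'm \<Rightarrow> bool" where
  "Galois_coring A B C x \<longleftrightarrow> coring A C \<and> grouplike A C x \<and>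
     (\<forall>b\<in>B. b \<odot>\<^bsub>C\<^esub> x = x \<bullet>\<^bsub>C\<^esub> b) \<and> can_map C x \<in> coring_iso A (Sweedler_coring A B) C"

definition balanced_right :: "('a, 'p) ring_scheme \<Rightarrow> 'a set \<Rightarrow> bool" where
  "balanced_right A B \<longleftrightarrow>
     (\<forall>f \<in> hom (add_monoid A) (add_monoid A).
        (\<forall>\<phi> \<in> right_module_hom (subring_of A B) (regular A) (regular A).
           \<forall>a\<in>carrier A. f (\<phi> a) = \<phi> (f a)) \<longrightarrow>
        (\<exists>b\<in>B. \<forall>a\<in>carrier A. f a = a \<otimes>\<^bsub>A\<^esub> b))"

definition exact_at ::
    "('m, 'p) ring_scheme \<Rightarrow> ('n, 'q) ring_scheme \<Rightarrow> ('o, 's) ring_scheme \<Rightarrow> ('m \<Rightarrow> 'n) \<Rightarrow> ('n \<Rightarrow> 'o) \<Rightarrow> bool" where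
  "exact_at N1 N2 N3 f g \<longleftrightarrow> f ` carrier N1 = {y \<in> carrier N2. g y = \<zero>\<^bsub>N3\<^esub>}"

text \<open>A right \<open>K\<close>-module \<open>M\<close> is faithfully flat if a sequence \<open>N1 \<rightarrow> N2 \<rightarrow> N3\<close> of left \<open>K\<close>-modules is exact
  if and only if \<open>M \<otimes>\<^sub>K N1 \<rightarrow> M \<otimes>\<^sub>K N2 \<rightarrow> M \<otimes>\<^sub>K N3\<close> is. HOL cannot quantify over types inside a
  formula, so the modules have carriers in the type \<open>(nat \<Rightarrow> 'k) set\<close>, where \<open>K\<close> has elements of
  type \<open>'k\<close>. Up to isomorphism this covers every subquotient of a countable power of \<open>K\<close> (a set of
  cosets), in particular all left ideals and all countably generated left modules. The restriction
  is harmless: flatness follows from exactness on \<open>0 \<rightarrow> I \<rightarrow> K\<close> for left ideals \<open>I\<close>, and a flat \<open>M\<close> is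
  faithfully flat as soon as \<open>M \<otimes>\<^sub>K N \<noteq> 0\<close> for all cyclic \<open>N \<noteq> 0\<close>; so the definition agrees with
  the one over all left \<open>K\<close>-modules.\<close>

definition faithfully_flat_right ::
    "('k, 'p) ring_scheme \<Rightarrow> ('l, 'm, 'k, 'q) bimodule_scheme \<Rightarrow> bool" where
  "faithfully_flat_right K M \<longleftrightarrow>
     (\<forall>(N1 :: ('k, (nat \<Rightarrow> 'k) set) module) (N2 :: ('k, (nat \<Rightarrow> 'k) set) module)
       (N3 :: ('k, (nat \<Rightarrow> 'k) set) module).
        left_module K N1 \<and> left_module K N2 \<and> left_module K N3 \<longrightarrow>
        (\<forall>f \<in> left_module_hom K N1 N2. \<forall>g \<in> left_module_hom K N2 N3.
           exact_at N1 N2 N3 f g \<longleftrightarrow>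
           exact_at (tensor_group K M N1) (tensor_group K M N2) (tensor_group K M N3)
             (tensor_map K M N2 (\<lambda>x. x) f) (tensor_map K M N3 (\<lambda>x. x) g)))"

end

theory Submission
  imports Defs
begin

text \<open>
  Write \<open>Q\<close> for \<open>A \<otimes>\<^sub>B A\<close>. The reason for the Galois property is that the left \<open>A\<close>-linear map
  \<open>canon : Q \<rightarrow> A \<otimes>\<^sub>R T\<close>, \<open>a \<otimes> a' \<mapsto> \<Sum>\<^sub>j a \<gamma>\<^sub>j(a') \<otimes> u\<^sub>j\<close>, is bijective with inverse
  \<open>evaluate : a \<otimes> t \<mapsto> a t\<close>. That \<open>evaluate \<circ> canon\<close> is the identity is the quasibase equation. For the
  other composite, \<open>canon\<close> sends \<open>t \<in> T\<close> to \<open>\<Sum>\<^sub>j t\<^sup>1 \<gamma>\<^sub>j(t\<^sup>2) \<otimes> u\<^sub>j\<close>, and since \<open>t\<close> commutes with \<open>B\<close>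
  the coefficients \<open>t\<^sup>1 \<gamma>\<^sub>j(t\<^sup>2)\<close> lie in \<open>R\<close> (\<open>coefficient_R\<close>); so they cross \<open>\<otimes>\<^sub>R\<close> and the quasibase
  equation gives \<open>1 \<otimes> t\<close> (\<open>canon_T\<close>).

  All of the structure on \<open>\<C> = A \<otimes>\<^sub>R T\<close> is the structure of \<open>Q\<close> transported along \<open>canon\<close>. The product of
  \<open>t\<close> and \<open>t'\<close> in \<open>T\<close> is \<open>t'\<^sup>1 t t'\<^sup>2\<close>, so \<open>(a \<otimes> t) \<cdot> a'\<close> is the image of \<open>a t a'\<close>
  (\<open>coaction_action\<close>); in particular the right action is well defined. The comultiplication
  corresponds to \<open>a \<otimes> a' \<mapsto> (a \<otimes> 1) \<otimes>\<^sub>A (1 \<otimes> a')\<close>, again by the quasibase equation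
  (\<open>split_expansion\<close>, \<open>comult_pure\<close>), and the counit to multiplication. As the bimodule \<open>\<C>\<close> is generated
  by the grouplike element \<open>x = canon (1 \<otimes> 1)\<close>, the coring axioms need to be checked on elements \<open>a x a'\<close>
  only (\<open>coring_generated_by_grouplike\<close>), and \<open>canon\<close> is an isomorphism from the Sweedler coring.

  Pulled back along \<open>canon\<close>, the condition \<open>\<rho>(a) = a \<otimes> 1\<^sub>T\<close> reads \<open>1 \<otimes> a = a \<otimes> 1\<close> in \<open>Q\<close>. If \<open>A\<^sub>B\<close> is
  balanced, this puts \<open>a\<close> into \<open>B\<close> because right multiplication by \<open>a\<close> then commutes with
  \<open>End(A\<^sub>B)\<close> (\<open>square_commute_balanced\<close>). If \<open>A\<^sub>B\<close> is faithfully flat, it does so because the map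
  \<open>B \<rightarrow> A / B\<close>, \<open>b \<mapsto> b a + B\<close>, becomes zero after tensoring with \<open>A\<close>
  (\<open>square_commute_faithfully_flat\<close>).

  A quasibase exists because \<open>Q\<close> embeds as a direct summand into a power of \<open>A\<close>: the coordinates of the
  embedding give the \<open>\<gamma>\<^sub>j\<close>, and retracting the standard basis vectors to \<open>Q\<close> gives the \<open>u\<^sub>j\<close>
  (\<open>right_D2_quasibase_exists\<close>).
\<close>


section \<open>Additive maps\<close>

lemma homD:
  assumes "f \<in> hom (add_monoid M) (add_monoid N)"
  shows "x \<in> carrier M \<Longrightarrow> f x \<in> carrier N"
    and "\<lbrakk>x \<in> carrier M; y \<in> carrier M\<rbrakk> \<Longrightarrow> f (x \<oplus>\<^bsub>M\<^esub> y) = f x \<oplus>\<^bsub>N\<^esub> f y"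
  using assms by (auto simp: hom_def)

lemma additive_finsum:
  assumes M: "abelian_group M" and N: "abelian_group N"
    and f: "f \<in> hom (add_monoid M) (add_monoid N)" and g: "g \<in> I \<rightarrow> carrier M" and I: "finite I"
  shows "f (\<Oplus>\<^bsub>M\<^esub>i\<in>I. g i) = (\<Oplus>\<^bsub>N\<^esub>i\<in>I. f (g i))"
proof -
  interpret M: abelian_group M by fact
  interpret N: abelian_group N by fact
  have z: "f \<zero>\<^bsub>M\<^esub> = \<zero>\<^bsub>N\<^esub>"
    using f M.a_group N.a_group hom_one[of f "add_monoid M" "add_monoid N"] by simp
  show ?thesis using I g
  proof (induction I)
    case empty then show ?case by (simp add: z)
  next
    case (insert i I)
    then have "g \<in> I \<rightarrow> carrier M" "g i \<in> carrier M" by auto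
    moreover from this have "f \<circ> g \<in> I \<rightarrow> carrier N" "f (g i) \<in> carrier N" using homD(1)[OF f] by (auto simp: Pi_def)
    ultimately show ?case using insert
      by (simp add: homD(2)[OF f] M.finsum_closed M.finsum_insert N.finsum_insert comp_def)
  qed
qed

lemma additive_comp:
  assumes "f \<in> hom (add_monoid M) (add_monoid N)" and "g \<in> hom (add_monoid N) (add_monoid P)"
  shows "(\<lambda>x. g (f x)) \<in> hom (add_monoid M) (add_monoid P)"
  using hom_compose[OF assms] by (simp add: comp_def)

lemma additive_id: "(\<lambda>x. x) \<in> hom (add_monoid M) (add_monoid M)"
  by (simp add: hom_def)

lemma additive_inv:
  assumes M: "abelian_group M" and N: "abelian_group N"
    and f: "f \<in> hom (add_monoid M) (add_monoid N)" and x: "x \<in> carrier M"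
  shows "f (\<ominus>\<^bsub>M\<^esub> x) = \<ominus>\<^bsub>N\<^esub> f x"
proof -
  interpret group_hom "add_monoid M" "add_monoid N" f
    using f abelian_group.a_group[OF M] abelian_group.a_group[OF N]
    by (auto simp: group_hom_def group_hom_axioms_def)
  show ?thesis using hom_inv x by (simp add: a_inv_def)
qed

lemma additive_plus:
  assumes "abelian_group N" and "f \<in> hom (add_monoid M) (add_monoid N)" and "g \<in> hom (add_monoid M) (add_monoid N)"
  shows "(\<lambda>x. f x \<oplus>\<^bsub>N\<^esub> g x) \<in> hom (add_monoid M) (add_monoid N)"
proof -
  interpret abelian_group N by fact
  show ?thesis
    by (rule homI) (simp_all add: homD[OF assms(2)] homD[OF assms(3)] a_ac)
qed

lemma additive_sum:
  assumes G: "abelian_group G" and f: "\<And>j. j \<in> I \<Longrightarrow> f j \<in> hom (add_monoid M) (add_monoid G)" and I: "finite I"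
  shows "(\<lambda>x. \<Oplus>\<^bsub>G\<^esub>j\<in>I. f j x) \<in> hom (add_monoid M) (add_monoid G)"
proof -
  interpret G: abelian_group G by fact
  show ?thesis
  proof (rule homI, simp_all)
    fix x assume "x \<in> carrier M"
    then show "(\<Oplus>\<^bsub>G\<^esub>j\<in>I. f j x) \<in> carrier G" using homD(1)[OF f] by (intro G.finsum_closed) auto
  next
    fix x y assume xy: "x \<in> carrier M" "y \<in> carrier M"
    have "(\<Oplus>\<^bsub>G\<^esub>j\<in>I. f j (x \<oplus>\<^bsub>M\<^esub> y)) = (\<Oplus>\<^bsub>G\<^esub>j\<in>I. f j x \<oplus>\<^bsub>G\<^esub> f j y)"
      using xy homD[OF f] by (intro G.finsum_cong') auto
    also have "\<dots> = (\<Oplus>\<^bsub>G\<^esub>j\<in>I. f j x) \<oplus>\<^bsub>G\<^esub> (\<Oplus>\<^bsub>G\<^esub>j\<in>I. f j y)"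
      using xy homD(1)[OF f] I by (intro G.finsum_addf) auto
    finally show "(\<Oplus>\<^bsub>G\<^esub>j\<in>I. f j (x \<oplus>\<^bsub>M\<^esub> y)) = (\<Oplus>\<^bsub>G\<^esub>j\<in>I. f j x) \<oplus>\<^bsub>G\<^esub> (\<Oplus>\<^bsub>G\<^esub>j\<in>I. f j y)" .
  qed
qed

lemma additive_eq_on_generate:
  assumes M: "abelian_group M" and N: "abelian_group N"
    and f: "f \<in> hom (add_monoid M) (add_monoid N)" and g: "g \<in> hom (add_monoid M) (add_monoid N)"
    and S: "S \<subseteq> carrier M" and eq: "\<And>x. x \<in> S \<Longrightarrow> f x = g x" and c: "c \<in> generate (add_monoid M) S"
  shows "f c = g c"
proof -
  interpret M: abelian_group M by fact
  have mem: "x \<in> carrier M" if "x \<in> generate (add_monoid M) S" for x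
    using M.add.generate_incl[of S] S that by auto
  show ?thesis using c
  proof (induction rule: generate.induct)
    case one
    show ?case using hom_one[OF f] hom_one[OF g] abelian_group.a_group[OF M] abelian_group.a_group[OF N] by simp
  next
    case (incl h) then show ?case by (rule eq)
  next
    case (inv h)
    then show ?case using additive_inv[OF M N f] additive_inv[OF M N g] S eq by (auto simp: a_inv_def)
  next
    case (eng h h')
    then show ?case using homD(2)[OF f mem mem] homD(2)[OF g mem mem] by simp
  qed
qed

lemma abelian_group_restrict_scheme:
  assumes "abelian_group G" "carrier H = carrier G" "\<zero>\<^bsub>H\<^esub> = \<zero>\<^bsub>G\<^esub>" "ring.add H = ring.add G"
  shows "abelian_group H"
proof -
  interpret abelian_group G by fact
  show ?thesis
    by (rule abelian_groupI) (auto simp: assms(2-) a_ac intro: bexI[of _ "\<ominus>\<^bsub>G\<^esub> x" for x] l_neg)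
qed

text \<open>Sums, and below lifts, depend only on the additive structure of their target. This identifies
  them for records with different further fields: a tensor product as a group or as a bimodule, and a
  coring or its underlying bimodule.\<close>

lemma finsum_restrict_scheme:
  assumes "carrier G = carrier H" "\<zero>\<^bsub>G\<^esub> = \<zero>\<^bsub>H\<^esub>" "ring.add G = ring.add H"
  shows "finsum G f I = finsum H f I"
  using assms by (simp add: finsum_def finprod_def)

lemma tensor_lift_restrict_scheme:
  assumes "carrier G = carrier H" "\<zero>\<^bsub>G\<^esub> = \<zero>\<^bsub>H\<^esub>" "ring.add G = ring.add H"
  shows "tensor_lift G f = tensor_lift H f"
proof -
  have "add_pow G (k::int) a = add_pow H k a" for k a
    using assms by (simp add: add_pow_def int_pow_def nat_pow_def m_inv_def Let_def)
  then have "additive_extension G f = additive_extension H f"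
    by (intro ext) (simp add: additive_extension_def finsum_restrict_scheme[OF assms])
  then show ?thesis by (intro ext) (simp add: tensor_lift_def)
qed


section \<open>Homomorphisms of modules and bimodules\<close>

lemma lsmult_hom:
  assumes "left_module K M" "k \<in> carrier K"
  shows "(\<lambda>x. k \<odot>\<^bsub>M\<^esub> x) \<in> hom (add_monoid M) (add_monoid M)"
  using assms left_module.lsmult_closed left_module.lsmult_add by (force intro!: homI)

lemma rsmult_hom:
  assumes "right_module K M" "k \<in> carrier K"
  shows "(\<lambda>x. x \<bullet>\<^bsub>M\<^esub> k) \<in> hom (add_monoid M) (add_monoid M)"
  using assms right_module.rsmult_closed right_module.rsmult_add by (force intro!: homI)

lemma right_module_homD:
  assumes "f \<in> right_module_hom K M N"
  shows "f \<in> hom (add_monoid M) (add_monoid N)"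
    and "\<lbrakk>k \<in> carrier K; x \<in> carrier M\<rbrakk> \<Longrightarrow> f (x \<bullet>\<^bsub>M\<^esub> k) = f x \<bullet>\<^bsub>N\<^esub> k"
  using assms by (auto simp: right_module_hom_def)

lemma left_module_homD:
  assumes "f \<in> left_module_hom K M N"
  shows "f \<in> hom (add_monoid M) (add_monoid N)"
    and "\<lbrakk>k \<in> carrier K; x \<in> carrier M\<rbrakk> \<Longrightarrow> f (k \<odot>\<^bsub>M\<^esub> x) = k \<odot>\<^bsub>N\<^esub> f x"
  using assms by (auto simp: left_module_hom_def)

lemma bimodule_homD:
  assumes "f \<in> bimodule_hom L R M N"
  shows "f \<in> left_module_hom L M N" and "f \<in> right_module_hom R M N"
    and "f \<in> hom (add_monoid M) (add_monoid N)"
    and "\<lbrakk>k \<in> carrier L; x \<in> carrier M\<rbrakk> \<Longrightarrow> f (k \<odot>\<^bsub>M\<^esub> x) = k \<odot>\<^bsub>N\<^esub> f x"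
    and "\<lbrakk>r \<in> carrier R; x \<in> carrier M\<rbrakk> \<Longrightarrow> f (x \<bullet>\<^bsub>M\<^esub> r) = f x \<bullet>\<^bsub>N\<^esub> r"
  using assms by (auto simp: bimodule_hom_def left_module_hom_def right_module_hom_def)

lemma bimodule_homI:
  assumes "f \<in> hom (add_monoid M) (add_monoid N)"
    and "\<And>k x. \<lbrakk>k \<in> carrier L; x \<in> carrier M\<rbrakk> \<Longrightarrow> f (k \<odot>\<^bsub>M\<^esub> x) = k \<odot>\<^bsub>N\<^esub> f x"
    and "\<And>r x. \<lbrakk>r \<in> carrier R; x \<in> carrier M\<rbrakk> \<Longrightarrow> f (x \<bullet>\<^bsub>M\<^esub> r) = f x \<bullet>\<^bsub>N\<^esub> r"
  shows "f \<in> bimodule_hom L R M N"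
  using assms by (auto simp: bimodule_hom_def left_module_hom_def right_module_hom_def)

lemma bimodule_hom_comp:
  assumes f: "f \<in> bimodule_hom L R' M N" and g: "g \<in> bimodule_hom L R' N P"
    and h: "\<And>c. c \<in> carrier M \<Longrightarrow> h c = g (f c)" and M: "bimodule L R' M"
  shows "h \<in> bimodule_hom L R' M P"
proof -
  interpret M: bimodule L R' M by fact
  show ?thesis
    by (intro bimodule_homI homI)
      (simp_all add: h homD[OF bimodule_homD(3)[OF f]] homD[OF bimodule_homD(3)[OF g]] bimodule_homD(4,5)[OF f]
        bimodule_homD(4,5)[OF g] M.lsmult_closed M.rsmult_closed)
qed

text \<open>Transport of structure. The scalar actions on \<open>N\<close> are only known to correspond to those on \<open>M\<close>
  under \<open>f\<close>; that they are actions at all is part of the conclusion.\<close>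

lemma bimodule_of_bijection:
  assumes M: "bimodule L R M" and N: "abelian_group N" and bij: "bij_betw f (carrier M) (carrier N)"
    and f: "f \<in> hom (add_monoid M) (add_monoid N)"
    and l: "\<And>k x. \<lbrakk>k \<in> carrier L; x \<in> carrier M\<rbrakk> \<Longrightarrow> k \<odot>\<^bsub>N\<^esub> f x = f (k \<odot>\<^bsub>M\<^esub> x)"
    and r: "\<And>k x. \<lbrakk>k \<in> carrier R; x \<in> carrier M\<rbrakk> \<Longrightarrow> f x \<bullet>\<^bsub>N\<^esub> k = f (x \<bullet>\<^bsub>M\<^esub> k)"
  shows "bimodule L R N"
proof -
  interpret M: bimodule L R M by fact
  interpret N: abelian_group N by fact
  have rings: "ring L" "ring R" by unfold_locales
  have N_eq: "carrier N = f ` carrier M" using bij by (simp add: bij_betw_def)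
  have add: "f x \<oplus>\<^bsub>N\<^esub> f y = f (x \<oplus>\<^bsub>M\<^esub> y)" if "x \<in> carrier M" "y \<in> carrier M" for x y
    using homD(2)[OF f that] by simp
  show ?thesis
    by (intro bimodule.intro left_module.intro right_module.intro bimodule_axioms.intro rings
        left_module_axioms.intro right_module_axioms.intro N)
      (auto simp: N_eq add l r M.lsmult_closed M.lsmult_add M.lsmult_add_scalar M.lsmult_assoc M.lsmult_one
        M.rsmult_closed M.rsmult_add M.rsmult_add_scalar M.rsmult_assoc M.rsmult_one M.bimodule_assoc)
qed

lemma bimodule_restrict_scalars:
  assumes M: "bimodule A A' M" and "ring A" and "ring A'" and U: "subring U A" and V: "subring V A'"
  shows "bimodule (A\<lparr>carrier := U\<rparr>) (A'\<lparr>carrier := V\<rparr>) M"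
proof -
  interpret M: bimodule A A' M by fact
  have r: "ring (A\<lparr>carrier := U\<rparr>)" "ring (A'\<lparr>carrier := V\<rparr>)"
    using assms ring.subring_is_ring by auto
  have U': "x \<in> carrier A" if "x \<in> U" for x using subringE(1)[OF U] that by auto
  have V': "y \<in> carrier A'" if "y \<in> V" for y using subringE(1)[OF V] that by auto
  show ?thesis
    by (intro bimodule.intro left_module.intro right_module.intro bimodule_axioms.intro r
        left_module_axioms.intro right_module_axioms.intro M.M.abelian_group_axioms)
      (simp_all add: U' V' M.lsmult_closed M.lsmult_add M.lsmult_add_scalar M.lsmult_assoc M.lsmult_one[simplified]
        M.rsmult_closed M.rsmult_add M.rsmult_add_scalar M.rsmult_assoc M.rsmult_one[simplified] M.bimodule_assoc)
qed

lemma regular_simps [simp]: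
  "carrier (regular A) = carrier A" "\<zero>\<^bsub>regular A\<^esub> = \<zero>\<^bsub>A\<^esub>" "ring.add (regular A) = ring.add A"
  "smult (regular A) = monoid.mult A" "rsmult (regular A) = monoid.mult A"
  by (simp_all add: regular_def)

lemma regular_bimodule:
  assumes "ring A"
  shows "bimodule A A (regular A)"
proof -
  interpret ring A by fact
  have g: "abelian_group (regular A)" by (rule abelian_group_restrict_scheme[OF abelian_group_axioms]) simp_all
  show ?thesis
    by (intro bimodule.intro left_module.intro right_module.intro bimodule_axioms.intro assms
        left_module_axioms.intro right_module_axioms.intro g)
      (simp_all add: l_distr r_distr m_assoc)
qed


section \<open>Tensor products\<close>

lemma tensor_simps:
  "carrier (tensor K M N) = carrier (tensor_group K M N)"
  "\<zero>\<^bsub>tensor K M N\<^esub> = \<zero>\<^bsub>tensor_group K M N\<^esub>"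
  "ring.add (tensor K M N) = ring.add (tensor_group K M N)"
  by (simp_all add: tensor_def Let_def)

lemma hom_from_tensor:
  "hom (add_monoid (tensor K M N)) Z = hom (add_monoid (tensor_group K M N)) Z"
  by (simp add: hom_def tensor_simps)

lemma hom_into_tensor:
  "hom Z (add_monoid (tensor K M N)) = hom Z (add_monoid (tensor_group K M N))"
  by (simp add: hom_def tensor_simps)

lemma tensor_restrict_scheme:
  assumes M: "carrier M' = carrier M" "ring.add M' = ring.add M" "rsmult M' = rsmult M"
    and N: "carrier N' = carrier N" "ring.add N' = ring.add N" "smult N' = smult N"
  shows pure_tensor_restrict_scheme: "pure_tensor K M' N' = pure_tensor K M N"
    and tensor_group_restrict_scheme: "tensor_group K M' N' = tensor_group K M N"
proof -
  have "tensor_kernel K M' N' = tensor_kernel K M N"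
    by (simp add: tensor_kernel_def tensor_relators_def M N)
  then show "pure_tensor K M' N' = pure_tensor K M N" "tensor_group K M' N' = tensor_group K M N"
    by (auto simp: pure_tensor_def[abs_def] tensor_group_def M N)
qed

text \<open>The hypotheses of the universal property of \<open>M \<otimes>\<^sub>K N\<close>. Additivity in each argument is stated by
  \<^const>\<open>hom\<close>, so that balanced maps can be obtained by composing additive maps.\<close>

definition balanced_map ::
    "('k, 'p) ring_scheme \<Rightarrow> ('l, 'm, 'k, 'q) bimodule_scheme \<Rightarrow> ('k, 'n, 's) module_scheme
      \<Rightarrow> ('g, 'w) ring_scheme \<Rightarrow> ('m \<Rightarrow> 'n \<Rightarrow> 'g) \<Rightarrow> bool" where
  "balanced_map K M N G f \<longleftrightarrow>
     (\<forall>x\<in>carrier M. f x \<in> hom (add_monoid N) (add_monoid G)) \<and>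
     (\<forall>y\<in>carrier N. (\<lambda>x. f x y) \<in> hom (add_monoid M) (add_monoid G)) \<and>
     (\<forall>x\<in>carrier M. \<forall>k\<in>carrier K. \<forall>y\<in>carrier N. f (x \<bullet>\<^bsub>M\<^esub> k) y = f x (k \<odot>\<^bsub>N\<^esub> y))"

lemma balanced_mapI:
  assumes "\<And>x. x \<in> carrier M \<Longrightarrow> f x \<in> hom (add_monoid N) (add_monoid G)"
    and "\<And>y. y \<in> carrier N \<Longrightarrow> (\<lambda>x. f x y) \<in> hom (add_monoid M) (add_monoid G)"
    and "\<And>x k y. \<lbrakk>x \<in> carrier M; k \<in> carrier K; y \<in> carrier N\<rbrakk> \<Longrightarrow> f (x \<bullet>\<^bsub>M\<^esub> k) y = f x (k \<odot>\<^bsub>N\<^esub> y)"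
  shows "balanced_map K M N G f"
  using assms by (auto simp: balanced_map_def)

lemma balanced_map_comp:
  assumes "balanced_map K M N G f" and "g \<in> hom (add_monoid G) (add_monoid G')"
  shows "balanced_map K M N G' (\<lambda>x y. g (f x y))"
  using assms by (auto simp: balanced_map_def dest: additive_comp)

locale tensor_pair = M: right_module K M + N: left_module K N for K M N

begin

abbreviation "F \<equiv> free_Abelian_group (carrier M \<times> carrier N)"
abbreviation "H \<equiv> tensor_kernel K M N"
abbreviation pt (infixl "\<star>" 75) where "x \<star> y \<equiv> pure_tensor K M N x y"

sublocale T: abelian_group "tensor_group K M N"
  by (rule abelian_group_tensor_group) unfold_locales

lemma M_ax: "right_module K M" and N_ax: "left_module K N"
  by unfold_locales

lemma kernel_normal: "H \<lhd> F"
proof -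
  interpret F: comm_group F by (rule abelian_free_Abelian_group)
  have "subgroup H F"
    unfolding tensor_kernel_def using F.generate_is_subgroup tensor_relators_closed[OF M_ax N_ax] by blast
  then show ?thesis by (rule F.subgroup_imp_normal)
qed

lemma coset_eq:
  assumes "c \<in> carrier F" "d \<in> carrier F" "c - d \<in> H"
  shows "H #>\<^bsub>F\<^esub> c = H #>\<^bsub>F\<^esub> d"
proof -
  interpret F: comm_group F by (rule abelian_free_Abelian_group)
  have "c \<in> H #>\<^bsub>F\<^esub> d" using assms(3) unfolding r_coset_def by (force intro: exI[of _ "c - d"])
  then show ?thesis
    using F.repr_independence[OF _ assms(2)] kernel_normal normal_imp_subgroup by blast
qed

lemma coset_add:
  assumes "c \<in> carrier F" "d \<in> carrier F"
  shows "(H #>\<^bsub>F\<^esub> c) \<oplus>\<^bsub>tensor_group K M N\<^esub> (H #>\<^bsub>F\<^esub> d) = H #>\<^bsub>F\<^esub> (c + d)"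
  using normal.rcos_sum[OF kernel_normal assms] by (simp add: tensor_group_def Let_def)

lemma coset_closed: "c \<in> carrier F \<Longrightarrow> H #>\<^bsub>F\<^esub> c \<in> carrier (tensor_group K M N)"
  by (auto simp: tensor_group_def Let_def FactGroup_def RCOSETS_def)

lemma relator_kernel: "c \<in> tensor_relators K M N \<Longrightarrow> c \<in> H"
  unfolding tensor_kernel_def by (rule generate.incl)

lemma frag_closed:
  assumes "x \<in> carrier M" "y \<in> carrier N"
  shows "frag_of (x, y) \<in> carrier F"
  using assms by simp

lemma frag_add_closed: "c \<in> carrier F \<Longrightarrow> d \<in> carrier F \<Longrightarrow> c + d \<in> carrier F"
  using Poly_Mapping.keys_add[of c d] by auto

lemma pure_closed: "x \<in> carrier M \<Longrightarrow> y \<in> carrier N \<Longrightarrow> x \<star> y \<in> carrier (tensor_group K M N)"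
  unfolding pure_tensor_def by (rule coset_closed[OF frag_closed])

lemma pure_add_left:
  assumes "x \<in> carrier M" "x' \<in> carrier M" "y \<in> carrier N"
  shows "(x \<oplus>\<^bsub>M\<^esub> x') \<star> y = x \<star> y \<oplus>\<^bsub>tensor_group K M N\<^esub> x' \<star> y"
proof -
  have "frag_of (x \<oplus>\<^bsub>M\<^esub> x', y) - (frag_of (x, y) + frag_of (x', y)) \<in> H"
    using assms by (intro relator_kernel) (unfold tensor_relators_def diff_diff_eq[symmetric], blast)
  then show ?thesis unfolding pure_tensor_def
    by (subst coset_add) (use assms in \<open>intro coset_eq frag_closed frag_add_closed; simp\<close>)+
qed

lemma pure_add_right:
  assumes "x \<in> carrier M" "y \<in> carrier N" "y' \<in> carrier N"
  shows "x \<star> (y \<oplus>\<^bsub>N\<^esub> y') = x \<star> y \<oplus>\<^bsub>tensor_group K M N\<^esub> x \<star> y'"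
proof -
  have "frag_of (x, y \<oplus>\<^bsub>N\<^esub> y') - (frag_of (x, y) + frag_of (x, y')) \<in> H"
    using assms by (intro relator_kernel) (unfold tensor_relators_def diff_diff_eq[symmetric], blast)
  then show ?thesis unfolding pure_tensor_def
    by (subst coset_add) (use assms in \<open>intro coset_eq frag_closed frag_add_closed; simp\<close>)+
qed

lemma pure_balanced:
  assumes "x \<in> carrier M" "k \<in> carrier K" "y \<in> carrier N"
  shows "(x \<bullet>\<^bsub>M\<^esub> k) \<star> y = x \<star> (k \<odot>\<^bsub>N\<^esub> y)"
proof -
  have "frag_of (x \<bullet>\<^bsub>M\<^esub> k, y) - frag_of (x, k \<odot>\<^bsub>N\<^esub> y) \<in> H"
    using assms by (intro relator_kernel) (unfold tensor_relators_def, blast)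
  then show ?thesis unfolding pure_tensor_def
    using assms M.rsmult_closed N.lsmult_closed by (intro coset_eq frag_closed)
qed

lemma pure_left_hom:
  "y \<in> carrier N \<Longrightarrow> (\<lambda>x. x \<star> y) \<in> hom (add_monoid M) (add_monoid (tensor_group K M N))"
  by (auto intro!: homI pure_closed simp: pure_add_left)

lemma pure_right_hom:
  "x \<in> carrier M \<Longrightarrow> (\<lambda>y. x \<star> y) \<in> hom (add_monoid N) (add_monoid (tensor_group K M N))"
  by (auto intro!: homI pure_closed simp: pure_add_right)

text \<open>No case for negatives is needed, since \<open>-(x \<otimes> y) = (-x) \<otimes> y\<close> is again a pure tensor.\<close>

lemma tensor_induct [consumes 1, case_names pure add]:
  assumes t: "t \<in> carrier (tensor_group K M N)"
    and pure: "\<And>x y. x \<in> carrier M \<Longrightarrow> y \<in> carrier N \<Longrightarrow> P (x \<star> y)"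
    and add: "\<And>s t. \<lbrakk>s \<in> carrier (tensor_group K M N); t \<in> carrier (tensor_group K M N); P s; P t\<rbrakk>
      \<Longrightarrow> P (s \<oplus>\<^bsub>tensor_group K M N\<^esub> t)"
  shows "P t"
proof -
  interpret F: comm_group F by (rule abelian_free_Abelian_group)
  obtain c where c: "c \<in> carrier F" "t = H #>\<^bsub>F\<^esub> c"
    using t by (auto simp: tensor_group_def Let_def FactGroup_def RCOSETS_def)
  have zero: "H #>\<^bsub>F\<^esub> 0 = \<zero>\<^bsub>M\<^esub> \<star> \<zero>\<^bsub>N\<^esub>"
  proof -
    have "H #>\<^bsub>F\<^esub> 0 = \<zero>\<^bsub>tensor_group K M N\<^esub>"
      using F.coset_mult_one[of H] kernel_normal[THEN normal_imp_subgroup, THEN subgroup.subset]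
      by (simp add: tensor_group_def Let_def FactGroup_def)
    also have "\<dots> = \<zero>\<^bsub>M\<^esub> \<star> \<zero>\<^bsub>N\<^esub>"
      using pure_add_left[of "\<zero>\<^bsub>M\<^esub>" "\<zero>\<^bsub>M\<^esub>" "\<zero>\<^bsub>N\<^esub>"] pure_closed[of "\<zero>\<^bsub>M\<^esub>" "\<zero>\<^bsub>N\<^esub>"]
      by (metis M.M.add.one_closed M.M.add.r_one N.M.add.one_closed T.add.r_cancel_one')
    finally show ?thesis .
  qed
  have "Poly_Mapping.keys c \<subseteq> carrier M \<times> carrier N" using c by simp
  \<comment> \<open>Induction on \<open>c\<close> produces differences; carrying the claim for \<open>- c\<close> along turns them into sums.\<close>
  then have "c \<in> carrier F \<and> P (H #>\<^bsub>F\<^esub> c) \<and> P (H #>\<^bsub>F\<^esub> (- c))"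
  proof (induction rule: frag_induction)
    case zero
    then show ?case using \<open>H #>\<^bsub>F\<^esub> 0 = \<zero>\<^bsub>M\<^esub> \<star> \<zero>\<^bsub>N\<^esub>\<close> pure by simp
  next
    case (one p)
    then obtain x y where p: "p = (x, y)" and x: "x \<in> carrier M" and y: "y \<in> carrier N" by auto
    have mx: "\<ominus>\<^bsub>M\<^esub> x \<in> carrier M" using x by simp
    have f: "frag_of (x, y) \<in> carrier F" by (rule frag_closed[OF x y])
    have f': "- frag_of (x, y) \<in> carrier F" using x y by simp
    have "\<ominus>\<^bsub>M\<^esub> x \<star> y \<oplus>\<^bsub>tensor_group K M N\<^esub> x \<star> y = \<zero>\<^bsub>M\<^esub> \<star> y"
      using pure_add_left[OF mx x y] x by (simp add: M.M.l_neg)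
    also have "\<dots> = \<zero>\<^bsub>tensor_group K M N\<^esub>"
      using pure_add_left[of "\<zero>\<^bsub>M\<^esub>" "\<zero>\<^bsub>M\<^esub>" y] pure_closed[of "\<zero>\<^bsub>M\<^esub>" y] y
      by (metis M.M.add.one_closed M.M.add.r_one T.add.r_cancel_one')
    also have "\<dots> = (H #>\<^bsub>F\<^esub> (- frag_of (x, y))) \<oplus>\<^bsub>tensor_group K M N\<^esub> x \<star> y"
      using coset_add[OF f' f] F.coset_mult_one[of H] kernel_normal[THEN normal_imp_subgroup, THEN subgroup.subset]
      by (simp add: pure_tensor_def) (simp add: tensor_group_def Let_def FactGroup_def)
    finally have "H #>\<^bsub>F\<^esub> (- frag_of (x, y)) = \<ominus>\<^bsub>M\<^esub> x \<star> y"
      using T.add.r_cancel pure_closed[OF mx y] pure_closed[OF x y] coset_closed[OF f'] by metis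
    then show ?case using pure[OF x y] pure[OF mx y] f p by (simp add: pure_tensor_def)
  next
    case (diff a b)
    have n: "- a \<in> carrier F" "- b \<in> carrier F" using diff by auto
    have "a + (- b) \<in> carrier F" by (rule frag_add_closed) (use diff n in auto)
    moreover have "P (H #>\<^bsub>F\<^esub> (a + (- b)))" "P (H #>\<^bsub>F\<^esub> (b + (- a)))"
      using diff n add coset_closed by (auto simp: coset_add[symmetric] simp del: carrier_free_Abelian_group_iff add_uminus_conv_diff)
    ultimately show ?case by simp
  qed
  then show ?thesis using c by simp
qed

lemma additive_eqI:
  assumes f: "f \<in> hom (add_monoid (tensor_group K M N)) (add_monoid G)"
    and g: "g \<in> hom (add_monoid (tensor_group K M N)) (add_monoid G)"
    and eq: "\<And>x y. x \<in> carrier M \<Longrightarrow> y \<in> carrier N \<Longrightarrow> f (x \<star> y) = g (x \<star> y)"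
    and t: "t \<in> carrier (tensor_group K M N)"
  shows "f t = g t"
  using t by (induction rule: tensor_induct) (simp_all add: eq homD(2)[OF f] homD(2)[OF g])

lemma lift_hom_pure:
  assumes "abelian_group G" and f: "balanced_map K M N G f"
  shows lift_hom: "tensor_lift G f \<in> hom (add_monoid (tensor_group K M N)) (add_monoid G)"
    and lift_pure: "\<And>x y. \<lbrakk>x \<in> carrier M; y \<in> carrier N\<rbrakk> \<Longrightarrow> tensor_lift G f (x \<star> y) = f x y"
proof -
  have c: "f x \<in> hom (add_monoid N) (add_monoid G)" if "x \<in> carrier M" for x
    using f that by (auto simp: balanced_map_def)
  have d: "(\<lambda>x. f x y) \<in> hom (add_monoid M) (add_monoid G)" if "y \<in> carrier N" for y
    using f that by (auto simp: balanced_map_def)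
  have b: "f (x \<bullet>\<^bsub>M\<^esub> k) y = f x (k \<odot>\<^bsub>N\<^esub> y)" if "x \<in> carrier M" "k \<in> carrier K" "y \<in> carrier N" for x k y
    using f that by (auto simp: balanced_map_def)
  show "tensor_lift G f \<in> hom (add_monoid (tensor_group K M N)) (add_monoid G)"
    by (rule tensor_lift_hom[OF M_ax N_ax assms(1)]) (simp_all add: homD[OF c] homD(2)[OF d] b)
  show "tensor_lift G f (x \<star> y) = f x y" if "x \<in> carrier M" "y \<in> carrier N" for x y
    by (rule tensor_lift_pure[OF M_ax N_ax assms(1)]) (simp_all add: homD[OF c] homD(2)[OF d] b that)
qed

lemma pure_balanced_map: "balanced_map K M N (tensor_group K M N) (pure_tensor K M N)"
  by (intro balanced_mapI pure_left_hom pure_right_hom) (simp_all add: pure_balanced)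

text \<open>If \<open>f\<close> is visibly an additive map applied to a pure tensor, it need not be checked to be balanced.
  This computes lifts whose defining formula is not balanced term by term.\<close>

lemma lift_unique:
  assumes G: "abelian_group G" and g: "g \<in> hom (add_monoid (tensor_group K M N)) (add_monoid G)"
    and eq: "\<And>x y. x \<in> carrier M \<Longrightarrow> y \<in> carrier N \<Longrightarrow> f x y = g (x \<star> y)"
    and t: "t \<in> carrier (tensor_group K M N)"
  shows "tensor_lift G f t = g t"
proof -
  have "balanced_map K M N G (\<lambda>x y. g (x \<star> y))"
    by (rule balanced_map_comp[OF pure_balanced_map g])
  then have bal: "balanced_map K M N G f"
    using M.rsmult_closed N.lsmult_closed by (auto simp: balanced_map_def hom_def Pi_def eq)
  show ?thesis
    by (rule additive_eqI[OF lift_hom[OF G bal] g _ t]) (simp add: lift_pure[OF G bal] eq)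
qed

end

lemma tensor_map_hom_pure:
  assumes P: "tensor_pair K M N" and P': "tensor_pair K M' N'"
    and f: "f \<in> right_module_hom K M M'" and g: "g \<in> left_module_hom K N N'"
  shows tensor_map_hom: "tensor_map K M' N' f g \<in>
      hom (add_monoid (tensor_group K M N)) (add_monoid (tensor_group K M' N'))"
    and tensor_map_pure: "\<And>x y. \<lbrakk>x \<in> carrier M; y \<in> carrier N\<rbrakk> \<Longrightarrow>
      tensor_map K M' N' f g (pure_tensor K M N x y) = pure_tensor K M' N' (f x) (g y)"
proof -
  interpret P: tensor_pair K M N by (rule P)
  interpret P': tensor_pair K M' N' by (rule P')
  note f = right_module_homD[OF f] and g = left_module_homD[OF g]
  have bal: "balanced_map K M N (tensor_group K M' N') (\<lambda>x y. pure_tensor K M' N' (f x) (g y))"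
  proof (rule balanced_mapI)
    fix x assume "x \<in> carrier M"
    then show "(\<lambda>y. pure_tensor K M' N' (f x) (g y)) \<in> hom (add_monoid N) (add_monoid (tensor_group K M' N'))"
      by (rule additive_comp[OF g(1) P'.pure_right_hom[OF homD(1)[OF f(1)]]])
  next
    fix y assume "y \<in> carrier N"
    then show "(\<lambda>x. pure_tensor K M' N' (f x) (g y)) \<in> hom (add_monoid M) (add_monoid (tensor_group K M' N'))"
      by (rule additive_comp[OF f(1) P'.pure_left_hom[OF homD(1)[OF g(1)]]])
  qed (simp add: f g P'.pure_balanced homD(1)[OF f(1)] homD(1)[OF g(1)])
  show "tensor_map K M' N' f g \<in> hom (add_monoid (tensor_group K M N)) (add_monoid (tensor_group K M' N'))"
    unfolding tensor_map_def by (rule P.lift_hom[OF P'.T.abelian_group_axioms bal])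
  show "\<And>x y. \<lbrakk>x \<in> carrier M; y \<in> carrier N\<rbrakk> \<Longrightarrow>
      tensor_map K M' N' f g (pure_tensor K M N x y) = pure_tensor K M' N' (f x) (g y)"
    unfolding tensor_map_def by (rule P.lift_pure[OF P'.T.abelian_group_axioms bal])
qed

locale tensor_bimodule = M: bimodule L K M + N: bimodule K R N for L K R M N

begin

sublocale tensor_pair K M N by unfold_locales

lemma left_M_ax: "left_module L M" and right_N_ax: "right_module R N" by unfold_locales

lemma tensor_abelian_group: "abelian_group (tensor K M N)"
  by (rule abelian_group_restrict_scheme[OF T.abelian_group_axioms]) (simp_all add: tensor_simps)

lemma lsmult_tensor:
  assumes l: "l \<in> carrier L"
  shows lsmult_tensor_hom: "(\<lambda>t. l \<odot>\<^bsub>tensor K M N\<^esub> t)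
      \<in> hom (add_monoid (tensor_group K M N)) (add_monoid (tensor_group K M N))"
    and lsmult_pure: "\<And>x y. \<lbrakk>x \<in> carrier M; y \<in> carrier N\<rbrakk>
      \<Longrightarrow> l \<odot>\<^bsub>tensor K M N\<^esub> (x \<star> y) = (l \<odot>\<^bsub>M\<^esub> x) \<star> y"
proof -
  have eq: "(\<lambda>t. l \<odot>\<^bsub>tensor K M N\<^esub> t) = tensor_map K M N (\<lambda>x. l \<odot>\<^bsub>M\<^esub> x) (\<lambda>y. y)"
    by (simp add: tensor_def Let_def tensor_map_def)
  have h: "(\<lambda>x. l \<odot>\<^bsub>M\<^esub> x) \<in> right_module_hom K M M" "(\<lambda>y. y) \<in> left_module_hom K N N"
    using lsmult_hom[OF left_M_ax l] M.bimodule_assoc l by (simp_all add: right_module_hom_def left_module_hom_def additive_id)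
  note tensor_map_hom[OF tensor_pair_axioms tensor_pair_axioms h] tensor_map_pure[OF tensor_pair_axioms tensor_pair_axioms h]
  then show "(\<lambda>t. l \<odot>\<^bsub>tensor K M N\<^esub> t) \<in> hom (add_monoid (tensor_group K M N)) (add_monoid (tensor_group K M N))"
    and "\<And>x y. \<lbrakk>x \<in> carrier M; y \<in> carrier N\<rbrakk> \<Longrightarrow> l \<odot>\<^bsub>tensor K M N\<^esub> (x \<star> y) = (l \<odot>\<^bsub>M\<^esub> x) \<star> y"
    using fun_cong[OF eq] eq by simp_all
qed

lemma rsmult_tensor:
  assumes r: "r \<in> carrier R"
  shows rsmult_tensor_hom: "(\<lambda>t. t \<bullet>\<^bsub>tensor K M N\<^esub> r)
      \<in> hom (add_monoid (tensor_group K M N)) (add_monoid (tensor_group K M N))"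
    and rsmult_pure: "\<And>x y. \<lbrakk>x \<in> carrier M; y \<in> carrier N\<rbrakk>
      \<Longrightarrow> (x \<star> y) \<bullet>\<^bsub>tensor K M N\<^esub> r = x \<star> (y \<bullet>\<^bsub>N\<^esub> r)"
proof -
  have eq: "(\<lambda>t. t \<bullet>\<^bsub>tensor K M N\<^esub> r) = tensor_map K M N (\<lambda>x. x) (\<lambda>y. y \<bullet>\<^bsub>N\<^esub> r)"
    by (simp add: tensor_def Let_def tensor_map_def)
  have h: "(\<lambda>x. x) \<in> right_module_hom K M M" "(\<lambda>y. y \<bullet>\<^bsub>N\<^esub> r) \<in> left_module_hom K N N"
    using rsmult_hom[OF right_N_ax r] N.bimodule_assoc r by (simp_all add: right_module_hom_def left_module_hom_def additive_id)
  note tensor_map_hom[OF tensor_pair_axioms tensor_pair_axioms h] tensor_map_pure[OF tensor_pair_axioms tensor_pair_axioms h]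
  then show "(\<lambda>t. t \<bullet>\<^bsub>tensor K M N\<^esub> r) \<in> hom (add_monoid (tensor_group K M N)) (add_monoid (tensor_group K M N))"
    and "\<And>x y. \<lbrakk>x \<in> carrier M; y \<in> carrier N\<rbrakk> \<Longrightarrow> (x \<star> y) \<bullet>\<^bsub>tensor K M N\<^esub> r = x \<star> (y \<bullet>\<^bsub>N\<^esub> r)"
    using fun_cong[OF eq] eq by simp_all
qed

lemma tensor_is_bimodule: "bimodule L R (tensor K M N)"
proof -
  note lh = lsmult_tensor_hom and rh = rsmult_tensor_hom
  note c = additive_comp[where M = "tensor_group K M N" and N = "tensor_group K M N"]
  note p = additive_plus[OF T.abelian_group_axioms, where M = "tensor_group K M N"]
  have left: "left_module_axioms L (tensor K M N)"
  proof (unfold_locales, unfold tensor_simps)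
    fix k x assume "k \<in> carrier L" "x \<in> carrier (tensor_group K M N)"
    then show "k \<odot>\<^bsub>tensor K M N\<^esub> x \<in> carrier (tensor_group K M N)" using homD(1)[OF lh] by blast
  next
    fix k x y assume "k \<in> carrier L" "x \<in> carrier (tensor_group K M N)" "y \<in> carrier (tensor_group K M N)"
    then show "k \<odot>\<^bsub>tensor K M N\<^esub> (x \<oplus>\<^bsub>tensor_group K M N\<^esub> y)
      = k \<odot>\<^bsub>tensor K M N\<^esub> x \<oplus>\<^bsub>tensor_group K M N\<^esub> k \<odot>\<^bsub>tensor K M N\<^esub> y" using homD(2)[OF lh] by blast
  next
    fix k k' x assume k: "k \<in> carrier L" "k' \<in> carrier L" and x: "x \<in> carrier (tensor_group K M N)"
    show "(k \<oplus>\<^bsub>L\<^esub> k') \<odot>\<^bsub>tensor K M N\<^esub> x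
      = k \<odot>\<^bsub>tensor K M N\<^esub> x \<oplus>\<^bsub>tensor_group K M N\<^esub> k' \<odot>\<^bsub>tensor K M N\<^esub> x"
      by (rule additive_eqI[OF lh p[OF lh lh] _ x])
        (use k in \<open>simp_all add: lsmult_pure M.lsmult_add_scalar pure_add_left M.lsmult_closed\<close>)
    show "(k \<otimes>\<^bsub>L\<^esub> k') \<odot>\<^bsub>tensor K M N\<^esub> x = k \<odot>\<^bsub>tensor K M N\<^esub> (k' \<odot>\<^bsub>tensor K M N\<^esub> x)"
      by (rule additive_eqI[OF lh c[OF lh lh] _ x])
        (use k in \<open>simp_all add: lsmult_pure M.lsmult_assoc M.lsmult_closed\<close>)
  next
    fix x assume x: "x \<in> carrier (tensor_group K M N)"
    show "\<one>\<^bsub>L\<^esub> \<odot>\<^bsub>tensor K M N\<^esub> x = x"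
      by (rule additive_eqI[OF lh additive_id _ x]) (simp_all add: lsmult_pure M.lsmult_one)
  qed
  have right: "right_module_axioms R (tensor K M N)"
  proof (unfold_locales, unfold tensor_simps)
    fix k x assume "k \<in> carrier R" "x \<in> carrier (tensor_group K M N)"
    then show "x \<bullet>\<^bsub>tensor K M N\<^esub> k \<in> carrier (tensor_group K M N)" using homD(1)[OF rh] by blast
  next
    fix k x y assume "k \<in> carrier R" "x \<in> carrier (tensor_group K M N)" "y \<in> carrier (tensor_group K M N)"
    then show "(x \<oplus>\<^bsub>tensor_group K M N\<^esub> y) \<bullet>\<^bsub>tensor K M N\<^esub> k
      = x \<bullet>\<^bsub>tensor K M N\<^esub> k \<oplus>\<^bsub>tensor_group K M N\<^esub> y \<bullet>\<^bsub>tensor K M N\<^esub> k" using homD(2)[OF rh] by blast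
  next
    fix k k' x assume k: "k \<in> carrier R" "k' \<in> carrier R" and x: "x \<in> carrier (tensor_group K M N)"
    show "x \<bullet>\<^bsub>tensor K M N\<^esub> (k \<oplus>\<^bsub>R\<^esub> k')
      = x \<bullet>\<^bsub>tensor K M N\<^esub> k \<oplus>\<^bsub>tensor_group K M N\<^esub> x \<bullet>\<^bsub>tensor K M N\<^esub> k'"
      by (rule additive_eqI[OF rh p[OF rh rh] _ x])
        (use k in \<open>simp_all add: rsmult_pure N.rsmult_add_scalar pure_add_right N.rsmult_closed\<close>)
    show "x \<bullet>\<^bsub>tensor K M N\<^esub> (k \<otimes>\<^bsub>R\<^esub> k') = x \<bullet>\<^bsub>tensor K M N\<^esub> k \<bullet>\<^bsub>tensor K M N\<^esub> k'"
      by (rule additive_eqI[OF rh c[OF rh rh] _ x])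
        (use k in \<open>simp_all add: rsmult_pure N.rsmult_assoc N.rsmult_closed\<close>)
  next
    fix x assume x: "x \<in> carrier (tensor_group K M N)"
    show "x \<bullet>\<^bsub>tensor K M N\<^esub> \<one>\<^bsub>R\<^esub> = x"
      by (rule additive_eqI[OF rh additive_id _ x]) (simp_all add: rsmult_pure N.rsmult_one)
  qed
  have "(l \<odot>\<^bsub>tensor K M N\<^esub> x) \<bullet>\<^bsub>tensor K M N\<^esub> r = l \<odot>\<^bsub>tensor K M N\<^esub> (x \<bullet>\<^bsub>tensor K M N\<^esub> r)"
    if "l \<in> carrier L" "r \<in> carrier R" "x \<in> carrier (tensor_group K M N)" for l r x
    by (rule additive_eqI[OF c[OF lh rh] c[OF rh lh] _ that(3)])
      (use that in \<open>simp_all add: rsmult_pure lsmult_pure N.rsmult_closed M.lsmult_closed\<close>)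
  then show ?thesis
    using left right left_module.axioms(1)[OF left_M_ax] right_module.axioms(1)[OF right_N_ax] tensor_abelian_group
    by (auto intro!: bimodule.intro left_module.intro right_module.intro bimodule_axioms.intro simp: tensor_simps)
qed

end

lemma tensor_assoc_hom_pure:
  assumes M: "bimodule L J M" and N: "bimodule J K N" and P: "bimodule K R P"
  shows tensor_assoc_hom: "tensor_assoc J K M N P \<in>
      hom (add_monoid (tensor_group K (tensor J M N) P)) (add_monoid (tensor_group J M (tensor K N P)))"
    and tensor_assoc_pure: "\<And>x y z. \<lbrakk>x \<in> carrier M; y \<in> carrier N; z \<in> carrier P\<rbrakk> \<Longrightarrow>
      tensor_assoc J K M N P (pure_tensor K (tensor J M N) P (pure_tensor J M N x y) z)
      = pure_tensor J M (tensor K N P) x (pure_tensor K N P y z)"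
proof -
  interpret MN: tensor_bimodule L J K M N using M N by (simp add: tensor_bimodule_def)
  interpret NP: tensor_bimodule J K R N P using N P by (simp add: tensor_bimodule_def)
  interpret M_NP: tensor_bimodule L J R M "tensor K N P"
    using M NP.tensor_is_bimodule by (simp add: tensor_bimodule_def)
  interpret MN_P: tensor_bimodule L K R "tensor J M N" P
    using MN.tensor_is_bimodule P by (simp add: tensor_bimodule_def)
  let ?H = "tensor J M (tensor K N P)"
  let ?G = "tensor_group J M (tensor K N P)"
  let ?f = "\<lambda>z x y. pure_tensor J M (tensor K N P) x (pure_tensor K N P y z)"
  have H: "abelian_group ?H" by (rule M_NP.tensor_abelian_group)
  have inner: "balanced_map J M N ?H (?f z)" if z: "z \<in> carrier P" for z
  proof (rule balanced_mapI, unfold hom_into_tensor)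
    fix x assume x: "x \<in> carrier M"
    have "(\<lambda>w. pure_tensor J M (tensor K N P) x w) \<in> hom (add_monoid (tensor_group K N P)) (add_monoid ?G)"
      using M_NP.pure_right_hom[OF x] by (simp only: hom_from_tensor)
    then show "?f z x \<in> hom (add_monoid N) (add_monoid ?G)"
      by (rule additive_comp[OF NP.pure_left_hom[OF z]])
  next
    fix y assume "y \<in> carrier N"
    then show "(\<lambda>x. ?f z x y) \<in> hom (add_monoid M) (add_monoid ?G)"
      by (intro M_NP.pure_left_hom) (simp add: tensor_simps NP.pure_closed z)
  next
    fix x k y assume "x \<in> carrier M" "k \<in> carrier J" "y \<in> carrier N"
    then show "?f z (x \<bullet>\<^bsub>M\<^esub> k) y = ?f z x (k \<odot>\<^bsub>N\<^esub> y)"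
      using z by (simp add: M_NP.pure_balanced tensor_simps NP.pure_closed NP.lsmult_pure[symmetric])
  qed
  note ih = MN.lift_hom[OF H inner] and ip = MN.lift_pure[OF H inner]
  let ?F = "\<lambda>t z. tensor_lift ?H (?f z) t"
  have outer: "balanced_map K (tensor J M N) P ?H ?F"
  proof (rule balanced_mapI)
    fix t assume "t \<in> carrier (tensor J M N)"
    then have t: "t \<in> carrier (tensor_group J M N)" by (simp add: tensor_simps)
    show "?F t \<in> hom (add_monoid P) (add_monoid ?H)"
    proof (rule homI, simp_all)
      fix z assume "z \<in> carrier P"
      then show "?F t z \<in> carrier ?H" by (rule homD(1)[OF ih t])
    next
      fix z z' assume z: "z \<in> carrier P" "z' \<in> carrier P"
      then have zz: "z \<oplus>\<^bsub>P\<^esub> z' \<in> carrier P" by simp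
      show "?F t (z \<oplus>\<^bsub>P\<^esub> z') = ?F t z \<oplus>\<^bsub>?H\<^esub> ?F t z'"
      proof (rule MN.additive_eqI[OF ih[OF zz] additive_plus[OF H ih[OF z(1)] ih[OF z(2)]] _ t])
        fix x y assume "x \<in> carrier M" "y \<in> carrier N"
        then show "?F (pure_tensor J M N x y) (z \<oplus>\<^bsub>P\<^esub> z')
            = ?F (pure_tensor J M N x y) z \<oplus>\<^bsub>?H\<^esub> ?F (pure_tensor J M N x y) z'"
          using z zz M_NP.pure_add_right
          by (simp add: ip NP.pure_add_right tensor_simps NP.pure_closed)
      qed
    qed
  next
    fix z assume "z \<in> carrier P"
    then show "(\<lambda>t. ?F t z) \<in> hom (add_monoid (tensor J M N)) (add_monoid ?H)"
      unfolding hom_from_tensor by (rule ih)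
  next
    fix t k z assume "t \<in> carrier (tensor J M N)" and k: "k \<in> carrier K" and z: "z \<in> carrier P"
    then have t: "t \<in> carrier (tensor_group J M N)" by (simp add: tensor_simps)
    have kz: "k \<odot>\<^bsub>P\<^esub> z \<in> carrier P" using k z by (rule NP.N.lsmult_closed)
    show "?F (t \<bullet>\<^bsub>tensor J M N\<^esub> k) z = ?F t (k \<odot>\<^bsub>P\<^esub> z)"
    proof (rule MN.additive_eqI[OF additive_comp[OF MN.rsmult_tensor_hom[OF k] ih[OF z]] ih[OF kz] _ t])
      fix x y assume "x \<in> carrier M" "y \<in> carrier N"
      then show "?F (pure_tensor J M N x y \<bullet>\<^bsub>tensor J M N\<^esub> k) z = ?F (pure_tensor J M N x y) (k \<odot>\<^bsub>P\<^esub> z)"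
        using k z kz by (simp add: ip MN.rsmult_pure MN.N.rsmult_closed NP.pure_balanced)
    qed
  qed
  have eq: "tensor_assoc J K M N P = tensor_lift ?H ?F" by (simp add: tensor_assoc_def Let_def)
  show "tensor_assoc J K M N P \<in>
      hom (add_monoid (tensor_group K (tensor J M N) P)) (add_monoid (tensor_group J M (tensor K N P)))"
    using MN_P.lift_hom[OF H outer] unfolding eq hom_into_tensor .
  show "tensor_assoc J K M N P (pure_tensor K (tensor J M N) P (pure_tensor J M N x y) z)
      = pure_tensor J M (tensor K N P) x (pure_tensor K N P y z)"
    if "x \<in> carrier M" "y \<in> carrier N" "z \<in> carrier P" for x y z
    using that MN_P.lift_pure[OF H outer] by (simp add: eq ip tensor_simps MN.pure_closed)
qed


section \<open>Corings generated by a grouplike element\<close>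

text \<open>Over a coring generated by one grouplike element \<open>x\<close>, the comultiplication must be
  \<open>a x a' \<mapsto> a x \<otimes> x a'\<close> and the counit \<open>a x a' \<mapsto> a a'\<close>. Both sides of each coring axiom are additive,
  so it suffices to compare them on the elements \<open>a x a'\<close>, where they agree at sight.\<close>

lemma coring_generated_by_grouplike:
  assumes C: "bimodule A A C"
    and comult: "comult C \<in> bimodule_hom A A C (tensor A C C)"
    and counit: "counit C \<in> bimodule_hom A A C (regular A)"
    and x: "grouplike A C x"
    and gen: "carrier C \<subseteq> generate (add_monoid C) {(a \<odot>\<^bsub>C\<^esub> x) \<bullet>\<^bsub>C\<^esub> a' | a a'. a \<in> carrier A \<and> a' \<in> carrier A}"
  shows "coring A C"
proof -
  interpret C: bimodule A A C by (rule C)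
  interpret CC: tensor_bimodule A A A C C using C by (simp add: tensor_bimodule_def)
  interpret C_CC: tensor_bimodule A A A C "tensor A C C"
    using C CC.tensor_is_bimodule by (simp add: tensor_bimodule_def)
  interpret CC_C: tensor_bimodule A A A "tensor A C C" C
    using C CC.tensor_is_bimodule by (simp add: tensor_bimodule_def)
  let ?D = "comult C" and ?e = "counit C"
  let ?X = "{(a \<odot>\<^bsub>C\<^esub> x) \<bullet>\<^bsub>C\<^esub> a' | a a'. a \<in> carrier A \<and> a' \<in> carrier A}"
  have xC: "x \<in> carrier C" and Dx: "?D x = pure_tensor A C C x x" and ex: "?e x = \<one>\<^bsub>A\<^esub>"
    using x by (auto simp: grouplike_def)
  note cl = C.lsmult_closed[OF _ xC] C.rsmult_closed
  have CA: "abelian_group C" by unfold_locales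
  note pure = CC.lsmult_pure CC.rsmult_pure CC.pure_closed CC.lsmult_tensor_hom[THEN homD(1)]
  have Dl: "?D (a \<odot>\<^bsub>C\<^esub> x) = pure_tensor A C C (a \<odot>\<^bsub>C\<^esub> x) x" if "a \<in> carrier A" for a
    using that xC by (simp add: bimodule_homD(4)[OF comult] Dx pure)
  have Dr: "?D (x \<bullet>\<^bsub>C\<^esub> a) = pure_tensor A C C x (x \<bullet>\<^bsub>C\<^esub> a)" if "a \<in> carrier A" for a
    using that xC by (simp add: bimodule_homD(5)[OF comult] Dx pure)
  have Dg: "?D ((a \<odot>\<^bsub>C\<^esub> x) \<bullet>\<^bsub>C\<^esub> a') = pure_tensor A C C (a \<odot>\<^bsub>C\<^esub> x) (x \<bullet>\<^bsub>C\<^esub> a')"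
    if "a \<in> carrier A" "a' \<in> carrier A" for a a'
    using that xC by (simp add: bimodule_homD(5)[OF comult] Dl pure cl)
  have el: "?e (a \<odot>\<^bsub>C\<^esub> x) = a" and er: "?e (x \<bullet>\<^bsub>C\<^esub> a) = a" if "a \<in> carrier A" for a
    using that xC bimodule_homD(4,5)[OF counit] ex by simp_all
  have D_hom: "?D \<in> hom (add_monoid C) (add_monoid (tensor_group A C C))"
    using bimodule_homD(3)[OF comult] by (simp only: hom_into_tensor)
  have id: "(\<lambda>d. d) \<in> left_module_hom A C C" "(\<lambda>d. d) \<in> right_module_hom A C C"
    by (simp_all add: left_module_hom_def right_module_hom_def additive_id)
  note l = CC.tensor_pair_axioms CC_C.tensor_pair_axioms bimodule_homD(2)[OF comult] id(1)
  note r = CC.tensor_pair_axioms C_CC.tensor_pair_axioms id(2) bimodule_homD(1)[OF comult]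
  have eqI: "f c = g c"
    if "abelian_group G" "f \<in> hom (add_monoid C) (add_monoid G)" "g \<in> hom (add_monoid C) (add_monoid G)"
      "\<And>a a'. a \<in> carrier A \<Longrightarrow> a' \<in> carrier A \<Longrightarrow> f ((a \<odot>\<^bsub>C\<^esub> x) \<bullet>\<^bsub>C\<^esub> a') = g ((a \<odot>\<^bsub>C\<^esub> x) \<bullet>\<^bsub>C\<^esub> a')"
      "c \<in> carrier C" for f g c and G :: "('z, 'zz) ring_scheme"
    by (rule additive_eq_on_generate[OF CA that(1-3), where S = ?X]) (use that gen cl in auto)
  have coassoc: "tensor_assoc A A C C C (tensor_map A (tensor A C C) C ?D (\<lambda>d. d) (?D c))
      = tensor_map A C (tensor A C C) (\<lambda>d. d) ?D (?D c)" if "c \<in> carrier C" for c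
    by (rule eqI[OF C_CC.T.abelian_group_axioms
          additive_comp[OF additive_comp[OF D_hom tensor_map_hom[OF l]] tensor_assoc_hom[OF C C C]]
          additive_comp[OF D_hom tensor_map_hom[OF r]] _ that])
      (simp add: Dg Dl Dr cl xC tensor_map_pure[OF l] tensor_map_pure[OF r] tensor_assoc_pure[OF C C C])
  have bl: "balanced_map A C C C (\<lambda>d d'. ?e d \<odot>\<^bsub>C\<^esub> d')"
    using homD[OF bimodule_homD(3)[OF counit]] bimodule_homD(5)[OF counit]
    by (intro balanced_mapI homI)
      (auto simp: C.lsmult_closed C.lsmult_add C.lsmult_add_scalar C.lsmult_assoc)
  have br: "balanced_map A C C C (\<lambda>d d'. d \<bullet>\<^bsub>C\<^esub> ?e d')"
    using homD[OF bimodule_homD(3)[OF counit]] bimodule_homD(4)[OF counit]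
    by (intro balanced_mapI homI)
      (auto simp: C.rsmult_closed C.rsmult_add C.rsmult_add_scalar C.rsmult_assoc)
  have cl': "tensor_lift C (\<lambda>d d'. ?e d \<odot>\<^bsub>C\<^esub> d') (?D c) = c" if "c \<in> carrier C" for c
    by (rule eqI[OF CA additive_comp[OF D_hom CC.lift_hom[OF CA bl]] additive_id _ that])
      (simp add: Dg cl xC CC.lift_pure[OF CA bl] el C.bimodule_assoc[symmetric])
  have cr': "tensor_lift C (\<lambda>d d'. d \<bullet>\<^bsub>C\<^esub> ?e d') (?D c) = c" if "c \<in> carrier C" for c
    by (rule eqI[OF CA additive_comp[OF D_hom CC.lift_hom[OF CA br]] additive_id _ that])
      (simp add: Dg cl xC CC.lift_pure[OF CA br] er)
  show ?thesis
    by (intro coring.intro C coring_axioms.intro comult counit coassoc cl' cr')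
qed


section \<open>The tensor square of a ring extension and its centralizing elements\<close>

locale subring_extension = A: ring A for A :: "('a, 'p) ring_scheme" +
  fixes B :: "'a set"
  assumes B_subring: "subring B A"

begin

abbreviation R where "R \<equiv> centralizer A B"
abbreviation Q where "Q \<equiv> tensor_square A B"
abbreviation T where "T \<equiv> T_ring A B"
abbreviation sq (infixl "\<boxtimes>" 75) where "x \<boxtimes> y \<equiv> square_tensor A B x y"

lemma B_in_A: "b \<in> B \<Longrightarrow> b \<in> carrier A"
  using subringE(1)[OF B_subring] by auto

lemma one_B: "\<one>\<^bsub>A\<^esub> \<in> B"
  using subringE(3)[OF B_subring] .

lemma R_in_A: "r \<in> R \<Longrightarrow> r \<in> carrier A"
  by (simp add: centralizer_def)

lemma R_commute: "r \<in> R \<Longrightarrow> b \<in> B \<Longrightarrow> r \<otimes>\<^bsub>A\<^esub> b = b \<otimes>\<^bsub>A\<^esub> r"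
  by (simp add: centralizer_def)

lemma R_subring: "subring R A"
proof (rule A.subringI)
  fix h k assume h: "h \<in> R" and k: "k \<in> R"
  note c = R_in_A[OF h] R_in_A[OF k] B_in_A R_commute[OF h] R_commute[OF k]
  show "\<ominus>\<^bsub>A\<^esub> h \<in> R" using c by (simp add: centralizer_def A.l_minus A.r_minus)
  show "h \<oplus>\<^bsub>A\<^esub> k \<in> R" using c by (simp add: centralizer_def A.l_distr A.r_distr)
  have "h \<otimes>\<^bsub>A\<^esub> k \<otimes>\<^bsub>A\<^esub> b = b \<otimes>\<^bsub>A\<^esub> (h \<otimes>\<^bsub>A\<^esub> k)" if "b \<in> B" for b
    using c that by (metis A.m_assoc)
  then show "h \<otimes>\<^bsub>A\<^esub> k \<in> R" using c by (simp add: centralizer_def)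
qed (auto simp: centralizer_def B_in_A)

lemma regular_restricted:
  assumes "subring U A" "subring V A"
  shows "bimodule (subring_of A U) (subring_of A V) (regular A)"
  by (rule bimodule_restrict_scalars[OF regular_bimodule[OF A.ring_axioms] A.ring_axioms A.ring_axioms assms])

lemma regular_left: "subring U A \<Longrightarrow> bimodule (subring_of A U) A (regular A)"
  using regular_restricted[OF _ A.carrier_is_subring] by simp

lemma regular_right: "subring U A \<Longrightarrow> bimodule A (subring_of A U) (regular A)"
  using regular_restricted[OF A.carrier_is_subring] by simp

sublocale square: tensor_bimodule A "subring_of A B" A "regular A" "regular A"
  using regular_left[OF B_subring] regular_right[OF B_subring] by (simp add: tensor_bimodule_def)

sublocale Q: bimodule A A Q
  unfolding tensor_square_def by (rule square.tensor_is_bimodule)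

lemma Q_group: "abelian_group Q" by unfold_locales

lemma Q_left: "left_module A Q" by unfold_locales

lemma Q_right: "right_module A Q" by unfold_locales

lemma
  shows square_closed [simp]: "\<lbrakk>x \<in> carrier A; y \<in> carrier A\<rbrakk> \<Longrightarrow> x \<boxtimes> y \<in> carrier Q"
    and square_balanced: "\<lbrakk>x \<in> carrier A; b \<in> B; y \<in> carrier A\<rbrakk> \<Longrightarrow> (x \<otimes>\<^bsub>A\<^esub> b) \<boxtimes> y = x \<boxtimes> (b \<otimes>\<^bsub>A\<^esub> y)"
    and square_lsmult: "\<lbrakk>a \<in> carrier A; x \<in> carrier A; y \<in> carrier A\<rbrakk> \<Longrightarrow> a \<odot>\<^bsub>Q\<^esub> (x \<boxtimes> y) = (a \<otimes>\<^bsub>A\<^esub> x) \<boxtimes> y"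
    and square_rsmult: "\<lbrakk>a \<in> carrier A; x \<in> carrier A; y \<in> carrier A\<rbrakk> \<Longrightarrow> (x \<boxtimes> y) \<bullet>\<^bsub>Q\<^esub> a = x \<boxtimes> (y \<otimes>\<^bsub>A\<^esub> a)"
  using square.pure_closed[of x y] square.pure_balanced[of x b y] square.lsmult_pure[of a x y] square.rsmult_pure[of a x y]
  by (simp_all add: tensor_square_def square_tensor_def tensor_simps)

lemma square_left_hom: "y \<in> carrier A \<Longrightarrow> (\<lambda>x. x \<boxtimes> y) \<in> hom (add_monoid A) (add_monoid Q)"
  using square.pure_left_hom[of y] by (simp add: tensor_square_def square_tensor_def hom_def tensor_simps)

lemma square_right_hom: "x \<in> carrier A \<Longrightarrow> (\<lambda>y. x \<boxtimes> y) \<in> hom (add_monoid A) (add_monoid Q)"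
  using square.pure_right_hom[of x] by (simp add: tensor_square_def square_tensor_def hom_def tensor_simps)

lemma square_induct [consumes 1, case_names pure add]:
  assumes "q \<in> carrier Q"
    and "\<And>x y. x \<in> carrier A \<Longrightarrow> y \<in> carrier A \<Longrightarrow> P (x \<boxtimes> y)"
    and "\<And>s t. \<lbrakk>s \<in> carrier Q; t \<in> carrier Q; P s; P t\<rbrakk> \<Longrightarrow> P (s \<oplus>\<^bsub>Q\<^esub> t)"
  shows "P q"
  using square.tensor_induct[of q P] assms by (simp add: tensor_square_def square_tensor_def tensor_simps)

lemma square_eqI:
  assumes "f \<in> hom (add_monoid Q) (add_monoid G)" and "g \<in> hom (add_monoid Q) (add_monoid G)"
    and "\<And>x y. x \<in> carrier A \<Longrightarrow> y \<in> carrier A \<Longrightarrow> f (x \<boxtimes> y) = g (x \<boxtimes> y)"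
    and "q \<in> carrier Q"
  shows "f q = g q"
  by (rule square.additive_eqI[OF assms(1,2)[unfolded tensor_square_def hom_from_tensor]])
    (use assms(3,4) in \<open>simp_all add: tensor_square_def square_tensor_def tensor_simps\<close>)

lemma square_lift:
  assumes G: "abelian_group G" 
    and "\<And>x. x \<in> carrier A \<Longrightarrow> f x \<in> hom (add_monoid A) (add_monoid G)"
    and "\<And>y. y \<in> carrier A \<Longrightarrow> (\<lambda>x. f x y) \<in> hom (add_monoid A) (add_monoid G)"
    and "\<And>x b y. \<lbrakk>x \<in> carrier A; b \<in> B; y \<in> carrier A\<rbrakk> \<Longrightarrow> f (x \<otimes>\<^bsub>A\<^esub> b) y = f x (b \<otimes>\<^bsub>A\<^esub> y)"
  shows square_lift_hom: "tensor_lift G f \<in> hom (add_monoid Q) (add_monoid G)"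
    and square_lift_pure: "\<And>x y. \<lbrakk>x \<in> carrier A; y \<in> carrier A\<rbrakk> \<Longrightarrow> tensor_lift G f (x \<boxtimes> y) = f x y"
proof -
  have bal: "balanced_map (subring_of A B) (regular A) (regular A) G f"
    by (rule balanced_mapI) (use assms in \<open>simp_all add: hom_def\<close>)
  show "tensor_lift G f \<in> hom (add_monoid Q) (add_monoid G)"
    using square.lift_hom[OF G bal] by (simp add: tensor_square_def hom_from_tensor)
  show "tensor_lift G f (x \<boxtimes> y) = f x y" if "x \<in> carrier A" "y \<in> carrier A" for x y
    using square.lift_pure[OF G bal] that by (simp add: square_tensor_def)
qed

lemma square_lift_unique:
  assumes G: "abelian_group G" and g: "g \<in> hom (add_monoid Q) (add_monoid G)"
    and eq: "\<And>x y. x \<in> carrier A \<Longrightarrow> y \<in> carrier A \<Longrightarrow> f x y = g (x \<boxtimes> y)"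
    and q: "q \<in> carrier Q"
  shows "tensor_lift G f q = g q"
  by (rule square.lift_unique[OF G g[unfolded tensor_square_def hom_from_tensor]])
    (use eq q in \<open>simp_all add: tensor_square_def square_tensor_def tensor_simps\<close>)

lemma multiplication:
  shows multiplication_hom: "T_counit A \<in> hom (add_monoid Q) (add_monoid A)"
    and multiplication_pure: "\<lbrakk>x \<in> carrier A; y \<in> carrier A\<rbrakk> \<Longrightarrow> T_counit A (x \<boxtimes> y) = x \<otimes>\<^bsub>A\<^esub> y"
proof -
  have 1: "(\<lambda>y. x \<otimes>\<^bsub>A\<^esub> y) \<in> hom (add_monoid A) (add_monoid A)" if "x \<in> carrier A" for x
    using that by (intro homI) (simp_all add: A.r_distr)
  have 2: "(\<lambda>x. x \<otimes>\<^bsub>A\<^esub> y) \<in> hom (add_monoid A) (add_monoid A)" if "y \<in> carrier A" for y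
    using that by (intro homI) (simp_all add: A.l_distr)
  have 3: "x \<otimes>\<^bsub>A\<^esub> b \<otimes>\<^bsub>A\<^esub> y = x \<otimes>\<^bsub>A\<^esub> (b \<otimes>\<^bsub>A\<^esub> y)" if "x \<in> carrier A" "b \<in> B" "y \<in> carrier A" for x b y
    using that by (simp add: A.m_assoc B_in_A)
  show "T_counit A \<in> hom (add_monoid Q) (add_monoid A)"
    unfolding T_counit_def by (rule square_lift_hom[OF A.abelian_group_axioms 1 2 3])
  show "\<lbrakk>x \<in> carrier A; y \<in> carrier A\<rbrakk> \<Longrightarrow> T_counit A (x \<boxtimes> y) = x \<otimes>\<^bsub>A\<^esub> y"
    unfolding T_counit_def by (rule square_lift_pure[OF A.abelian_group_axioms 1 2 3])
qed

lemma multiplication_bimodule_hom: "T_counit A \<in> bimodule_hom A A Q (regular A)"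
proof (rule bimodule_homI)
  show "T_counit A \<in> hom (add_monoid Q) (add_monoid (regular A))"
    using multiplication_hom by (simp add: hom_def)
next
  fix a q assume a: "a \<in> carrier A" and q: "q \<in> carrier Q"
  have l: "(\<lambda>x. a \<otimes>\<^bsub>A\<^esub> x) \<in> hom (add_monoid A) (add_monoid A)" 
    using a by (intro homI) (simp_all add: A.r_distr)
  have r: "(\<lambda>x. x \<otimes>\<^bsub>A\<^esub> a) \<in> hom (add_monoid A) (add_monoid A)" 
    using a by (intro homI) (simp_all add: A.l_distr)
  have "T_counit A (a \<odot>\<^bsub>Q\<^esub> q) = a \<otimes>\<^bsub>A\<^esub> T_counit A q"
    by (rule square_eqI[OF additive_comp[OF lsmult_hom[OF Q_left a] multiplication_hom]
          additive_comp[OF multiplication_hom l] _ q])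
      (use a in \<open>simp add: square_lsmult multiplication_pure A.m_assoc\<close>)
  then show "T_counit A (a \<odot>\<^bsub>Q\<^esub> q) = a \<odot>\<^bsub>regular A\<^esub> T_counit A q" by simp
  have "T_counit A (q \<bullet>\<^bsub>Q\<^esub> a) = T_counit A q \<otimes>\<^bsub>A\<^esub> a"
    by (rule square_eqI[OF additive_comp[OF rsmult_hom[OF Q_right a] multiplication_hom]
          additive_comp[OF multiplication_hom r] _ q])
      (use a in \<open>simp add: square_rsmult multiplication_pure A.m_assoc\<close>)
  then show "T_counit A (q \<bullet>\<^bsub>Q\<^esub> a) = T_counit A q \<bullet>\<^bsub>regular A\<^esub> a" by simp
qed

text \<open>The comultiplication forced by a grouplike element \<open>h(1 \<otimes> 1)\<close>. For the identity of \<open>A \<otimes>\<^sub>B A\<close> it is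
  the Sweedler comultiplication, for the canonical map that of the canonical coring.\<close>

definition splitting ::
    "('a, 'm, 'a, 'q) bimodule_scheme \<Rightarrow> (('a, 'a) tens \<Rightarrow> 'm) \<Rightarrow> ('a, 'a) tens \<Rightarrow> ('m, 'm) tens" where
  "splitting N h = tensor_lift (tensor A N N)
     (\<lambda>a a'. pure_tensor A N N (h (a \<boxtimes> \<one>\<^bsub>A\<^esub>)) (h (\<one>\<^bsub>A\<^esub> \<boxtimes> a')))"

lemma splitting:
  assumes N: "bimodule A A N" and h: "h \<in> bimodule_hom A A Q N"
  shows splitting_hom: "splitting N h \<in> hom (add_monoid Q) (add_monoid (tensor A N N))"
    and splitting_pure: "\<lbrakk>a \<in> carrier A; a' \<in> carrier A\<rbrakk> \<Longrightarrow>
      splitting N h (a \<boxtimes> a') = pure_tensor A N N (h (a \<boxtimes> \<one>\<^bsub>A\<^esub>)) (h (\<one>\<^bsub>A\<^esub> \<boxtimes> a'))"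
proof -
  interpret NN: tensor_bimodule A A A N N
    using N by (simp add: tensor_bimodule_def)
  note h_hom = bimodule_homD[OF h]
  note h_closed = homD(1)[OF h_hom(3)]
  let ?f = "\<lambda>a a'. pure_tensor A N N (h (a \<boxtimes> \<one>\<^bsub>A\<^esub>)) (h (\<one>\<^bsub>A\<^esub> \<boxtimes> a'))"
  have 1: "?f a \<in> hom (add_monoid A) (add_monoid (tensor A N N))" if "a \<in> carrier A" for a
    using that unfolding hom_into_tensor
    by (intro additive_comp[OF additive_comp[OF square_right_hom h_hom(3)] NN.pure_right_hom]) (simp_all add: h_closed)
  have 2: "(\<lambda>a. ?f a a') \<in> hom (add_monoid A) (add_monoid (tensor A N N))" if "a' \<in> carrier A" for a'
    using that unfolding hom_into_tensor
    by (intro additive_comp[OF additive_comp[OF square_left_hom h_hom(3)] NN.pure_left_hom]) (simp_all add: h_closed)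
  have 3: "?f (a \<otimes>\<^bsub>A\<^esub> b) a' = ?f a (b \<otimes>\<^bsub>A\<^esub> a')" if "a \<in> carrier A" "b \<in> B" "a' \<in> carrier A" for a b a'
  proof -
    note c = that B_in_A[OF that(2)]
    have "(a \<otimes>\<^bsub>A\<^esub> b) \<boxtimes> \<one>\<^bsub>A\<^esub> = (a \<boxtimes> \<one>\<^bsub>A\<^esub>) \<bullet>\<^bsub>Q\<^esub> b" "\<one>\<^bsub>A\<^esub> \<boxtimes> (b \<otimes>\<^bsub>A\<^esub> a') = b \<odot>\<^bsub>Q\<^esub> (\<one>\<^bsub>A\<^esub> \<boxtimes> a')"
      using c square_balanced[of "\<one>\<^bsub>A\<^esub>" b a'] by (simp_all add: square_balanced square_rsmult square_lsmult)
    then show ?thesis using c by (simp add: h_hom(4,5) NN.pure_balanced h_closed)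
  qed
  show "splitting N h \<in> hom (add_monoid Q) (add_monoid (tensor A N N))"
    unfolding splitting_def by (rule square_lift_hom[OF NN.tensor_abelian_group 1 2 3])
  show "\<lbrakk>a \<in> carrier A; a' \<in> carrier A\<rbrakk> \<Longrightarrow> splitting N h (a \<boxtimes> a') = ?f a a'"
    unfolding splitting_def by (rule square_lift_pure[OF NN.tensor_abelian_group 1 2 3])
qed

lemma T_simps:
  "\<zero>\<^bsub>T\<^esub> = \<zero>\<^bsub>Q\<^esub>" "ring.add T = ring.add Q" "smult T = smult Q" "rsmult T = rsmult Q"
  "\<one>\<^bsub>T\<^esub> = \<one>\<^bsub>A\<^esub> \<boxtimes> \<one>\<^bsub>A\<^esub>"
  by (simp_all add: T_ring_def Let_def)

lemma T_iff: "t \<in> carrier T \<longleftrightarrow> t \<in> carrier Q \<and> (\<forall>b\<in>B. b \<odot>\<^bsub>Q\<^esub> t = t \<bullet>\<^bsub>Q\<^esub> b)"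
  by (simp add: T_ring_def Let_def)

lemma T_in_Q: "t \<in> carrier T \<Longrightarrow> t \<in> carrier Q" by (simp add: T_iff)

lemma T_commute: "t \<in> carrier T \<Longrightarrow> b \<in> B \<Longrightarrow> b \<odot>\<^bsub>Q\<^esub> t = t \<bullet>\<^bsub>Q\<^esub> b" by (simp add: T_iff)

lemma one_T: "\<one>\<^bsub>T\<^esub> \<in> carrier T"
  using square_balanced[of "\<one>\<^bsub>A\<^esub>" _ "\<one>\<^bsub>A\<^esub>"] by (auto simp: T_iff T_simps square_lsmult square_rsmult B_in_A)

lemma T_group: "abelian_group T"
proof (rule abelian_groupI, unfold T_simps)
  show "\<zero>\<^bsub>Q\<^esub> \<in> carrier T"
    using additive_finsum[OF Q_group Q_group lsmult_hom[OF Q_left], of _ "\<lambda>_. undefined" "{}"]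
      additive_finsum[OF Q_group Q_group rsmult_hom[OF Q_right], of _ "\<lambda>_. undefined" "{}"]
    by (simp add: T_iff B_in_A)
next
  fix s t assume s: "s \<in> carrier T" and t: "t \<in> carrier T"
  then show "s \<oplus>\<^bsub>Q\<^esub> t \<in> carrier T" by (simp add: T_iff Q.lsmult_add Q.rsmult_add B_in_A)
next
  fix t assume t: "t \<in> carrier T"
  have "\<ominus>\<^bsub>Q\<^esub> t \<in> carrier T"
    using t additive_inv[OF Q_group Q_group lsmult_hom[OF Q_left]] additive_inv[OF Q_group Q_group rsmult_hom[OF Q_right]]
    by (simp add: T_iff B_in_A)
  then show "\<exists>s\<in>carrier T. s \<oplus>\<^bsub>Q\<^esub> t = \<zero>\<^bsub>Q\<^esub>" using Q.M.l_neg[OF T_in_Q[OF t]] by blast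
qed (simp_all add: T_in_Q Q.M.a_ac)

lemma T_inclusion: "(\<lambda>t. t) \<in> hom (add_monoid T) (add_monoid Q)"
  by (simp add: hom_def T_simps T_in_Q)

lemma finsum_T: "g \<in> I \<rightarrow> carrier T \<Longrightarrow> finite I \<Longrightarrow> finsum T g I = finsum Q g I"
  by (rule additive_finsum[OF T_group Q_group T_inclusion])

lemma T_lsmult:
  assumes r: "r \<in> R" and t: "t \<in> carrier T"
  shows "r \<odot>\<^bsub>Q\<^esub> t \<in> carrier T"
proof -
  have "b \<odot>\<^bsub>Q\<^esub> (r \<odot>\<^bsub>Q\<^esub> t) = (r \<odot>\<^bsub>Q\<^esub> t) \<bullet>\<^bsub>Q\<^esub> b" if b: "b \<in> B" for b
  proof -
    have "b \<odot>\<^bsub>Q\<^esub> (r \<odot>\<^bsub>Q\<^esub> t) = (r \<otimes>\<^bsub>A\<^esub> b) \<odot>\<^bsub>Q\<^esub> t"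
      using b r t by (simp add: Q.lsmult_assoc B_in_A R_in_A T_in_Q R_commute)
    also have "\<dots> = r \<odot>\<^bsub>Q\<^esub> (t \<bullet>\<^bsub>Q\<^esub> b)"
      using b r t by (simp add: Q.lsmult_assoc B_in_A R_in_A T_in_Q T_commute)
    finally show ?thesis using b r t by (simp add: Q.bimodule_assoc B_in_A R_in_A T_in_Q)
  qed
  then show ?thesis using r t by (simp add: T_iff Q.lsmult_closed R_in_A)
qed

lemma T_rsmult:
  assumes r: "r \<in> R" and t: "t \<in> carrier T"
  shows "t \<bullet>\<^bsub>Q\<^esub> r \<in> carrier T"
proof -
  have "b \<odot>\<^bsub>Q\<^esub> (t \<bullet>\<^bsub>Q\<^esub> r) = (t \<bullet>\<^bsub>Q\<^esub> r) \<bullet>\<^bsub>Q\<^esub> b" if b: "b \<in> B" for b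
  proof -
    have "b \<odot>\<^bsub>Q\<^esub> (t \<bullet>\<^bsub>Q\<^esub> r) = (t \<bullet>\<^bsub>Q\<^esub> b) \<bullet>\<^bsub>Q\<^esub> r"
      using b r t Q.bimodule_assoc[of b t r] by (simp add: B_in_A R_in_A T_in_Q T_commute)
    also have "\<dots> = t \<bullet>\<^bsub>Q\<^esub> (r \<otimes>\<^bsub>A\<^esub> b)"
      using b r t Q.rsmult_assoc[of t b r] by (simp add: B_in_A R_in_A T_in_Q R_commute)
    finally show ?thesis using b r t by (simp add: Q.rsmult_assoc B_in_A R_in_A T_in_Q)
  qed
  then show ?thesis using r t by (simp add: T_iff Q.rsmult_closed R_in_A)
qed

lemma T_bimodule: "bimodule (subring_of A R) (subring_of A R) T"
proof -
  have rings: "ring (subring_of A R)" by (rule A.subring_is_ring[OF R_subring])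
  show ?thesis
    by (intro bimodule.intro left_module.intro right_module.intro bimodule_axioms.intro rings
        left_module_axioms.intro right_module_axioms.intro T_group)
      (simp_all add: T_simps T_lsmult T_rsmult T_in_Q R_in_A Q.lsmult_add Q.lsmult_add_scalar Q.lsmult_assoc
        Q.lsmult_one Q.rsmult_add Q.rsmult_add_scalar Q.rsmult_assoc Q.rsmult_one Q.bimodule_assoc)
qed

text \<open>The product of \<open>T\<close> makes sense with an arbitrary right factor \<open>q\<close> in \<open>A \<otimes>\<^sub>B A\<close>: it is
  \<open>q\<^sup>1 t q\<^sup>2\<close>, which is balanced over \<open>B\<close> because \<open>t\<close> commutes with \<open>B\<close>. For fixed \<open>t\<close> this is an
  endomorphism of the \<open>A\<close>-\<open>A\<close>-bimodule \<open>A \<otimes>\<^sub>B A\<close>, whence \<open>T\<close> is closed under the product.\<close>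

lemma sandwich:
  assumes t: "t \<in> carrier T"
  shows sandwich_hom: "monoid.mult T t \<in> hom (add_monoid Q) (add_monoid Q)"
    and sandwich_pure: "\<lbrakk>x \<in> carrier A; y \<in> carrier A\<rbrakk> \<Longrightarrow> t \<otimes>\<^bsub>T\<^esub> (x \<boxtimes> y) = (x \<odot>\<^bsub>Q\<^esub> t) \<bullet>\<^bsub>Q\<^esub> y"
proof -
  let ?f = "\<lambda>x y. (x \<odot>\<^bsub>Q\<^esub> t) \<bullet>\<^bsub>Q\<^esub> y"
  have eq: "monoid.mult T t = tensor_lift Q ?f"
    by (simp add: T_ring_def Let_def)
  note tQ = T_in_Q[OF t]
  have a: "?f x \<in> hom (add_monoid A) (add_monoid Q)" if "x \<in> carrier A" for x
    using that tQ by (intro homI) (simp_all add: Q.lsmult_closed Q.rsmult_closed Q.rsmult_add_scalar)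
  have b: "(\<lambda>x. ?f x y) \<in> hom (add_monoid A) (add_monoid Q)" if "y \<in> carrier A" for y
    using that tQ by (intro homI) (simp_all add: Q.lsmult_closed Q.rsmult_closed Q.rsmult_add Q.lsmult_add_scalar)
  have c: "?f (x \<otimes>\<^bsub>A\<^esub> b) y = ?f x (b \<otimes>\<^bsub>A\<^esub> y)" if "x \<in> carrier A" "b \<in> B" "y \<in> carrier A" for x b y
    using that tQ by (simp add: Q.lsmult_assoc B_in_A T_commute[OF t] Q.rsmult_assoc Q.lsmult_closed
        Q.bimodule_assoc[symmetric])
  show "monoid.mult T t \<in> hom (add_monoid Q) (add_monoid Q)"
    unfolding eq by (rule square_lift_hom[OF Q_group a b c])
  show "t \<otimes>\<^bsub>T\<^esub> (x \<boxtimes> y) = ?f x y" if "x \<in> carrier A" "y \<in> carrier A"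
    unfolding eq by (rule square_lift_pure[OF Q_group a b c that])
qed

lemma sandwich_closed: "t \<in> carrier T \<Longrightarrow> q \<in> carrier Q \<Longrightarrow> t \<otimes>\<^bsub>T\<^esub> q \<in> carrier Q"
  by (rule homD(1)[OF sandwich_hom])

lemma sandwich_lsmult:
  assumes t: "t \<in> carrier T" and a: "a \<in> carrier A" and q: "q \<in> carrier Q"
  shows "t \<otimes>\<^bsub>T\<^esub> (a \<odot>\<^bsub>Q\<^esub> q) = a \<odot>\<^bsub>Q\<^esub> (t \<otimes>\<^bsub>T\<^esub> q)"
  by (rule square_eqI[OF additive_comp[OF lsmult_hom[OF Q_left a] sandwich_hom[OF t]]
        additive_comp[OF sandwich_hom[OF t] lsmult_hom[OF Q_left a]] _ q])
    (use t a in \<open>simp add: square_lsmult sandwich_pure Q.lsmult_assoc Q.bimodule_assoc Q.lsmult_closed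
      Q.rsmult_closed T_in_Q\<close>)

lemma sandwich_rsmult:
  assumes t: "t \<in> carrier T" and a: "a \<in> carrier A" and q: "q \<in> carrier Q"
  shows "t \<otimes>\<^bsub>T\<^esub> (q \<bullet>\<^bsub>Q\<^esub> a) = (t \<otimes>\<^bsub>T\<^esub> q) \<bullet>\<^bsub>Q\<^esub> a"
  by (rule square_eqI[OF additive_comp[OF rsmult_hom[OF Q_right a] sandwich_hom[OF t]]
        additive_comp[OF sandwich_hom[OF t] rsmult_hom[OF Q_right a]] _ q])
    (use t a in \<open>simp add: square_rsmult sandwich_pure Q.rsmult_assoc Q.lsmult_closed T_in_Q\<close>)

lemma T_mult_closed: "t \<in> carrier T \<Longrightarrow> t' \<in> carrier T \<Longrightarrow> t \<otimes>\<^bsub>T\<^esub> t' \<in> carrier T"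
  by (subst T_iff) (simp add: sandwich_closed B_in_A T_in_Q T_commute
      sandwich_lsmult[symmetric] sandwich_rsmult[symmetric])


section \<open>Bijectivity of the canonical map\<close>

abbreviation AT where "AT \<equiv> A_tensor_T A B"
abbreviation at (infixl "\<boxdot>" 75) where "a \<boxdot> t \<equiv> AT_tensor A B a t"

sublocale AT: tensor_bimodule A "subring_of A R" "subring_of A R" "regular A" T
  using regular_right[OF R_subring] T_bimodule by (simp add: tensor_bimodule_def)

lemma AT_group: "abelian_group AT"
  unfolding A_tensor_T_def by (rule AT.tensor_abelian_group)

lemma AT_left: "left_module A AT"
  using AT.tensor_is_bimodule by (simp add: A_tensor_T_def bimodule_def)

lemma
  shows at_closed [simp]: "\<lbrakk>a \<in> carrier A; t \<in> carrier T\<rbrakk> \<Longrightarrow> a \<boxdot> t \<in> carrier AT"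
    and at_balanced: "\<lbrakk>a \<in> carrier A; r \<in> R; t \<in> carrier T\<rbrakk> \<Longrightarrow> (a \<otimes>\<^bsub>A\<^esub> r) \<boxdot> t = a \<boxdot> (r \<odot>\<^bsub>Q\<^esub> t)"
    and at_lsmult: "\<lbrakk>b \<in> carrier A; a \<in> carrier A; t \<in> carrier T\<rbrakk> \<Longrightarrow> b \<odot>\<^bsub>AT\<^esub> (a \<boxdot> t) = (b \<otimes>\<^bsub>A\<^esub> a) \<boxdot> t"
  using AT.pure_closed[of a t] AT.pure_balanced[of a r t] AT.lsmult_pure[of b a t]
  by (simp_all add: A_tensor_T_def AT_tensor_def tensor_def Let_def T_simps)

lemma at_left_hom: "t \<in> carrier T \<Longrightarrow> (\<lambda>a. a \<boxdot> t) \<in> hom (add_monoid A) (add_monoid AT)"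
  using AT.pure_left_hom[of t] by (simp add: A_tensor_T_def AT_tensor_def hom_def tensor_simps)

lemma at_right_hom: "a \<in> carrier A \<Longrightarrow> (\<lambda>t. a \<boxdot> t) \<in> hom (add_monoid T) (add_monoid AT)"
  using AT.pure_right_hom[of a] by (simp add: A_tensor_T_def AT_tensor_def hom_def tensor_simps)

lemma AT_eqI:
  assumes "f \<in> hom (add_monoid AT) (add_monoid G)" and "g \<in> hom (add_monoid AT) (add_monoid G)"
    and "\<And>a t. a \<in> carrier A \<Longrightarrow> t \<in> carrier T \<Longrightarrow> f (a \<boxdot> t) = g (a \<boxdot> t)"
    and "c \<in> carrier AT"
  shows "f c = g c"
  by (rule AT.additive_eqI[OF assms(1,2)[unfolded A_tensor_T_def hom_from_tensor]])
    (use assms(3,4) in \<open>simp_all add: A_tensor_T_def AT_tensor_def tensor_simps\<close>)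

lemma AT_lift_unique:
  assumes G: "abelian_group G" and g: "g \<in> hom (add_monoid AT) (add_monoid G)"
    and eq: "\<And>a t. a \<in> carrier A \<Longrightarrow> t \<in> carrier T \<Longrightarrow> f a t = g (a \<boxdot> t)"
    and c: "c \<in> carrier AT"
  shows "tensor_lift G f c = g c"
  by (rule AT.lift_unique[OF G g[unfolded A_tensor_T_def hom_from_tensor]])
    (use eq c in \<open>simp_all add: A_tensor_T_def AT_tensor_def tensor_simps\<close>)

text \<open>The inverse of the canonical map.\<close>

definition evaluate :: "('a, ('a, 'a) tens) tens \<Rightarrow> ('a, 'a) tens" where
  "evaluate = tensor_lift Q (\<lambda>a t. a \<odot>\<^bsub>Q\<^esub> t)"

lemma evaluate_hom: "evaluate \<in> hom (add_monoid AT) (add_monoid Q)"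
  and evaluate_at: "\<And>a t. \<lbrakk>a \<in> carrier A; t \<in> carrier T\<rbrakk> \<Longrightarrow> evaluate (a \<boxdot> t) = a \<odot>\<^bsub>Q\<^esub> t"
proof -
  have bal: "balanced_map (subring_of A R) (regular A) T Q (\<lambda>a t. a \<odot>\<^bsub>Q\<^esub> t)"
    by (intro balanced_mapI homI)
      (simp_all add: T_simps T_in_Q R_in_A Q.lsmult_closed Q.lsmult_add Q.lsmult_add_scalar Q.lsmult_assoc)
  show "evaluate \<in> hom (add_monoid AT) (add_monoid Q)"
    using AT.lift_hom[OF Q_group bal] by (simp only: evaluate_def A_tensor_T_def hom_from_tensor)
  show "\<And>a t. \<lbrakk>a \<in> carrier A; t \<in> carrier T\<rbrakk> \<Longrightarrow> evaluate (a \<boxdot> t) = a \<odot>\<^bsub>Q\<^esub> t"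
    using AT.lift_pure[OF Q_group bal] by (simp add: evaluate_def AT_tensor_def)
qed

lemma evaluate_lsmult:
  assumes a: "a \<in> carrier A" and c: "c \<in> carrier AT"
  shows "evaluate (a \<odot>\<^bsub>AT\<^esub> c) = a \<odot>\<^bsub>Q\<^esub> evaluate c"
  by (rule AT_eqI[OF additive_comp[OF lsmult_hom[OF AT_left a] evaluate_hom]
        additive_comp[OF evaluate_hom lsmult_hom[OF Q_left a]] _ c])
    (use a in \<open>simp add: at_lsmult evaluate_at Q.lsmult_assoc T_in_Q\<close>)

end

locale D2_quasibase = subring_extension A B for A :: "('a, 'p) ring_scheme" and B +
  fixes n :: nat and \<gamma> :: "nat \<Rightarrow> 'a \<Rightarrow> 'a" and u :: "nat \<Rightarrow> ('a, 'a) tens"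
  assumes quasibase: "right_D2_quasibase A B n \<gamma> u"

begin

lemma \<gamma>_hom: "j < n \<Longrightarrow> \<gamma> j \<in> hom (add_monoid A) (add_monoid A)"
  using quasibase by (auto simp: right_D2_quasibase_def bimodule_End_def bimodule_hom_def left_module_hom_def hom_def)

lemma \<gamma>_closed [simp]: "j < n \<Longrightarrow> a \<in> carrier A \<Longrightarrow> \<gamma> j a \<in> carrier A"
  by (rule homD(1)[OF \<gamma>_hom])

lemma \<gamma>_left: "j < n \<Longrightarrow> b \<in> B \<Longrightarrow> a \<in> carrier A \<Longrightarrow> \<gamma> j (b \<otimes>\<^bsub>A\<^esub> a) = b \<otimes>\<^bsub>A\<^esub> \<gamma> j a"
  using quasibase by (auto simp: right_D2_quasibase_def bimodule_End_def bimodule_hom_def left_module_hom_def)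

lemma \<gamma>_right: "j < n \<Longrightarrow> b \<in> B \<Longrightarrow> a \<in> carrier A \<Longrightarrow> \<gamma> j (a \<otimes>\<^bsub>A\<^esub> b) = \<gamma> j a \<otimes>\<^bsub>A\<^esub> b"
  using quasibase by (auto simp: right_D2_quasibase_def bimodule_End_def bimodule_hom_def right_module_hom_def)

lemma u_T [simp]: "j < n \<Longrightarrow> u j \<in> carrier T"
  using quasibase by (simp add: right_D2_quasibase_def)

lemma u_Q [simp]: "j < n \<Longrightarrow> u j \<in> carrier Q"
  by (rule T_in_Q[OF u_T])

lemma quasibase_expansion:
  "a \<in> carrier A \<Longrightarrow> a' \<in> carrier A \<Longrightarrow> (\<Oplus>\<^bsub>Q\<^esub>j\<in>{..<n}. (a \<otimes>\<^bsub>A\<^esub> \<gamma> j a') \<odot>\<^bsub>Q\<^esub> u j) = a \<boxtimes> a'"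
  using quasibase by (simp add: right_D2_quasibase_def)

abbreviation \<rho> where "\<rho> \<equiv> coaction A B n \<gamma> u"

lemma coaction_hom: "\<rho> \<in> hom (add_monoid A) (add_monoid AT)"
proof -
  have "(\<lambda>a. \<Oplus>\<^bsub>AT\<^esub>j\<in>{..<n}. \<gamma> j a \<boxdot> u j) \<in> hom (add_monoid A) (add_monoid AT)"
    by (rule additive_sum[OF AT_group additive_comp[OF \<gamma>_hom at_left_hom]]) simp_all
  then show ?thesis by (simp add: coaction_def[abs_def])
qed

lemma coaction_closed [simp]: "a \<in> carrier A \<Longrightarrow> \<rho> a \<in> carrier AT"
  by (rule homD(1)[OF coaction_hom])

lemma lsmult_coaction:
  assumes a: "a \<in> carrier A" and a': "a' \<in> carrier A"
  shows "a \<odot>\<^bsub>AT\<^esub> \<rho> a' = (\<Oplus>\<^bsub>AT\<^esub>j\<in>{..<n}. (a \<otimes>\<^bsub>A\<^esub> \<gamma> j a') \<boxdot> u j)"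
proof -
  have "a \<odot>\<^bsub>AT\<^esub> \<rho> a' = (\<Oplus>\<^bsub>AT\<^esub>j\<in>{..<n}. a \<odot>\<^bsub>AT\<^esub> (\<gamma> j a' \<boxdot> u j))"
    unfolding coaction_def using a' by (intro additive_finsum[OF AT_group AT_group lsmult_hom[OF AT_left a]]) auto
  also have "\<dots> = (\<Oplus>\<^bsub>AT\<^esub>j\<in>{..<n}. (a \<otimes>\<^bsub>A\<^esub> \<gamma> j a') \<boxdot> u j)"
    using a a' by (intro abelian_monoid.finsum_cong'[OF abelian_group.axioms(1)[OF AT_group]]) (auto simp: at_lsmult)
  finally show ?thesis .
qed

text \<open>The quasibase equation for \<open>1 \<otimes> a\<close>: the coaction is the preimage of \<open>1 \<otimes> a\<close> under
  evaluation.\<close>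

lemma evaluate_coaction:
  assumes a: "a \<in> carrier A"
  shows "evaluate (\<rho> a) = \<one>\<^bsub>A\<^esub> \<boxtimes> a"
proof -
  have "evaluate (\<rho> a) = (\<Oplus>\<^bsub>Q\<^esub>j\<in>{..<n}. evaluate (\<gamma> j a \<boxdot> u j))"
    unfolding coaction_def using a by (intro additive_finsum[OF AT_group Q_group evaluate_hom]) auto
  also have "\<dots> = (\<Oplus>\<^bsub>Q\<^esub>j\<in>{..<n}. (\<one>\<^bsub>A\<^esub> \<otimes>\<^bsub>A\<^esub> \<gamma> j a) \<odot>\<^bsub>Q\<^esub> u j)"
    using a by (intro Q.M.finsum_cong') (auto simp: evaluate_at Q.lsmult_closed)
  also have "\<dots> = \<one>\<^bsub>A\<^esub> \<boxtimes> a" using a by (rule quasibase_expansion[OF A.one_closed])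
  finally show ?thesis .
qed

text \<open>The canonical map, with values in the left \<open>A\<close>-module \<open>A \<otimes>\<^sub>R T\<close>: that the coring has a right action
  of \<open>A\<close> is a consequence of the bijectivity of this map.\<close>

definition canon :: "('a, 'a) tens \<Rightarrow> ('a, ('a, 'a) tens) tens" where
  "canon = tensor_lift AT (\<lambda>a a'. a \<odot>\<^bsub>AT\<^esub> \<rho> a')"

lemma canon_hom: "canon \<in> hom (add_monoid Q) (add_monoid AT)"
  and canon_pure: "\<And>a a'. \<lbrakk>a \<in> carrier A; a' \<in> carrier A\<rbrakk> \<Longrightarrow> canon (a \<boxtimes> a') = a \<odot>\<^bsub>AT\<^esub> \<rho> a'"
proof -
  let ?f = "\<lambda>a a'. a \<odot>\<^bsub>AT\<^esub> \<rho> a'"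
  interpret AT: left_module A AT by (rule AT_left)
  have 1: "?f a \<in> hom (add_monoid A) (add_monoid AT)" if "a \<in> carrier A" for a
    by (rule additive_comp[OF coaction_hom lsmult_hom[OF AT_left that]])
  have 2: "(\<lambda>a. ?f a a') \<in> hom (add_monoid A) (add_monoid AT)" if "a' \<in> carrier A" for a'
    using that by (intro homI) (simp_all add: AT.lsmult_closed AT.lsmult_add_scalar)
  have 3: "?f (a \<otimes>\<^bsub>A\<^esub> b) a' = ?f a (b \<otimes>\<^bsub>A\<^esub> a')" if "a \<in> carrier A" "b \<in> B" "a' \<in> carrier A" for a b a'
    unfolding lsmult_coaction[OF A.m_closed[OF that(1) B_in_A[OF that(2)]] that(3)]
      lsmult_coaction[OF that(1) A.m_closed[OF B_in_A[OF that(2)] that(3)]]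
    using that by (intro AT.M.finsum_cong') (auto simp: \<gamma>_left A.m_assoc B_in_A)
  show "canon \<in> hom (add_monoid Q) (add_monoid AT)"
    unfolding canon_def by (rule square_lift_hom[OF AT_group 1 2 3])
  show "\<And>a a'. \<lbrakk>a \<in> carrier A; a' \<in> carrier A\<rbrakk> \<Longrightarrow> canon (a \<boxtimes> a') = a \<odot>\<^bsub>AT\<^esub> \<rho> a'"
    unfolding canon_def by (rule square_lift_pure[OF AT_group 1 2 3])
qed

lemma canon_closed: "q \<in> carrier Q \<Longrightarrow> canon q \<in> carrier AT"
  by (rule homD(1)[OF canon_hom])

lemma canon_lsmult:
  assumes a: "a \<in> carrier A" and q: "q \<in> carrier Q"
  shows "canon (a \<odot>\<^bsub>Q\<^esub> q) = a \<odot>\<^bsub>AT\<^esub> canon q"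
  by (rule square_eqI[OF additive_comp[OF lsmult_hom[OF Q_left a] canon_hom]
        additive_comp[OF canon_hom lsmult_hom[OF AT_left a]] _ q])
    (use a in \<open>simp add: square_lsmult canon_pure left_module.lsmult_assoc[OF AT_left]\<close>)

lemma evaluate_canon:
  assumes q: "q \<in> carrier Q"
  shows "evaluate (canon q) = q"
  by (rule square_eqI[OF additive_comp[OF canon_hom evaluate_hom] additive_id _ q])
    (simp add: canon_pure evaluate_lsmult evaluate_coaction square_lsmult)

text \<open>The map \<open>q \<mapsto> q\<^sup>1 \<gamma>\<^sub>j(q\<^sup>2)\<close>, whose values are the coefficients of \<open>q\<close> over the \<open>u\<^sub>j\<close>.\<close>

definition coefficient :: "nat \<Rightarrow> ('a, 'a) tens \<Rightarrow> 'a" where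
  "coefficient j = tensor_lift A (\<lambda>x y. x \<otimes>\<^bsub>A\<^esub> \<gamma> j y)"

lemma coefficient:
  assumes j: "j < n"
  shows coefficient_hom: "coefficient j \<in> hom (add_monoid Q) (add_monoid A)"
    and coefficient_pure: "\<lbrakk>x \<in> carrier A; y \<in> carrier A\<rbrakk> \<Longrightarrow> coefficient j (x \<boxtimes> y) = x \<otimes>\<^bsub>A\<^esub> \<gamma> j y"
proof -
  have 1: "(\<lambda>y. x \<otimes>\<^bsub>A\<^esub> \<gamma> j y) \<in> hom (add_monoid A) (add_monoid A)" if "x \<in> carrier A" for x
    using that j homD(2)[OF \<gamma>_hom] by (intro homI) (simp_all add: A.r_distr)
  have 2: "(\<lambda>x. x \<otimes>\<^bsub>A\<^esub> \<gamma> j y) \<in> hom (add_monoid A) (add_monoid A)" if "y \<in> carrier A" for y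
    using that j by (intro homI) (simp_all add: A.l_distr)
  have 3: "x \<otimes>\<^bsub>A\<^esub> b \<otimes>\<^bsub>A\<^esub> \<gamma> j y = x \<otimes>\<^bsub>A\<^esub> \<gamma> j (b \<otimes>\<^bsub>A\<^esub> y)" if "x \<in> carrier A" "b \<in> B" "y \<in> carrier A" for x b y
    using that j by (simp add: \<gamma>_left A.m_assoc B_in_A)
  show "coefficient j \<in> hom (add_monoid Q) (add_monoid A)"
    unfolding coefficient_def by (rule square_lift_hom[OF A.abelian_group_axioms 1 2 3])
  show "\<lbrakk>x \<in> carrier A; y \<in> carrier A\<rbrakk> \<Longrightarrow> coefficient j (x \<boxtimes> y) = x \<otimes>\<^bsub>A\<^esub> \<gamma> j y"
    unfolding coefficient_def by (rule square_lift_pure[OF A.abelian_group_axioms 1 2 3])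
qed

lemma coefficient_closed: "j < n \<Longrightarrow> q \<in> carrier Q \<Longrightarrow> coefficient j q \<in> carrier A"
  by (rule homD(1)[OF coefficient_hom])

lemma coefficient_expansion:
  assumes q: "q \<in> carrier Q"
  shows "(\<Oplus>\<^bsub>Q\<^esub>j\<in>{..<n}. coefficient j q \<odot>\<^bsub>Q\<^esub> u j) = q"
proof (rule square_eqI[OF additive_sum[OF Q_group] additive_id _ q])
  fix j assume j: "j \<in> {..<n}"
  have "(\<lambda>a. a \<odot>\<^bsub>Q\<^esub> u j) \<in> hom (add_monoid A) (add_monoid Q)"
    using j by (intro homI) (simp_all add: Q.lsmult_closed Q.lsmult_add_scalar)
  then show "(\<lambda>q. coefficient j q \<odot>\<^bsub>Q\<^esub> u j) \<in> hom (add_monoid Q) (add_monoid Q)"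
    using j by (intro additive_comp[OF coefficient_hom]) auto
next
  fix x y assume xy: "x \<in> carrier A" "y \<in> carrier A"
  then have "(\<Oplus>\<^bsub>Q\<^esub>j\<in>{..<n}. coefficient j (x \<boxtimes> y) \<odot>\<^bsub>Q\<^esub> u j) = (\<Oplus>\<^bsub>Q\<^esub>j\<in>{..<n}. (x \<otimes>\<^bsub>A\<^esub> \<gamma> j y) \<odot>\<^bsub>Q\<^esub> u j)"
    by (intro Q.M.finsum_cong') (auto simp: coefficient_pure Q.lsmult_closed)
  then show "(\<Oplus>\<^bsub>Q\<^esub>j\<in>{..<n}. coefficient j (x \<boxtimes> y) \<odot>\<^bsub>Q\<^esub> u j) = x \<boxtimes> y"
    using quasibase_expansion xy by simp
qed simp

lemma canon_coefficients:
  assumes q: "q \<in> carrier Q"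
  shows "canon q = (\<Oplus>\<^bsub>AT\<^esub>j\<in>{..<n}. coefficient j q \<boxdot> u j)"
proof (rule square_eqI[OF canon_hom additive_sum[OF AT_group] _ q])
  fix j assume j: "j \<in> {..<n}"
  then show "(\<lambda>q. coefficient j q \<boxdot> u j) \<in> hom (add_monoid Q) (add_monoid AT)"
    by (intro additive_comp[OF coefficient_hom at_left_hom]) auto
next
  fix x y assume xy: "x \<in> carrier A" "y \<in> carrier A"
  interpret AT: abelian_group AT by (rule AT_group)
  show "canon (x \<boxtimes> y) = (\<Oplus>\<^bsub>AT\<^esub>j\<in>{..<n}. coefficient j (x \<boxtimes> y) \<boxdot> u j)"
    unfolding canon_pure[OF xy] lsmult_coaction[OF xy]
    using xy by (intro AT.finsum_cong') (auto simp: coefficient_pure)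
qed simp

text \<open>The coefficient map is left \<open>A\<close>-linear and right \<open>B\<close>-linear, so it sends elements commuting with \<open>B\<close>
  to elements commuting with \<open>B\<close>.\<close>

lemma coefficient_R:
  assumes j: "j < n" and t: "t \<in> carrier T"
  shows "coefficient j t \<in> R"
proof -
  have left: "coefficient j (b \<odot>\<^bsub>Q\<^esub> q) = b \<otimes>\<^bsub>A\<^esub> coefficient j q" if b: "b \<in> carrier A" and q: "q \<in> carrier Q" for b q
  proof (rule square_eqI[OF additive_comp[OF lsmult_hom[OF Q_left b] coefficient_hom[OF j]] additive_comp[OF coefficient_hom[OF j]] _ q])
    show "(\<lambda>a. b \<otimes>\<^bsub>A\<^esub> a) \<in> hom (add_monoid A) (add_monoid A)" using b by (intro homI) (simp_all add: A.r_distr)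
  qed (use j b in \<open>simp add: square_lsmult coefficient_pure A.m_assoc\<close>)
  have right: "coefficient j (q \<bullet>\<^bsub>Q\<^esub> b) = coefficient j q \<otimes>\<^bsub>A\<^esub> b" if b: "b \<in> B" and q: "q \<in> carrier Q" for b q
  proof (rule square_eqI[OF additive_comp[OF rsmult_hom[OF Q_right B_in_A[OF b]] coefficient_hom[OF j]] additive_comp[OF coefficient_hom[OF j]] _ q])
    show "(\<lambda>a. a \<otimes>\<^bsub>A\<^esub> b) \<in> hom (add_monoid A) (add_monoid A)" using b B_in_A by (intro homI) (simp_all add: A.l_distr)
  qed (use j b B_in_A in \<open>simp add: square_rsmult coefficient_pure \<gamma>_right A.m_assoc\<close>)
  show ?thesis
    using left[OF B_in_A T_in_Q[OF t]] right[OF _ T_in_Q[OF t]] coefficient_closed[OF j T_in_Q[OF t]] T_commute[OF t]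
    by (simp add: centralizer_def)
qed

text \<open>The coefficients of \<open>t\<close> lie in \<open>R\<close>, so they may be moved across \<open>\<otimes>\<^sub>R\<close> onto the \<open>u\<^sub>j\<close>, where the
  quasibase equation adds them up to \<open>t\<close>.\<close>

lemma canon_T:
  assumes t: "t \<in> carrier T"
  shows "canon t = \<one>\<^bsub>A\<^esub> \<boxdot> t"
proof -
  interpret AT: abelian_group AT by (rule AT_group)
  note tQ = T_in_Q[OF t]
  have T: "(\<lambda>j. coefficient j t \<odot>\<^bsub>Q\<^esub> u j) \<in> {..<n} \<rightarrow> carrier T"
    using t by (auto simp: T_lsmult coefficient_R)
  have "canon t = (\<Oplus>\<^bsub>AT\<^esub>j\<in>{..<n}. \<one>\<^bsub>A\<^esub> \<boxdot> (coefficient j t \<odot>\<^bsub>Q\<^esub> u j))"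
    unfolding canon_coefficients[OF tQ] using t tQ
    by (intro AT.finsum_cong') (auto simp: at_balanced[symmetric] coefficient_R coefficient_closed T_lsmult)
  also have "\<dots> = \<one>\<^bsub>A\<^esub> \<boxdot> (\<Oplus>\<^bsub>T\<^esub>j\<in>{..<n}. coefficient j t \<odot>\<^bsub>Q\<^esub> u j)"
    using additive_finsum[OF T_group AT_group at_right_hom[OF A.one_closed] T] by simp
  also have "\<dots> = \<one>\<^bsub>A\<^esub> \<boxdot> t" by (simp add: finsum_T[OF T] coefficient_expansion[OF tQ])
  finally show ?thesis .
qed

lemma canon_lsmult_T: "a \<in> carrier A \<Longrightarrow> t \<in> carrier T \<Longrightarrow> canon (a \<odot>\<^bsub>Q\<^esub> t) = a \<boxdot> t"
  by (simp add: canon_lsmult canon_T T_in_Q at_lsmult)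

lemma canon_evaluate:
  assumes c: "c \<in> carrier AT"
  shows "canon (evaluate c) = c"
  by (rule AT_eqI[OF additive_comp[OF evaluate_hom canon_hom] additive_id _ c]) (simp add: evaluate_at canon_lsmult_T)

lemma canon_bij: "bij_betw canon (carrier Q) (carrier AT)"
  by (rule bij_betw_byWitness[where f' = evaluate])
    (auto simp: evaluate_canon canon_evaluate canon_closed homD(1)[OF evaluate_hom])


section \<open>The canonical coring\<close>

abbreviation C where "C \<equiv> canonical_coring A B n \<gamma> u"
abbreviation pc (infixl "\<circledast>" 75) where "c \<circledast> d \<equiv> pure_tensor A C C c d"
abbreviation \<xi> where "\<xi> \<equiv> canonical_element A B"

lemma canonical_bimodule_simps:
  "carrier (canonical_bimodule A B n \<gamma> u) = carrier AT" "\<zero>\<^bsub>canonical_bimodule A B n \<gamma> u\<^esub> = \<zero>\<^bsub>AT\<^esub>"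
  "ring.add (canonical_bimodule A B n \<gamma> u) = ring.add AT" "smult (canonical_bimodule A B n \<gamma> u) = smult AT"
  by (simp_all add: canonical_bimodule_def)

lemma C_simps: "carrier C = carrier AT" "\<zero>\<^bsub>C\<^esub> = \<zero>\<^bsub>AT\<^esub>" "ring.add C = ring.add AT" "smult C = smult AT"
  "rsmult C = rsmult (canonical_bimodule A B n \<gamma> u)"
  by (simp_all add: canonical_coring_def Let_def bimodule.defs canonical_bimodule_simps)

lemma hom_into_C: "hom Z (add_monoid C) = hom Z (add_monoid AT)"
  by (simp add: hom_def C_simps)

lemma hom_from_C: "hom (add_monoid C) Z = hom (add_monoid AT) Z"
  by (simp add: hom_def C_simps)

text \<open>The summands \<open>a \<gamma>\<^sub>j(a') \<otimes> t u\<^sub>j\<close> of the left side are not balanced in \<open>a\<close> and \<open>t\<close> over \<open>R\<close>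
  one by one, but by the right side their sum is. Both sides are values of the additive map
  \<open>w \<mapsto> canon (a (t * evaluate w))\<close> at \<open>w = \<rho>(a')\<close>, where \<open>evaluate w = 1 \<otimes> a'\<close> and \<open>*\<close> is the product
  of \<open>T\<close> extended to \<open>A \<otimes>\<^sub>B A\<close>.\<close>

lemma coaction_action:
  assumes a: "a \<in> carrier A" and t: "t \<in> carrier T" and a': "a' \<in> carrier A"
  shows "tensor_lift AT (\<lambda>a'0 a'1. (a \<otimes>\<^bsub>A\<^esub> a'0) \<boxdot> (t \<otimes>\<^bsub>T\<^esub> a'1)) (\<rho> a') = canon ((a \<odot>\<^bsub>Q\<^esub> t) \<bullet>\<^bsub>Q\<^esub> a')"
proof -
  have g: "(\<lambda>w. canon (a \<odot>\<^bsub>Q\<^esub> (t \<otimes>\<^bsub>T\<^esub> evaluate w))) \<in> hom (add_monoid AT) (add_monoid AT)"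
    by (rule additive_comp[OF additive_comp[OF additive_comp[OF evaluate_hom sandwich_hom[OF t]]
          lsmult_hom[OF Q_left a]] canon_hom])
  have "tensor_lift AT (\<lambda>a'0 a'1. (a \<otimes>\<^bsub>A\<^esub> a'0) \<boxdot> (t \<otimes>\<^bsub>T\<^esub> a'1)) (\<rho> a') = canon (a \<odot>\<^bsub>Q\<^esub> (t \<otimes>\<^bsub>T\<^esub> evaluate (\<rho> a')))"
    using a t a' by (intro AT_lift_unique[OF AT_group g])
      (simp_all add: evaluate_at sandwich_lsmult T_in_Q Q.lsmult_assoc[symmetric] sandwich_closed canon_lsmult_T T_mult_closed)
  then show ?thesis using a t a' by (simp add: evaluate_coaction sandwich_pure Q.lsmult_one T_in_Q Q.bimodule_assoc)
qed

lemma C_rsmult: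
  assumes c: "c \<in> carrier AT" and a': "a' \<in> carrier A"
  shows "c \<bullet>\<^bsub>C\<^esub> a' = canon (evaluate c \<bullet>\<^bsub>Q\<^esub> a')"
  unfolding C_simps using a' 
  by (simp add: canonical_bimodule_def)
    (rule AT_lift_unique[OF AT_group additive_comp[OF additive_comp[OF evaluate_hom rsmult_hom[OF Q_right a']] canon_hom] _ c],
      simp add: coaction_action evaluate_at)

lemma canon_hom_C: "canon \<in> hom (add_monoid Q) (add_monoid C)"
  unfolding hom_into_C by (rule canon_hom)

lemma canon_rsmult: "q \<in> carrier Q \<Longrightarrow> a \<in> carrier A \<Longrightarrow> canon (q \<bullet>\<^bsub>Q\<^esub> a) = canon q \<bullet>\<^bsub>C\<^esub> a"
  by (simp add: C_rsmult canon_closed evaluate_canon)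

lemma canon_lsmult_C: "q \<in> carrier Q \<Longrightarrow> a \<in> carrier A \<Longrightarrow> canon (a \<odot>\<^bsub>Q\<^esub> q) = a \<odot>\<^bsub>C\<^esub> canon q"
  by (simp add: C_simps canon_lsmult)

lemma C_bimodule: "bimodule A A C"
proof (rule bimodule_of_bijection)
  show "bimodule A A Q" by unfold_locales
  show "abelian_group C" by (rule abelian_group_restrict_scheme[OF AT_group]) (simp_all add: C_simps)
  show "bij_betw canon (carrier Q) (carrier C)" using canon_bij by (simp add: C_simps)
qed (simp_all add: canon_hom_C canon_rsmult canon_lsmult_C)

sublocale C: bimodule A A C by (rule C_bimodule)

sublocale CC: tensor_bimodule A A A C C
  using C_bimodule by (simp add: tensor_bimodule_def)

lemma C_group: "abelian_group C" by unfold_locales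

lemma CC_group: "abelian_group (tensor A C C)" by (rule CC.tensor_abelian_group)

lemma CC_left: "left_module A (tensor A C C)" and CC_right: "right_module A (tensor A C C)"
  using CC.tensor_is_bimodule by (auto simp: bimodule_def)

lemma canon_bimodule_hom: "canon \<in> bimodule_hom A A Q C"
  by (rule bimodule_homI[OF canon_hom_C]) (simp_all add: canon_lsmult_C canon_rsmult)

lemma canon_closed_C [simp]: "q \<in> carrier Q \<Longrightarrow> canon q \<in> carrier C"
  by (rule homD(1)[OF canon_hom_C])

lemma pc_left_hom: "d \<in> carrier C \<Longrightarrow> (\<lambda>c. c \<circledast> d) \<in> hom (add_monoid C) (add_monoid (tensor A C C))"
  unfolding hom_into_tensor by (rule CC.pure_left_hom)

lemma pc_right_hom: "c \<in> carrier C \<Longrightarrow> (\<lambda>d. c \<circledast> d) \<in> hom (add_monoid C) (add_monoid (tensor A C C))"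
  unfolding hom_into_tensor by (rule CC.pure_right_hom)

lemma canon_evaluate_C: "c \<in> carrier C \<Longrightarrow> canon (evaluate c) = c"
  by (simp add: C_simps canon_evaluate)

lemma evaluate_hom_C: "evaluate \<in> hom (add_monoid C) (add_monoid Q)"
  unfolding hom_from_C by (rule evaluate_hom)

lemma evaluate_bimodule_hom: "evaluate \<in> bimodule_hom A A C Q"
proof (rule bimodule_homI[OF evaluate_hom_C])
  fix a c assume "a \<in> carrier A" "c \<in> carrier C"
  then show "evaluate (a \<odot>\<^bsub>C\<^esub> c) = a \<odot>\<^bsub>Q\<^esub> evaluate c" "evaluate (c \<bullet>\<^bsub>C\<^esub> a) = evaluate c \<bullet>\<^bsub>Q\<^esub> a"
    using homD(1)[OF evaluate_hom]
    by (simp_all add: C_simps(1,4) evaluate_lsmult C_rsmult evaluate_canon Q.rsmult_closed)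
qed

abbreviation split where "split \<equiv> splitting C canon"

lemmas split_hom = splitting_hom[OF C_bimodule canon_bimodule_hom]
lemmas split_pure = splitting_pure[OF C_bimodule canon_bimodule_hom]

lemma split_bimodule_hom: "split \<in> bimodule_hom A A Q (tensor A C C)"
proof (rule bimodule_homI[OF split_hom])
  fix a q assume a: "a \<in> carrier A" and q: "q \<in> carrier Q"
  show "split (a \<odot>\<^bsub>Q\<^esub> q) = a \<odot>\<^bsub>tensor A C C\<^esub> split q"
  proof (rule square_eqI[OF additive_comp[OF lsmult_hom[OF Q_left a] split_hom]
        additive_comp[OF split_hom lsmult_hom[OF CC_left a]] _ q])
    fix s t assume "s \<in> carrier A" "t \<in> carrier A"
    then show "split (a \<odot>\<^bsub>Q\<^esub> (s \<boxtimes> t)) = a \<odot>\<^bsub>tensor A C C\<^esub> split (s \<boxtimes> t)"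
      using a by (simp add: square_lsmult split_pure CC.lsmult_pure canon_lsmult_C[symmetric])
  qed
  show "split (q \<bullet>\<^bsub>Q\<^esub> a) = split q \<bullet>\<^bsub>tensor A C C\<^esub> a"
  proof (rule square_eqI[OF additive_comp[OF rsmult_hom[OF Q_right a] split_hom]
        additive_comp[OF split_hom rsmult_hom[OF CC_right a]] _ q])
    fix s t assume "s \<in> carrier A" "t \<in> carrier A"
    then show "split ((s \<boxtimes> t) \<bullet>\<^bsub>Q\<^esub> a) = split (s \<boxtimes> t) \<bullet>\<^bsub>tensor A C C\<^esub> a"
      using a by (simp add: square_rsmult split_pure CC.rsmult_pure canon_rsmult[symmetric])
  qed
qed

text \<open>The left tensor factor \<open>t\<^sup>1 \<otimes> \<gamma>\<^sub>j(t\<^sup>2)\<close> in the \<open>j\<close>-th summand of \<open>\<Delta>\<^sub>T(t)\<close>.\<close>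

definition leg :: "nat \<Rightarrow> ('a, 'a) tens \<Rightarrow> ('a, 'a) tens" where
  "leg j = tensor_lift Q (\<lambda>y z. y \<boxtimes> \<gamma> j z)"

lemma leg:
  assumes j: "j < n"
  shows leg_hom: "leg j \<in> hom (add_monoid Q) (add_monoid Q)"
    and leg_pure: "\<lbrakk>y \<in> carrier A; z \<in> carrier A\<rbrakk> \<Longrightarrow> leg j (y \<boxtimes> z) = y \<boxtimes> \<gamma> j z"
proof -
  have 1: "(\<lambda>z. y \<boxtimes> \<gamma> j z) \<in> hom (add_monoid A) (add_monoid Q)" if "y \<in> carrier A" for y
    by (rule additive_comp[OF \<gamma>_hom[OF j] square_right_hom[OF that]])
  have 2: "(\<lambda>y. y \<boxtimes> \<gamma> j z) \<in> hom (add_monoid A) (add_monoid Q)" if "z \<in> carrier A" for z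
    using that j by (intro square_left_hom) simp
  have 3: "(y \<otimes>\<^bsub>A\<^esub> b) \<boxtimes> \<gamma> j z = y \<boxtimes> \<gamma> j (b \<otimes>\<^bsub>A\<^esub> z)" if "y \<in> carrier A" "b \<in> B" "z \<in> carrier A" for y b z
    using that j by (simp add: \<gamma>_left square_balanced)
  show "leg j \<in> hom (add_monoid Q) (add_monoid Q)"
    unfolding leg_def by (rule square_lift_hom[OF Q_group 1 2 3])
  show "\<lbrakk>y \<in> carrier A; z \<in> carrier A\<rbrakk> \<Longrightarrow> leg j (y \<boxtimes> z) = y \<boxtimes> \<gamma> j z"
    unfolding leg_def by (rule square_lift_pure[OF Q_group 1 2 3])
qed

lemma leg_T:
  assumes j: "j < n" and t: "t \<in> carrier T"
  shows "leg j t \<in> carrier T"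
proof -
  have left: "leg j (b \<odot>\<^bsub>Q\<^esub> q) = b \<odot>\<^bsub>Q\<^esub> leg j q" if b: "b \<in> carrier A" and q: "q \<in> carrier Q" for b q
    by (rule square_eqI[OF additive_comp[OF lsmult_hom[OF Q_left b] leg_hom[OF j]]
          additive_comp[OF leg_hom[OF j] lsmult_hom[OF Q_left b]] _ q])
      (use j b in \<open>simp add: square_lsmult leg_pure\<close>)
  have right: "leg j (q \<bullet>\<^bsub>Q\<^esub> b) = leg j q \<bullet>\<^bsub>Q\<^esub> b" if b: "b \<in> B" and q: "q \<in> carrier Q" for b q
    by (rule square_eqI[OF additive_comp[OF rsmult_hom[OF Q_right B_in_A[OF b]] leg_hom[OF j]]
          additive_comp[OF leg_hom[OF j] rsmult_hom[OF Q_right B_in_A[OF b]]] _ q])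
      (use j b B_in_A in \<open>simp add: square_rsmult leg_pure \<gamma>_right\<close>)
  show ?thesis
    using left[OF B_in_A T_in_Q[OF t]] right[OF _ T_in_Q[OF t]] homD(1)[OF leg_hom[OF j] T_in_Q[OF t]] T_commute[OF t]
    by (simp add: T_iff)
qed

text \<open>For \<open>q = y \<otimes> z\<close>, the factor \<open>\<gamma>\<^sub>j(z)\<close> of the left tensor factor moves across \<open>\<otimes>\<^sub>A\<close> to \<open>u\<^sub>j\<close>,
  and the quasibase equation turns the sum of the \<open>\<gamma>\<^sub>j(z) u\<^sub>j\<close> into \<open>1 \<otimes> z\<close>.\<close>

lemma split_expansion:
  assumes a: "a \<in> carrier A" and q: "q \<in> carrier Q"
  shows "(\<Oplus>\<^bsub>tensor A C C\<^esub>j\<in>{..<n}. canon (a \<odot>\<^bsub>Q\<^esub> leg j q) \<circledast> canon (u j)) = split (a \<odot>\<^bsub>Q\<^esub> q)"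
proof (rule square_eqI[OF additive_sum[OF CC_group] additive_comp[OF lsmult_hom[OF Q_left a] split_hom] _ q])
  fix j assume j: "j \<in> {..<n}"
  then show "(\<lambda>q. canon (a \<odot>\<^bsub>Q\<^esub> leg j q) \<circledast> canon (u j)) \<in> hom (add_monoid Q) (add_monoid (tensor A C C))"
    by (intro additive_comp[OF additive_comp[OF additive_comp[OF leg_hom lsmult_hom[OF Q_left a]] canon_hom_C] pc_left_hom]) simp_all
next
  fix y z assume y: "y \<in> carrier A" and z: "z \<in> carrier A"
  interpret CCg: abelian_group "tensor A C C" by (rule CC_group)
  let ?w = "canon ((a \<otimes>\<^bsub>A\<^esub> y) \<boxtimes> \<one>\<^bsub>A\<^esub>)"
  have w: "?w \<in> carrier C" using a y by simp
  have h: "(\<lambda>q. ?w \<circledast> canon q) \<in> hom (add_monoid Q) (add_monoid (tensor A C C))"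
    by (rule additive_comp[OF canon_hom_C pc_right_hom[OF w]])
  have move: "canon (a \<odot>\<^bsub>Q\<^esub> leg j (y \<boxtimes> z)) \<circledast> canon (u j) = ?w \<circledast> canon ((\<one>\<^bsub>A\<^esub> \<otimes>\<^bsub>A\<^esub> \<gamma> j z) \<odot>\<^bsub>Q\<^esub> u j)"
    if j: "j < n" for j
  proof -
    have "a \<odot>\<^bsub>Q\<^esub> leg j (y \<boxtimes> z) = ((a \<otimes>\<^bsub>A\<^esub> y) \<boxtimes> \<one>\<^bsub>A\<^esub>) \<bullet>\<^bsub>Q\<^esub> \<gamma> j z"
      using a y z j by (simp add: leg_pure square_lsmult square_rsmult)
    then have "canon (a \<odot>\<^bsub>Q\<^esub> leg j (y \<boxtimes> z)) = ?w \<bullet>\<^bsub>C\<^esub> \<gamma> j z"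
      using a y z j by (simp add: canon_rsmult)
    then show ?thesis using w z j by (simp add: CC.pure_balanced canon_lsmult_C)
  qed
  have "(\<Oplus>\<^bsub>tensor A C C\<^esub>j\<in>{..<n}. canon (a \<odot>\<^bsub>Q\<^esub> leg j (y \<boxtimes> z)) \<circledast> canon (u j))
      = (\<Oplus>\<^bsub>tensor A C C\<^esub>j\<in>{..<n}. ?w \<circledast> canon ((\<one>\<^bsub>A\<^esub> \<otimes>\<^bsub>A\<^esub> \<gamma> j z) \<odot>\<^bsub>Q\<^esub> u j))"
    using z homD(1)[OF h] by (intro CCg.finsum_cong') (auto simp: move Q.lsmult_closed)
  also have "\<dots> = ?w \<circledast> canon (\<Oplus>\<^bsub>Q\<^esub>j\<in>{..<n}. (\<one>\<^bsub>A\<^esub> \<otimes>\<^bsub>A\<^esub> \<gamma> j z) \<odot>\<^bsub>Q\<^esub> u j)"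
    using z by (intro additive_finsum[OF Q_group CC_group h, symmetric]) (auto simp: Q.lsmult_closed)
  also have "\<dots> = split (a \<odot>\<^bsub>Q\<^esub> (y \<boxtimes> z))"
    using a y z by (simp only: quasibase_expansion A.one_closed) (simp add: square_lsmult split_pure)
  finally show "(\<Oplus>\<^bsub>tensor A C C\<^esub>j\<in>{..<n}. canon (a \<odot>\<^bsub>Q\<^esub> leg j (y \<boxtimes> z)) \<circledast> canon (u j)) = split (a \<odot>\<^bsub>Q\<^esub> (y \<boxtimes> z))" .
qed simp

lemma comult_pure:
  assumes a: "a \<in> carrier A" and t: "t \<in> carrier T"
  shows "tensor_lift (tensor A C C) (\<lambda>t1 t2. (a \<boxdot> t1) \<circledast> (\<one>\<^bsub>A\<^esub> \<boxdot> t2)) (T_comult A B n \<gamma> u t) = split (a \<odot>\<^bsub>Q\<^esub> t)"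
proof -
  interpret TT: tensor_bimodule "subring_of A R" "subring_of A R" "subring_of A R" T T
    using T_bimodule by (simp add: tensor_bimodule_def)
  let ?f = "\<lambda>t1 t2. (a \<boxdot> t1) \<circledast> (\<one>\<^bsub>A\<^esub> \<boxdot> t2)"
  have at_hom_C: "(\<lambda>t. a \<boxdot> t) \<in> hom (add_monoid T) (add_monoid C)" if "a \<in> carrier A" for a
    using at_right_hom[OF that] by (simp only: hom_into_C)
  have at_C: "a \<boxdot> t \<in> carrier C" if "a \<in> carrier A" "t \<in> carrier T" for a t
    using that by (simp add: C_simps)
  have bal: "balanced_map (subring_of A R) T T (tensor A C C) ?f"
  proof (rule balanced_mapI)
    fix s assume "s \<in> carrier T"
    then show "?f s \<in> hom (add_monoid T) (add_monoid (tensor A C C))"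
      using a by (intro additive_comp[OF at_hom_C pc_right_hom]) (simp_all add: at_C)
  next
    fix s assume "s \<in> carrier T"
    then show "(\<lambda>t. ?f t s) \<in> hom (add_monoid T) (add_monoid (tensor A C C))"
      using a by (intro additive_comp[OF at_hom_C pc_left_hom]) (simp_all add: at_C)
  next
    fix s r t' assume s: "s \<in> carrier T" and "r \<in> carrier (subring_of A R)" and t': "t' \<in> carrier T"
    then have r: "r \<in> R" and rA: "r \<in> carrier A" by (simp_all add: R_in_A)
    \<comment> \<open>The right action of \<open>R\<close> on \<open>T\<close> is the right action of \<open>R \<subseteq> A\<close> on \<open>A \<otimes>\<^sub>R T\<close>, so \<open>r\<close> passes across \<open>\<otimes>\<^sub>A\<close>.\<close>
    have "a \<boxdot> (s \<bullet>\<^bsub>Q\<^esub> r) = canon ((a \<odot>\<^bsub>Q\<^esub> s) \<bullet>\<^bsub>Q\<^esub> r)"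
      using a s r rA by (simp add: canon_lsmult_T[symmetric] T_rsmult Q.bimodule_assoc T_in_Q)
    also have "\<dots> = (a \<boxdot> s) \<bullet>\<^bsub>C\<^esub> r"
      using a s rA by (simp add: canon_rsmult Q.lsmult_closed T_in_Q canon_lsmult_T)
    finally have left: "a \<boxdot> (s \<bullet>\<^bsub>Q\<^esub> r) = (a \<boxdot> s) \<bullet>\<^bsub>C\<^esub> r" .
    have "\<one>\<^bsub>A\<^esub> \<boxdot> (r \<odot>\<^bsub>Q\<^esub> t') = r \<odot>\<^bsub>C\<^esub> (\<one>\<^bsub>A\<^esub> \<boxdot> t')"
      using r rA t' by (simp add: at_balanced[symmetric] C_simps at_lsmult)
    then show "?f (s \<bullet>\<^bsub>T\<^esub> r) t' = ?f s (r \<odot>\<^bsub>T\<^esub> t')"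
      using left a s rA t' by (simp add: T_simps CC.pure_balanced at_C)
  qed
  have f: "tensor_lift (tensor A C C) ?f \<in> hom (add_monoid (tensor (subring_of A R) T T)) (add_monoid (tensor A C C))"
    using TT.lift_hom[OF CC_group bal] by (simp only: hom_from_tensor)
  interpret CCg: abelian_group "tensor A C C" by (rule CC_group)
  note tQ = T_in_Q[OF t]
  have "tensor_lift (tensor A C C) ?f (T_comult A B n \<gamma> u t) =
      (\<Oplus>\<^bsub>tensor A C C\<^esub>j\<in>{..<n}. tensor_lift (tensor A C C) ?f (pure_tensor (subring_of A R) T T (leg j t) (u j)))"
    unfolding T_comult_def Let_def leg_def[symmetric]
    by (intro additive_finsum[OF TT.tensor_abelian_group CC_group f]) (auto simp: tensor_simps t leg_T intro!: TT.pure_closed)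
  also have "\<dots> = (\<Oplus>\<^bsub>tensor A C C\<^esub>j\<in>{..<n}. canon (a \<odot>\<^bsub>Q\<^esub> leg j t) \<circledast> canon (u j))"
    using a t homD(1)[OF leg_hom tQ]
    by (intro CCg.finsum_cong') (auto simp: TT.lift_pure[OF CC_group bal] leg_T canon_lsmult_T canon_T
        tensor_simps intro!: CC.pure_closed at_C)
  also have "\<dots> = split (a \<odot>\<^bsub>Q\<^esub> t)" by (rule split_expansion[OF a tQ])
  finally show ?thesis .
qed

lemma comult_C:
  assumes c: "c \<in> carrier C"
  shows "comult C c = split (evaluate c)"
proof -
  let ?C = "canonical_bimodule A B n \<gamma> u"
  have pt: "pure_tensor A ?C ?C = pure_tensor A C C" and tg: "tensor_group A ?C ?C = tensor_group A C C"
    by (simp_all add: pure_tensor_restrict_scheme[of ?C C ?C C] tensor_group_restrict_scheme[of ?C C ?C C]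
        C_simps canonical_bimodule_simps)
  have lift: "tensor_lift (tensor A ?C ?C) = tensor_lift (tensor A C C)"
    by (rule ext, rule tensor_lift_restrict_scheme) (simp_all add: tensor_simps tg)
  have "comult C c = tensor_lift (tensor A C C) (\<lambda>a t. tensor_lift (tensor A C C)
      (\<lambda>t1 t2. (a \<boxdot> t1) \<circledast> (\<one>\<^bsub>A\<^esub> \<boxdot> t2)) (T_comult A B n \<gamma> u t)) c"
    unfolding pt[symmetric] lift[symmetric] by (simp add: canonical_coring_def Let_def bimodule.defs coring.defs)
  also have "\<dots> = split (evaluate c)"
    by (rule AT_lift_unique[OF CC_group additive_comp[OF evaluate_hom split_hom]])
      (use c in \<open>simp_all add: comult_pure evaluate_at C_simps\<close>)
  finally show ?thesis .
qed

lemma counit_C: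
  assumes c: "c \<in> carrier C"
  shows "counit C c = T_counit A (evaluate c)"
proof -
  have "counit C c = tensor_lift A (\<lambda>a t. a \<otimes>\<^bsub>A\<^esub> T_counit A t) c"
    by (simp add: canonical_coring_def Let_def bimodule.defs coring.defs)
  also have "\<dots> = T_counit A (evaluate c)"
    by (rule AT_lift_unique[OF A.abelian_group_axioms additive_comp[OF evaluate_hom multiplication_hom]])
      (use c bimodule_homD(4)[OF multiplication_bimodule_hom] in \<open>simp_all add: evaluate_at C_simps T_in_Q\<close>)
  finally show ?thesis .
qed

lemma \<xi>_canon: "\<xi> = canon (\<one>\<^bsub>A\<^esub> \<boxtimes> \<one>\<^bsub>A\<^esub>)"
  using canon_T[OF one_T] by (simp add: canonical_element_def T_simps)

lemma canon_generator:
  assumes "a \<in> carrier A" and "a' \<in> carrier A"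
  shows "(a \<odot>\<^bsub>C\<^esub> \<xi>) \<bullet>\<^bsub>C\<^esub> a' = canon (a \<boxtimes> a')"
  using assms by (simp add: \<xi>_canon canon_rsmult[symmetric] canon_lsmult_C[symmetric] square_lsmult square_rsmult)

lemma comult_canon: "q \<in> carrier Q \<Longrightarrow> comult C (canon q) = split q"
  by (simp add: comult_C evaluate_canon)

lemma counit_canon: "q \<in> carrier Q \<Longrightarrow> counit C (canon q) = T_counit A q"
  by (simp add: counit_C evaluate_canon)

lemma grouplike_\<xi>: "grouplike A C \<xi>"
  by (simp add: grouplike_def \<xi>_canon comult_canon counit_canon split_pure multiplication_pure)

lemma coring_C: "coring A C"
proof (rule coring_generated_by_grouplike[OF C_bimodule _ _ grouplike_\<xi>])
  show "comult C \<in> bimodule_hom A A C (tensor A C C)"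
    by (rule bimodule_hom_comp[OF evaluate_bimodule_hom split_bimodule_hom comult_C C_bimodule])
  show "counit C \<in> bimodule_hom A A C (regular A)"
    by (rule bimodule_hom_comp[OF evaluate_bimodule_hom multiplication_bimodule_hom counit_C C_bimodule])
  let ?S = "{(a \<odot>\<^bsub>C\<^esub> \<xi>) \<bullet>\<^bsub>C\<^esub> a' | a a'. a \<in> carrier A \<and> a' \<in> carrier A}"
  show "carrier C \<subseteq> generate (add_monoid C) ?S"
  proof
    fix c assume c: "c \<in> carrier C"
    have "canon q \<in> generate (add_monoid C) ?S" if "q \<in> carrier Q" for q
      using that
    proof (induction rule: square_induct)
      case (pure a a')
      then show ?case using canon_generator[of a a'] by (intro generate.incl CollectI exI[of _ a] exI[of _ a']) simp
    next
      case (add s t)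
      then show ?case
        unfolding homD(2)[OF canon_hom_C add(1,2)]
        using generate.eng[OF add(3,4)] by (simp only: monoid.simps)
    qed
    from this[OF homD(1)[OF evaluate_hom_C c]] show "c \<in> generate (add_monoid C) ?S"
      by (simp only: canon_evaluate_C[OF c])
  qed
qed

lemma can_map_canon: "q \<in> carrier Q \<Longrightarrow> can_map C \<xi> q = canon q"
  unfolding can_map_def by (rule square_lift_unique[OF C_group canon_hom_C canon_generator])

lemma can_map_hom: "can_map C \<xi> \<in> bimodule_hom A A Q C"
  by (intro bimodule_homI homI)
    (simp_all add: can_map_canon homD(2)[OF canon_hom_C] canon_lsmult_C canon_rsmult Q.lsmult_closed Q.rsmult_closed)

lemma Sweedler_simps: "carrier (Sweedler_coring A B) = carrier Q" "\<zero>\<^bsub>Sweedler_coring A B\<^esub> = \<zero>\<^bsub>Q\<^esub>"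
  "ring.add (Sweedler_coring A B) = ring.add Q" "smult (Sweedler_coring A B) = smult Q"
  "rsmult (Sweedler_coring A B) = rsmult Q" "counit (Sweedler_coring A B) = T_counit A"
  "comult (Sweedler_coring A B) = splitting Q (\<lambda>q. q)"
  by (simp_all add: Sweedler_coring_def Let_def bimodule.defs coring.defs T_counit_def splitting_def)

lemma can_map_coring_iso: "can_map C \<xi> \<in> coring_iso A (Sweedler_coring A B) C"
proof -
  let ?f = "can_map C \<xi>" and ?S = "Sweedler_coring A B"
  have QQ: "tensor_pair A Q Q" using Q_left Q_right by (simp add: tensor_pair_def)
  have QA: "bimodule A A Q" by unfold_locales
  have "(\<lambda>q. q) \<in> bimodule_hom A A Q Q" by (simp add: bimodule_homI additive_id)
  note Sweedler_hom = splitting_hom[OF QA this] and Sweedler_pure = splitting_pure[OF QA this]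
  note f = bimodule_homD[OF can_map_hom]
  note m = QQ CC.tensor_pair_axioms f(2,1)
  have "?f \<in> bimodule_hom A A ?S C"
    using can_map_hom
    by (simp add: bimodule_hom_def left_module_hom_def right_module_hom_def hom_def Sweedler_simps)
  moreover have "bij_betw ?f (carrier ?S) (carrier C)"
    using canon_bij bij_betw_cong[of "carrier Q" ?f canon] by (simp add: Sweedler_simps C_simps(1) can_map_canon)
  moreover have "comult C (?f q) = tensor_map A C C ?f ?f (comult ?S q)" if q: "q \<in> carrier Q" for q
  proof -
    have m': "tensor_map A C C ?f ?f \<in> hom (add_monoid (tensor A Q Q)) (add_monoid (tensor A C C))"
      using tensor_map_hom[OF m] by (simp only: hom_from_tensor hom_into_tensor)
    have "tensor_map A C C ?f ?f (comult ?S q) = split q"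
      unfolding Sweedler_simps(7)
      by (rule square_eqI[OF additive_comp[OF Sweedler_hom m'] split_hom _ q])
        (simp add: Sweedler_pure split_pure tensor_map_pure[OF m] can_map_canon)
    then show ?thesis using q by (simp add: can_map_canon comult_canon)
  qed
  moreover have "counit C (?f q) = counit ?S q" if q: "q \<in> carrier Q" for q
    using q by (simp add: can_map_canon counit_canon Sweedler_simps)
  ultimately show ?thesis by (simp add: coring_iso_def bimodule_iso_def Sweedler_simps(1))
qed

theorem Galois_coring_canonical: "Galois_coring A B C \<xi>"
proof -
  have "b \<odot>\<^bsub>C\<^esub> \<xi> = \<xi> \<bullet>\<^bsub>C\<^esub> b" if b: "b \<in> B" for b
    using B_in_A[OF b] square_balanced[OF A.one_closed b A.one_closed]
    by (simp add: \<xi>_canon canon_rsmult[symmetric] canon_lsmult_C[symmetric] square_lsmult square_rsmult)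
  then show ?thesis using coring_C grouplike_\<xi> can_map_coring_iso by (simp add: Galois_coring_def)
qed


section \<open>Coinvariants\<close>

text \<open>The canonical map sends \<open>1 \<otimes> a\<close> to \<open>\<rho>(a)\<close> and \<open>a \<otimes> 1\<close> to \<open>a \<otimes> 1\<^sub>T\<close>.\<close>

lemma coinvariants_iff:
  "a \<in> coinvariants A B n \<gamma> u \<longleftrightarrow> a \<in> carrier A \<and> \<one>\<^bsub>A\<^esub> \<boxtimes> a = a \<boxtimes> \<one>\<^bsub>A\<^esub>"
proof -
  have "\<rho> a = a \<boxdot> \<one>\<^bsub>T\<^esub> \<longleftrightarrow> \<one>\<^bsub>A\<^esub> \<boxtimes> a = a \<boxtimes> \<one>\<^bsub>A\<^esub>" if a: "a \<in> carrier A"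
  proof -
    have "canon (\<one>\<^bsub>A\<^esub> \<boxtimes> a) = \<rho> a"
      using a by (simp add: canon_pure left_module.lsmult_one[OF AT_left])
    moreover have "canon (a \<boxtimes> \<one>\<^bsub>A\<^esub>) = a \<boxdot> \<one>\<^bsub>T\<^esub>"
      using canon_lsmult_T[OF a one_T] a by (simp add: T_simps square_lsmult)
    moreover have "canon (\<one>\<^bsub>A\<^esub> \<boxtimes> a) = canon (a \<boxtimes> \<one>\<^bsub>A\<^esub>) \<longleftrightarrow> \<one>\<^bsub>A\<^esub> \<boxtimes> a = a \<boxtimes> \<one>\<^bsub>A\<^esub>"
      using a evaluate_canon by (metis square_closed A.one_closed)
    ultimately show ?thesis by simp
  qed
  then show ?thesis by (auto simp: coinvariants_def)
qed

end

context subring_extension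
begin

text \<open>The equation \<open>1 \<otimes> a = a \<otimes> 1\<close> makes right multiplication by \<open>a\<close> commute with all right \<open>B\<close>-linear
  endomorphisms of \<open>A\<close>.\<close>

lemma square_commute_balanced:
  assumes bal: "balanced_right A B" and a: "a \<in> carrier A" and comm: "\<one>\<^bsub>A\<^esub> \<boxtimes> a = a \<boxtimes> \<one>\<^bsub>A\<^esub>"
  shows "a \<in> B"
proof -
  have "\<phi> y \<otimes>\<^bsub>A\<^esub> a = \<phi> (y \<otimes>\<^bsub>A\<^esub> a)"
    if \<phi>: "\<phi> \<in> right_module_hom (subring_of A B) (regular A) (regular A)" and y: "y \<in> carrier A" for \<phi> y
  proof -
    have \<phi>_hom: "\<phi> \<in> hom (add_monoid A) (add_monoid A)"
      using right_module_homD(1)[OF \<phi>] by (simp add: hom_def)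
    note \<phi>_closed = homD(1)[OF \<phi>_hom]
    have 1: "(\<lambda>z. \<phi> y \<otimes>\<^bsub>A\<^esub> z) \<in> hom (add_monoid A) (add_monoid A)" if "y \<in> carrier A" for y
      using \<phi>_closed[OF that] by (intro homI) (simp_all add: A.r_distr)
    have 2: "(\<lambda>y. \<phi> y \<otimes>\<^bsub>A\<^esub> z) \<in> hom (add_monoid A) (add_monoid A)" if "z \<in> carrier A" for z
      using that homD[OF \<phi>_hom] by (intro homI) (simp_all add: A.l_distr)
    have 3: "\<phi> (y \<otimes>\<^bsub>A\<^esub> b) \<otimes>\<^bsub>A\<^esub> z = \<phi> y \<otimes>\<^bsub>A\<^esub> (b \<otimes>\<^bsub>A\<^esub> z)" if "y \<in> carrier A" "b \<in> B" "z \<in> carrier A" for y b z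
      using right_module_homD(2)[OF \<phi>, of b y] that \<phi>_closed B_in_A by (simp add: A.m_assoc)
    have pure: "tensor_lift A (\<lambda>y z. \<phi> y \<otimes>\<^bsub>A\<^esub> z) (y \<boxtimes> z) = \<phi> y \<otimes>\<^bsub>A\<^esub> z"
      if "y \<in> carrier A" "z \<in> carrier A" for y z
      by (rule square_lift_pure[OF A.abelian_group_axioms 1 2 3 that])
    \<comment> \<open>Apply \<open>\<phi> \<otimes> id\<close> followed by multiplication to \<open>y \<otimes> a = y a \<otimes> 1\<close>.\<close>
    have "y \<boxtimes> a = (y \<otimes>\<^bsub>A\<^esub> a) \<boxtimes> \<one>\<^bsub>A\<^esub>"
      using square_lsmult[OF y A.one_closed a] square_lsmult[OF y a A.one_closed] comm y by simp
    then show ?thesis using pure[OF y a] pure[of "y \<otimes>\<^bsub>A\<^esub> a" "\<one>\<^bsub>A\<^esub>"] y a \<phi>_closed by simp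
  qed
  moreover have "(\<lambda>y. y \<otimes>\<^bsub>A\<^esub> a) \<in> hom (add_monoid A) (add_monoid A)"
    using a by (intro homI) (simp_all add: A.l_distr)
  ultimately obtain b where "b \<in> B" "\<forall>y\<in>carrier A. y \<otimes>\<^bsub>A\<^esub> a = y \<otimes>\<^bsub>A\<^esub> b"
    using bal[unfolded balanced_right_def, rule_format, of "\<lambda>y. y \<otimes>\<^bsub>A\<^esub> a"] by auto
  then show ?thesis using a B_in_A by (metis A.l_one A.one_closed)
qed

end

text \<open>Copies and quotients of a module on a prescribed carrier type: \<open>\<pi>\<close> encodes elements, or classes of
  elements identified by \<open>\<pi>\<close>, and the operations are computed on chosen representatives.\<close>

definition image_module :: "('k, 'm, 'q) module_scheme \<Rightarrow> ('m \<Rightarrow> 'x) \<Rightarrow> ('k, 'x) module" where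
  "image_module M \<pi> =
     (let s = inv_into (carrier M) \<pi>
      in \<lparr>carrier = \<pi> ` carrier M, monoid.mult = undefined, one = undefined, ring.zero = \<pi> \<zero>\<^bsub>M\<^esub>,
          ring.add = (\<lambda>v w. \<pi> (s v \<oplus>\<^bsub>M\<^esub> s w)), smult = (\<lambda>k v. \<pi> (k \<odot>\<^bsub>M\<^esub> s v))\<rparr>)"

lemma image_module:
  assumes M: "left_module K M"
    and add: "\<And>y z w. \<lbrakk>y \<in> carrier M; z \<in> carrier M; w \<in> carrier M; \<pi> y = \<pi> z\<rbrakk> \<Longrightarrow> \<pi> (y \<oplus>\<^bsub>M\<^esub> w) = \<pi> (z \<oplus>\<^bsub>M\<^esub> w)"
    and smult: "\<And>k y z. \<lbrakk>k \<in> carrier K; y \<in> carrier M; z \<in> carrier M; \<pi> y = \<pi> z\<rbrakk> \<Longrightarrow> \<pi> (k \<odot>\<^bsub>M\<^esub> y) = \<pi> (k \<odot>\<^bsub>M\<^esub> z)"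
  shows left_module_image: "left_module K (image_module M \<pi>)"
    and image_module_hom: "\<pi> \<in> left_module_hom K M (image_module M \<pi>)"
proof -
  interpret M: left_module K M by (rule M)
  let ?N = "image_module M \<pi>" and ?s = "inv_into (carrier M) \<pi>"
  have c: "carrier ?N = \<pi> ` carrier M" and z: "\<zero>\<^bsub>?N\<^esub> = \<pi> \<zero>\<^bsub>M\<^esub>" by (simp_all add: image_module_def Let_def)
  have s: "?s (\<pi> y) \<in> carrier M" "\<pi> (?s (\<pi> y)) = \<pi> y" if "y \<in> carrier M" for y
    using that by (auto intro: inv_into_into f_inv_into_f)
  have a: "\<pi> y \<oplus>\<^bsub>?N\<^esub> \<pi> w = \<pi> (y \<oplus>\<^bsub>M\<^esub> w)" if y: "y \<in> carrier M" and w: "w \<in> carrier M" for y w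
  proof -
    have "\<pi> (?s (\<pi> y) \<oplus>\<^bsub>M\<^esub> ?s (\<pi> w)) = \<pi> (y \<oplus>\<^bsub>M\<^esub> ?s (\<pi> w))" using s[OF y] s[OF w] y by (intro add)
    also have "\<dots> = \<pi> (?s (\<pi> w) \<oplus>\<^bsub>M\<^esub> y)" using s[OF w] y by (simp add: M.M.a_comm)
    also have "\<dots> = \<pi> (w \<oplus>\<^bsub>M\<^esub> y)" using s[OF w] y w by (intro add)
    also have "\<dots> = \<pi> (y \<oplus>\<^bsub>M\<^esub> w)" using y w by (simp add: M.M.a_comm)
    finally show ?thesis by (simp add: image_module_def Let_def)
  qed
  have k: "l \<odot>\<^bsub>?N\<^esub> \<pi> y = \<pi> (l \<odot>\<^bsub>M\<^esub> y)" if l: "l \<in> carrier K" and y: "y \<in> carrier M" for l y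
    using smult[OF l s(1)[OF y] y s(2)[OF y]] by (simp add: image_module_def Let_def)
  have g: "abelian_group ?N"
  proof (rule abelian_groupI)
    fix v assume "v \<in> carrier ?N"
    then obtain y where y: "y \<in> carrier M" "v = \<pi> y" by (auto simp: c)
    then show "\<exists>w\<in>carrier ?N. w \<oplus>\<^bsub>?N\<^esub> v = \<zero>\<^bsub>?N\<^esub>"
      by (intro bexI[of _ "\<pi> (\<ominus>\<^bsub>M\<^esub> y)"]) (simp_all add: a z c M.M.l_neg)
  qed (auto simp: c z a M.M.a_ac)
  have r: "ring K" by unfold_locales
  show "left_module K ?N"
    by (intro left_module.intro left_module_axioms.intro g r)
      (auto simp: c a k M.lsmult_closed M.lsmult_add M.lsmult_add_scalar M.lsmult_assoc M.lsmult_one)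
  show "\<pi> \<in> left_module_hom K M ?N"
    by (auto simp: left_module_hom_def c a k intro!: homI)
qed

context subring_extension
begin

text \<open>Tensoring with \<open>A\<close> kills the map \<open>B \<rightarrow> A / B\<close>, \<open>b \<mapsto> b a + B\<close>. Since faithful flatness reflects
  exactness of \<open>B \<rightarrow> B \<rightarrow> A / B\<close>, with the identity as first map, the map is zero, so \<open>a\<close> lies in \<open>B\<close>.\<close>

lemma square_commute_faithfully_flat:
  assumes ff: "faithfully_flat_right (subring_of A B) (regular A)"
    and a: "a \<in> carrier A" and comm: "\<one>\<^bsub>A\<^esub> \<boxtimes> a = a \<boxtimes> \<one>\<^bsub>A\<^esub>"
  shows "a \<in> B"
proof -
  let ?K = "subring_of A B" and ?B = "(regular A)\<lparr>carrier := B\<rparr>"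
  note B = subringE[OF B_subring]
  have K: "ring ?K" by (rule A.subring_is_ring[OF B_subring])
  interpret K: ring ?K by (rule K)
  have "abelian_group ?B"
    by (rule abelian_group_restrict_scheme[OF ring.is_abelian_group[OF K]]) simp_all
  then have B_mod: "left_module ?K ?B"
    by (intro left_module.intro left_module_axioms.intro K)
      (simp_all add: A.l_distr A.r_distr A.m_assoc B_in_A B(6))
  have A_mod: "left_module ?K (regular A)" and A_right: "right_module ?K (regular A)"
    by (rule square.N_ax, rule square.M_ax)
  \<comment> \<open>The modules tested by faithful flatness have carriers consisting of sets of sequences, so the
    copies of \<open>B\<close> and \<open>A / B\<close> consist of sets of constant sequences.\<close>
  define \<iota> :: "'a \<Rightarrow> (nat \<Rightarrow> 'a) set" where "\<iota> = (\<lambda>b. {\<lambda>_. b})"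
  define \<pi> :: "'a \<Rightarrow> (nat \<Rightarrow> 'a) set" where "\<pi> = (\<lambda>y. {\<lambda>_. z | z. z \<in> carrier A \<and> z \<ominus>\<^bsub>A\<^esub> y \<in> B})"
  have minus_B: "y \<ominus>\<^bsub>A\<^esub> z \<in> B" if "y \<in> B" "z \<in> B" for y z
    using that B(5,7) by (simp add: a_minus_def)
  have minus_swap: "z \<ominus>\<^bsub>A\<^esub> y \<in> B" if "y \<ominus>\<^bsub>A\<^esub> z \<in> B" "y \<in> carrier A" "z \<in> carrier A" for y z
  proof -
    have "z \<ominus>\<^bsub>A\<^esub> y = \<ominus>\<^bsub>A\<^esub> (y \<ominus>\<^bsub>A\<^esub> z)" using that by (simp add: a_minus_def A.minus_add A.minus_minus A.a_comm)
    then show ?thesis using that(1) B(5) by simp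
  qed
  have \<iota>_inj: "\<iota> y = \<iota> z \<longleftrightarrow> y = z" for y z
    by (auto simp: \<iota>_def dest: fun_cong)
  have \<pi>_eq: "\<pi> y = \<pi> z \<longleftrightarrow> y \<ominus>\<^bsub>A\<^esub> z \<in> B" if y: "y \<in> carrier A" and z: "z \<in> carrier A" for y z
  proof
    assume "\<pi> y = \<pi> z"
    moreover have "(\<lambda>_. y) \<in> \<pi> y" using y B(2) by (auto simp: \<pi>_def A.r_neg a_minus_def)
    ultimately have "(\<lambda>_::nat. y) \<in> \<pi> z" by simp
    then show "y \<ominus>\<^bsub>A\<^esub> z \<in> B" by (auto simp: \<pi>_def dest: fun_cong)
  next
    have shift: "w \<ominus>\<^bsub>A\<^esub> z \<in> B" if "y \<ominus>\<^bsub>A\<^esub> z \<in> B" "w \<ominus>\<^bsub>A\<^esub> y \<in> B" "w \<in> carrier A" "y \<in> carrier A" "z \<in> carrier A" for w y z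
    proof -
      have "w \<ominus>\<^bsub>A\<^esub> z = (w \<ominus>\<^bsub>A\<^esub> y) \<oplus>\<^bsub>A\<^esub> (y \<ominus>\<^bsub>A\<^esub> z)"
        using that(3-5) A.r_neg1[of y "\<ominus>\<^bsub>A\<^esub> z"] A.r_neg2[of y "\<ominus>\<^bsub>A\<^esub> z"] by (simp add: a_minus_def A.a_assoc)
      then show ?thesis using that(1,2) B(7) by simp
    qed
    assume yz: "y \<ominus>\<^bsub>A\<^esub> z \<in> B"
    have "w \<ominus>\<^bsub>A\<^esub> y \<in> B \<longleftrightarrow> w \<ominus>\<^bsub>A\<^esub> z \<in> B" if "w \<in> carrier A" for w
      using shift[OF yz _ that y z] shift[OF minus_swap[OF yz y z] _ that z y] by blast
    then show "\<pi> y = \<pi> z" unfolding \<pi>_def by blast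
  qed
  let ?N = "image_module ?B \<iota>" and ?N' = "image_module (regular A) \<pi>"
  have N: "left_module ?K ?N"
    by (rule left_module_image[OF B_mod]) (simp_all add: \<iota>_inj)
  have \<iota>: "\<iota> \<in> left_module_hom ?K ?B ?N"
    by (rule image_module_hom[OF B_mod]) (simp_all add: \<iota>_inj)
  have add: "\<pi> (y \<oplus>\<^bsub>A\<^esub> w) = \<pi> (z \<oplus>\<^bsub>A\<^esub> w)"
    if "y \<in> carrier A" "z \<in> carrier A" "w \<in> carrier A" "\<pi> y = \<pi> z" for y z w
  proof -
    have "(y \<oplus>\<^bsub>A\<^esub> w) \<ominus>\<^bsub>A\<^esub> (z \<oplus>\<^bsub>A\<^esub> w) = (y \<oplus>\<^bsub>A\<^esub> (w \<oplus>\<^bsub>A\<^esub> \<ominus>\<^bsub>A\<^esub> w)) \<oplus>\<^bsub>A\<^esub> \<ominus>\<^bsub>A\<^esub> z"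
      using that(1-3) by (simp add: a_minus_def A.minus_add A.a_ac)
    then have "(y \<oplus>\<^bsub>A\<^esub> w) \<ominus>\<^bsub>A\<^esub> (z \<oplus>\<^bsub>A\<^esub> w) = y \<ominus>\<^bsub>A\<^esub> z"
      using that(1-3) by (simp add: A.r_neg a_minus_def)
    then show ?thesis using that by (simp add: \<pi>_eq)
  qed
  have smult: "\<pi> (k \<otimes>\<^bsub>A\<^esub> y) = \<pi> (k \<otimes>\<^bsub>A\<^esub> z)"
    if "k \<in> B" "y \<in> carrier A" "z \<in> carrier A" "\<pi> y = \<pi> z" for k y z
  proof -
    have "k \<otimes>\<^bsub>A\<^esub> y \<ominus>\<^bsub>A\<^esub> k \<otimes>\<^bsub>A\<^esub> z = k \<otimes>\<^bsub>A\<^esub> (y \<ominus>\<^bsub>A\<^esub> z)"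
      using that(1-3) B_in_A by (simp add: a_minus_def A.r_distr A.r_minus)
    then show ?thesis using that B(6) B_in_A by (simp add: \<pi>_eq)
  qed
  have N': "left_module ?K ?N'"
    by (rule left_module_image[OF A_mod]; simp; rule add smult; assumption)
  have \<pi>: "\<pi> \<in> left_module_hom ?K (regular A) ?N'"
    by (rule image_module_hom[OF A_mod]; simp; rule add smult; assumption)
  interpret N: left_module ?K ?N by (rule N)
  interpret N': left_module ?K ?N' by (rule N')
  interpret AN: tensor_pair ?K "regular A" ?N using A_right N by (simp add: tensor_pair_def)
  interpret AN': tensor_pair ?K "regular A" ?N' using A_right N' by (simp add: tensor_pair_def)
  note \<iota>_hom = homD[OF left_module_homD(1)[OF \<iota>], simplified] left_module_homD(2)[OF \<iota>, simplified]
  note \<pi>_hom = homD[OF left_module_homD(1)[OF \<pi>], simplified] left_module_homD(2)[OF \<pi>, simplified]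
  have carrier_N: "carrier ?N = \<iota> ` B" by (simp add: image_module_def Let_def)
  have zero_N': "\<zero>\<^bsub>?N'\<^esub> = \<pi> \<zero>\<^bsub>A\<^esub>" by (simp add: image_module_def Let_def)
  \<comment> \<open>The map \<open>b \<mapsto> b a + B\<close>, which vanishes if and only if \<open>a \<in> B\<close>.\<close>
  define g where "g = (\<lambda>v. \<pi> (inv_into B \<iota> v \<otimes>\<^bsub>A\<^esub> a))"
  have g_\<iota>: "g (\<iota> b) = \<pi> (b \<otimes>\<^bsub>A\<^esub> a)" if "b \<in> B" for b
    using that \<iota>_inj by (simp add: g_def inv_into_f_f inj_on_def)
  have g: "g \<in> left_module_hom ?K ?N ?N'"
    unfolding left_module_hom_def
    by (auto intro!: homI simp: carrier_N g_\<iota> \<iota>_hom(2,3)[symmetric] \<pi>_hom(2,3)[symmetric] B(6,7) B_in_A a A.l_distr A.m_assoc \<pi>_hom(1))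
  have id: "(\<lambda>v. v) \<in> left_module_hom ?K ?N ?N" "(\<lambda>v. v) \<in> right_module_hom ?K (regular A) (regular A)"
    by (simp_all add: left_module_hom_def right_module_hom_def hom_def)
  note f' = AN.tensor_pair_axioms AN.tensor_pair_axioms id(2,1)
  note g' = AN.tensor_pair_axioms AN'.tensor_pair_axioms id(2) g
  note h = square.tensor_pair_axioms AN'.tensor_pair_axioms id(2) \<pi>
  let ?f' = "tensor_map ?K (regular A) ?N (\<lambda>v. v) (\<lambda>v. v)"
  let ?g' = "tensor_map ?K (regular A) ?N' (\<lambda>v. v) g"
  let ?h = "tensor_map ?K (regular A) ?N' (\<lambda>v. v) \<pi>"
  have f_id: "?f' t = t" if "t \<in> carrier (tensor_group ?K (regular A) ?N)" for t
    by (rule AN.additive_eqI[OF tensor_map_hom[OF f'] additive_id _ that]) (rule tensor_map_pure[OF f'])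
  have pi_one: "\<pi> \<one>\<^bsub>A\<^esub> = \<zero>\<^bsub>?N'\<^esub>"
    using \<pi>_eq[of "\<one>\<^bsub>A\<^esub>" "\<zero>\<^bsub>A\<^esub>"] minus_B[OF B(3) B(2)] by (simp add: zero_N')
  have pure_zero: "pure_tensor ?K (regular A) ?N' y \<zero>\<^bsub>?N'\<^esub> = \<zero>\<^bsub>tensor_group ?K (regular A) ?N'\<^esub>"
    if "y \<in> carrier A" for y
    using hom_one[OF AN'.pure_right_hom[of y]] that N'.M.a_group AN'.T.a_group by simp
  \<comment> \<open>In \<open>A \<otimes>\<^sub>B A\<close> the tensor \<open>y \<otimes> b a\<close> equals \<open>y b a \<otimes> 1\<close>, and \<open>1\<close> vanishes in \<open>A / B\<close>.\<close>
  have g_zero: "?g' t = \<zero>\<^bsub>tensor_group ?K (regular A) ?N'\<^esub>"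
    if "t \<in> carrier (tensor_group ?K (regular A) ?N)" for t
  proof (rule AN.additive_eqI[OF tensor_map_hom[OF g'] _ _ that])
    show "(\<lambda>t. \<zero>\<^bsub>tensor_group ?K (regular A) ?N'\<^esub>)
        \<in> hom (add_monoid (tensor_group ?K (regular A) ?N)) (add_monoid (tensor_group ?K (regular A) ?N'))"
      by (rule homI) simp_all
  next
    fix y v assume "y \<in> carrier (regular A)" and v: "v \<in> carrier ?N"
    then have y: "y \<in> carrier A" by simp
    obtain b where b: "b \<in> B" "v = \<iota> b" using v by (auto simp: carrier_N)
    note bA = B_in_A[OF b(1)]
    have "?g' (pure_tensor ?K (regular A) ?N y v) = pure_tensor ?K (regular A) ?N' y (\<pi> (b \<otimes>\<^bsub>A\<^esub> a))"
      using tensor_map_pure[OF g'] y v b by (simp add: g_\<iota>)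
    also have "\<dots> = ?h (y \<boxtimes> (b \<otimes>\<^bsub>A\<^esub> a))"
      using tensor_map_pure[OF h] y bA a by (simp add: square_tensor_def)
    also have "y \<boxtimes> (b \<otimes>\<^bsub>A\<^esub> a) = (y \<otimes>\<^bsub>A\<^esub> b) \<odot>\<^bsub>Q\<^esub> (\<one>\<^bsub>A\<^esub> \<boxtimes> a)"
      using y bA a b by (simp add: square_lsmult square_balanced)
    also have "\<dots> = (y \<otimes>\<^bsub>A\<^esub> b \<otimes>\<^bsub>A\<^esub> a) \<boxtimes> \<one>\<^bsub>A\<^esub>"
      unfolding comm using y bA a by (simp add: square_lsmult)
    also have "?h \<dots> = pure_tensor ?K (regular A) ?N' (y \<otimes>\<^bsub>A\<^esub> b \<otimes>\<^bsub>A\<^esub> a) (\<pi> \<one>\<^bsub>A\<^esub>)"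
      using tensor_map_pure[OF h] y bA a by (simp add: square_tensor_def)
    also have "\<dots> = \<zero>\<^bsub>tensor_group ?K (regular A) ?N'\<^esub>"
      using y bA a by (simp add: pi_one pure_zero)
    finally show "?g' (pure_tensor ?K (regular A) ?N y v) = \<zero>\<^bsub>tensor_group ?K (regular A) ?N'\<^esub>" .
  qed
  \<comment> \<open>Hence \<open>g\<close> tensored with \<open>A\<close> has the same kernel as the zero map: everything, the image of the identity.\<close>
  have "exact_at (tensor_group ?K (regular A) ?N) (tensor_group ?K (regular A) ?N)
      (tensor_group ?K (regular A) ?N') ?f' ?g'"
  proof -
    let ?S = "carrier (tensor_group ?K (regular A) ?N)"
    have "?f' ` ?S = (\<lambda>t. t) ` ?S" by (rule image_cong[OF refl f_id])
    then have "?f' ` ?S = ?S" by simp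
    moreover have "{t \<in> ?S. ?g' t = \<zero>\<^bsub>tensor_group ?K (regular A) ?N'\<^esub>} = ?S" using g_zero by blast
    ultimately show ?thesis by (simp only: exact_at_def)
  qed
  then have "exact_at ?N ?N ?N' (\<lambda>v. v) g"
    using ff[unfolded faithfully_flat_right_def, rule_format, of ?N ?N ?N' "\<lambda>v. v" g] N N' id(1) g by blast
  moreover have "\<iota> \<one>\<^bsub>A\<^esub> \<in> carrier ?N" using one_B by (simp add: carrier_N)
  ultimately have "g (\<iota> \<one>\<^bsub>A\<^esub>) = \<zero>\<^bsub>?N'\<^esub>" unfolding exact_at_def by auto
  then have "\<pi> a = \<pi> \<zero>\<^bsub>A\<^esub>" using a one_B by (simp add: g_\<iota> zero_N')
  then show "a \<in> B" using a \<pi>_eq[of a "\<zero>\<^bsub>A\<^esub>"] by (simp add: a_minus_def)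
qed

end


section \<open>Existence of quasibases\<close>

lemma direct_summand_projection:
  assumes V: "bimodule L R V" and P: "direct_summand L R P V"
  obtains p where "p \<in> bimodule_hom L R V (V\<lparr>carrier := P\<rparr>)" and "\<And>v. v \<in> P \<Longrightarrow> p v = v"
proof -
  interpret V: bimodule L R V by fact
  obtain D where Ps: "subbimodule L R P V" and Ds: "subbimodule L R D V"
    and meet: "P \<inter> D = {\<zero>\<^bsub>V\<^esub>}" and sum: "P <+>\<^bsub>V\<^esub> D = carrier V"
    using P by (auto simp: direct_summand_def)
  have Pg: "subgroup P (add_monoid V)" and Dg: "subgroup D (add_monoid V)"
    using Ps Ds by (auto simp: subbimodule_def)
  have PV: "v \<in> carrier V" if "v \<in> P" for v using subgroup.mem_carrier[OF Pg that] by simp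
  have DV: "v \<in> carrier V" if "v \<in> D" for v using subgroup.mem_carrier[OF Dg that] by simp
  have Padd: "v \<oplus>\<^bsub>V\<^esub> w \<in> P" if "v \<in> P" "w \<in> P" for v w using subgroup.m_closed[OF Pg that] by simp
  have Dadd: "v \<oplus>\<^bsub>V\<^esub> w \<in> D" if "v \<in> D" "w \<in> D" for v w using subgroup.m_closed[OF Dg that] by simp
  have Pneg: "\<ominus>\<^bsub>V\<^esub> v \<in> P" if "v \<in> P" for v using subgroup.m_inv_closed[OF Pg that] by (simp add: a_inv_def)
  have Dneg: "\<ominus>\<^bsub>V\<^esub> v \<in> D" if "v \<in> D" for v using subgroup.m_inv_closed[OF Dg that] by (simp add: a_inv_def)
  have D0: "\<zero>\<^bsub>V\<^esub> \<in> D" using subgroup.one_closed[OF Dg] by simp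
  define p where "p v = (SOME w. w \<in> P \<and> (\<exists>d\<in>D. v = w \<oplus>\<^bsub>V\<^esub> d))" for v
  have p: "p v \<in> P \<and> (\<exists>d\<in>D. v = p v \<oplus>\<^bsub>V\<^esub> d)" if "v \<in> carrier V" for v
  proof -
    have "\<exists>w. w \<in> P \<and> (\<exists>d\<in>D. v = w \<oplus>\<^bsub>V\<^esub> d)"
      using that unfolding sum[symmetric] by (auto simp: set_add_def set_mult_def)
    then show ?thesis unfolding p_def by (rule someI_ex)
  qed
  \<comment> \<open>The difference of two choices lies in \<open>P \<inter> D = 0\<close>.\<close>
  have unique: "v = w" if "v \<in> P" "w \<in> P" "d \<in> D" "e \<in> D" "v \<oplus>\<^bsub>V\<^esub> d = w \<oplus>\<^bsub>V\<^esub> e" for v w d e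
  proof -
    note c = PV[OF that(1)] PV[OF that(2)] DV[OF that(3)] DV[OF that(4)]
    have "v \<oplus>\<^bsub>V\<^esub> \<ominus>\<^bsub>V\<^esub> w = (v \<oplus>\<^bsub>V\<^esub> d) \<oplus>\<^bsub>V\<^esub> (\<ominus>\<^bsub>V\<^esub> d \<oplus>\<^bsub>V\<^esub> \<ominus>\<^bsub>V\<^esub> w)"
      using c by (simp add: V.M.a_assoc V.M.r_neg2)
    also have "\<dots> = (w \<oplus>\<^bsub>V\<^esub> e) \<oplus>\<^bsub>V\<^esub> (\<ominus>\<^bsub>V\<^esub> w \<oplus>\<^bsub>V\<^esub> \<ominus>\<^bsub>V\<^esub> d)"
      using c that(5) by (simp add: V.M.a_comm)
    also have "\<dots> = (\<ominus>\<^bsub>V\<^esub> w \<oplus>\<^bsub>V\<^esub> (w \<oplus>\<^bsub>V\<^esub> e)) \<oplus>\<^bsub>V\<^esub> \<ominus>\<^bsub>V\<^esub> d"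
      using c by (simp add: V.M.a_ac)
    also have "\<dots> = e \<oplus>\<^bsub>V\<^esub> \<ominus>\<^bsub>V\<^esub> d" using c by (simp add: V.M.r_neg1)
    finally have "v \<oplus>\<^bsub>V\<^esub> \<ominus>\<^bsub>V\<^esub> w \<in> D" using that Dadd Dneg by simp
    moreover have "v \<oplus>\<^bsub>V\<^esub> \<ominus>\<^bsub>V\<^esub> w \<in> P" using that Padd Pneg by simp
    ultimately have "v \<oplus>\<^bsub>V\<^esub> \<ominus>\<^bsub>V\<^esub> w \<in> P \<inter> D" by blast
    then have "v \<oplus>\<^bsub>V\<^esub> \<ominus>\<^bsub>V\<^esub> w = \<zero>\<^bsub>V\<^esub>" by (simp add: meet)
    then show ?thesis using c V.M.minus_equality[of v "\<ominus>\<^bsub>V\<^esub> w"] by simp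
  qed
  have pI: "p v = w" if "w \<in> P" "d \<in> D" "v = w \<oplus>\<^bsub>V\<^esub> d" for v w d
  proof -
    have "v \<in> carrier V" using that PV DV by simp
    then obtain d' where "p v \<in> P" "d' \<in> D" "v = p v \<oplus>\<^bsub>V\<^esub> d'" using p by blast
    then show ?thesis using unique[of "p v" w d' d] that by simp
  qed
  have "p \<in> bimodule_hom L R V (V\<lparr>carrier := P\<rparr>)"
  proof (rule bimodule_homI)
    show "p \<in> hom (add_monoid V) (add_monoid (V\<lparr>carrier := P\<rparr>))"
    proof (rule homI, simp_all add: p)
      fix v w assume v: "v \<in> carrier V" and w: "w \<in> carrier V"
      obtain d e where d: "p v \<in> P" "d \<in> D" "v = p v \<oplus>\<^bsub>V\<^esub> d" and e: "p w \<in> P" "e \<in> D" "w = p w \<oplus>\<^bsub>V\<^esub> e"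
        using p[OF v] p[OF w] by blast
      have "(p v \<oplus>\<^bsub>V\<^esub> d) \<oplus>\<^bsub>V\<^esub> (p w \<oplus>\<^bsub>V\<^esub> e) = (p v \<oplus>\<^bsub>V\<^esub> p w) \<oplus>\<^bsub>V\<^esub> (d \<oplus>\<^bsub>V\<^esub> e)"
        using PV[OF d(1)] PV[OF e(1)] DV[OF d(2)] DV[OF e(2)] by (simp add: V.M.a_ac)
      then show "p (v \<oplus>\<^bsub>V\<^esub> w) = p v \<oplus>\<^bsub>V\<^esub> p w"
        using d e by (intro pI[OF Padd Dadd]) simp_all
    qed
  next
    fix k v assume k: "k \<in> carrier L" and v: "v \<in> carrier V"
    obtain d where d: "p v \<in> P" "d \<in> D" "v = p v \<oplus>\<^bsub>V\<^esub> d" using p[OF v] by blast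
    have "k \<odot>\<^bsub>V\<^esub> v = k \<odot>\<^bsub>V\<^esub> p v \<oplus>\<^bsub>V\<^esub> k \<odot>\<^bsub>V\<^esub> d"
      using d(3) V.lsmult_add[OF k PV[OF d(1)] DV[OF d(2)]] by simp
    then have "p (k \<odot>\<^bsub>V\<^esub> v) = k \<odot>\<^bsub>V\<^esub> p v"
      using Ps Ds k d by (intro pI) (auto simp: subbimodule_def)
    then show "p (k \<odot>\<^bsub>V\<^esub> v) = k \<odot>\<^bsub>V\<lparr>carrier := P\<rparr>\<^esub> p v" by simp
  next
    fix k v assume k: "k \<in> carrier R" and v: "v \<in> carrier V"
    obtain d where d: "p v \<in> P" "d \<in> D" "v = p v \<oplus>\<^bsub>V\<^esub> d" using p[OF v] by blast
    have "v \<bullet>\<^bsub>V\<^esub> k = p v \<bullet>\<^bsub>V\<^esub> k \<oplus>\<^bsub>V\<^esub> d \<bullet>\<^bsub>V\<^esub> k"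
      using d(3) V.rsmult_add[OF PV[OF d(1)] DV[OF d(2)] k] by simp
    then have "p (v \<bullet>\<^bsub>V\<^esub> k) = p v \<bullet>\<^bsub>V\<^esub> k"
      using Ps Ds k d by (intro pI) (auto simp: subbimodule_def)
    then show "p (v \<bullet>\<^bsub>V\<^esub> k) = p v \<bullet>\<^bsub>V\<lparr>carrier := P\<rparr>\<^esub> k" by simp
  qed
  moreover have "p v = v" if "v \<in> P" for v
    using that D0 PV by (intro pI[of v "\<zero>\<^bsub>V\<^esub>"]) simp_all
  ultimately show thesis by (rule that)
qed

text \<open>The retraction \<open>g\<close> is the projection of \<open>V\<close> onto \<open>P\<close> followed by the inverse of \<open>f\<close>.\<close>

lemma direct_summand_retraction:
  assumes V: "bimodule L R V" and M: "bimodule L R M" and P: "direct_summand L R P V"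
    and f: "f \<in> bimodule_iso L R M (V\<lparr>carrier := P\<rparr>)"
  obtains g where "f \<in> bimodule_hom L R M V" and "g \<in> bimodule_hom L R V M"
    and "\<And>q. q \<in> carrier M \<Longrightarrow> g (f q) = q"
proof -
  interpret V: bimodule L R V by fact
  interpret M: bimodule L R M by fact
  obtain p where p: "p \<in> bimodule_hom L R V (V\<lparr>carrier := P\<rparr>)" "\<And>v. v \<in> P \<Longrightarrow> p v = v"
    using direct_summand_projection[OF V P] by blast
  have PV: "P \<subseteq> carrier V"
    using P subgroup.subset by (fastforce simp: direct_summand_def subbimodule_def)
  have fh: "f \<in> bimodule_hom L R M (V\<lparr>carrier := P\<rparr>)" and bij: "bij_betw f (carrier M) P"
    using f by (auto simp: bimodule_iso_def)
  have fP: "f q \<in> P" if "q \<in> carrier M" for q using bij that by (auto simp: bij_betw_def)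
  note f_hom = homD(2)[OF bimodule_homD(3)[OF fh], simplified] bimodule_homD(4,5)[OF fh, simplified]
  note p_hom = homD[OF bimodule_homD(3)[OF p(1)], simplified] bimodule_homD(4,5)[OF p(1), simplified]
  have 1: "f \<in> bimodule_hom L R M V"
    using fP PV by (intro bimodule_homI homI) (auto simp: f_hom)
  define g where "g v = inv_into (carrier M) f (p v)" for v
  have gf: "g v \<in> carrier M" "f (g v) = p v" if "v \<in> carrier V" for v
    using p_hom(1)[OF that] bij unfolding g_def bij_betw_def by (auto intro: inv_into_into f_inv_into_f)
  have gI: "g v = q" if "v \<in> carrier V" "q \<in> carrier M" "f q = p v" for v q
    by (rule inj_onD[OF bij_betw_imp_inj_on[OF bij]]) (simp_all add: gf that)
  have 2: "g \<in> bimodule_hom L R V M"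
  proof (rule bimodule_homI)
    show "g \<in> hom (add_monoid V) (add_monoid M)"
      by (rule homI) (simp_all add: gf gI f_hom p_hom)
  qed (simp_all add: gf gI f_hom p_hom V.lsmult_closed V.rsmult_closed M.lsmult_closed M.rsmult_closed)
  show thesis
    by (rule that[OF 1 2 gI]) (use fP PV p(2) in auto)
qed

lemma bimodule_power:
  assumes M: "bimodule L R M"
  shows "bimodule L R (bimodule_power n M)"
proof -
  interpret M: bimodule L R M by fact
  have rings: "ring L" "ring R" by unfold_locales
  have s: "carrier (bimodule_power n M) = (\<Pi>\<^sub>E i\<in>{..<n}. carrier M)" "\<zero>\<^bsub>bimodule_power n M\<^esub> = (\<lambda>i\<in>{..<n}. \<zero>\<^bsub>M\<^esub>)"
    "\<And>v w. v \<oplus>\<^bsub>bimodule_power n M\<^esub> w = (\<lambda>i\<in>{..<n}. v i \<oplus>\<^bsub>M\<^esub> w i)"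
    "\<And>l v. l \<odot>\<^bsub>bimodule_power n M\<^esub> v = (\<lambda>i\<in>{..<n}. l \<odot>\<^bsub>M\<^esub> v i)"
    "\<And>v r. v \<bullet>\<^bsub>bimodule_power n M\<^esub> r = (\<lambda>i\<in>{..<n}. v i \<bullet>\<^bsub>M\<^esub> r)"
    by (simp_all add: bimodule_power_def)
  note ext = PiE_iff extensional_def restrict_def fun_eq_iff
  have g: "abelian_group (bimodule_power n M)"
  proof (rule abelian_groupI, unfold s)
    fix v assume v: "v \<in> (\<Pi>\<^sub>E i\<in>{..<n}. carrier M)"
    then show "\<exists>w\<in>\<Pi>\<^sub>E i\<in>{..<n}. carrier M. (\<lambda>i\<in>{..<n}. w i \<oplus>\<^bsub>M\<^esub> v i) = (\<lambda>i\<in>{..<n}. \<zero>\<^bsub>M\<^esub>)"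
      by (intro bexI[of _ "\<lambda>i\<in>{..<n}. \<ominus>\<^bsub>M\<^esub> v i"]) (auto simp: ext M.M.l_neg)
  qed (auto simp: ext M.M.a_ac)
  show ?thesis
    by (intro bimodule.intro left_module.intro right_module.intro bimodule_axioms.intro rings
        left_module_axioms.intro right_module_axioms.intro g; unfold s)
      (auto simp: ext M.lsmult_closed M.lsmult_add M.lsmult_add_scalar M.lsmult_assoc M.lsmult_one M.rsmult_closed
        M.rsmult_add M.rsmult_add_scalar M.rsmult_assoc M.rsmult_one M.bimodule_assoc)
qed

context subring_extension
begin

text \<open>Embed \<open>A \<otimes>\<^sub>B A\<close> into a power of \<open>A\<close>. The \<open>\<gamma>\<^sub>j\<close> are the coordinates of the images of \<open>1 \<otimes> a\<close>, the
  \<open>u\<^sub>j\<close> the images of the standard basis vectors under a retraction.\<close>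

lemma right_D2_quasibase_exists:
  assumes "right_D2 A B"
  shows "\<exists>n \<gamma> u. right_D2_quasibase A B n \<gamma> u"
proof -
  let ?K = "subring_of A B"
  obtain n P f where P: "direct_summand A ?K P (bimodule_power n (regular A))"
    and f: "f \<in> bimodule_iso A ?K Q ((bimodule_power n (regular A))\<lparr>carrier := P\<rparr>)"
    using assms by (auto simp: right_D2_def)
  let ?V = "bimodule_power n (regular A)"
  have s: "carrier ?V = (\<Pi>\<^sub>E i\<in>{..<n}. carrier A)"
    "\<And>v w. v \<oplus>\<^bsub>?V\<^esub> w = (\<lambda>i\<in>{..<n}. v i \<oplus>\<^bsub>A\<^esub> w i)"
    "\<And>l v. l \<odot>\<^bsub>?V\<^esub> v = (\<lambda>i\<in>{..<n}. l \<otimes>\<^bsub>A\<^esub> v i)"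
    "\<And>v r. v \<bullet>\<^bsub>?V\<^esub> r = (\<lambda>i\<in>{..<n}. v i \<otimes>\<^bsub>A\<^esub> r)"
    by (simp_all add: bimodule_power_def)
  have V: "bimodule A ?K ?V" by (rule bimodule_power[OF regular_right[OF B_subring]])
  have Q_bimodule: "bimodule A A Q" by unfold_locales
  have QK: "bimodule A ?K Q"
    using bimodule_restrict_scalars[OF Q_bimodule A.ring_axioms A.ring_axioms A.carrier_is_subring B_subring] by simp
  obtain g where fh: "f \<in> bimodule_hom A ?K Q ?V" and gh: "g \<in> bimodule_hom A ?K ?V Q"
    and gf: "\<And>q. q \<in> carrier Q \<Longrightarrow> g (f q) = q"
    using direct_summand_retraction[OF V QK P f] by blast
  interpret V: bimodule A ?K ?V by (rule V)
  have V_group: "abelian_group ?V" by unfold_locales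
  note f_hom = homD[OF bimodule_homD(3)[OF fh]] bimodule_homD(4,5)[OF fh]
  note g_hom = homD[OF bimodule_homD(3)[OF gh]] bimodule_homD(4,5)[OF gh]
  define e where "e j = (\<lambda>i\<in>{..<n}. if i = j then \<one>\<^bsub>A\<^esub> else \<zero>\<^bsub>A\<^esub>)" for j
  have eV: "e j \<in> carrier ?V" for j by (auto simp: e_def s)
  have comp: "v i \<in> carrier A" if "v \<in> carrier ?V" "i < n" for v i
    using that by (auto simp: s)
  have expand: "(\<Oplus>\<^bsub>?V\<^esub>j\<in>{..<n}. v j \<odot>\<^bsub>?V\<^esub> e j) = v" if v: "v \<in> carrier ?V" for v
  proof -
    have closed: "(\<lambda>j. v j \<odot>\<^bsub>?V\<^esub> e j) \<in> {..<n} \<rightarrow> carrier ?V"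
      using comp[OF v] eV by (auto intro: V.lsmult_closed)
    have "(\<Oplus>\<^bsub>?V\<^esub>j\<in>{..<n}. v j \<odot>\<^bsub>?V\<^esub> e j) i = v i" if i: "i < n" for i
    proof -
      have h: "(\<lambda>w. w i) \<in> hom (add_monoid ?V) (add_monoid A)"
        using i by (intro homI) (auto simp: s)
      have "(\<Oplus>\<^bsub>?V\<^esub>j\<in>{..<n}. v j \<odot>\<^bsub>?V\<^esub> e j) i = (\<Oplus>\<^bsub>A\<^esub>j\<in>{..<n}. (v j \<odot>\<^bsub>?V\<^esub> e j) i)"
        by (rule additive_finsum[OF V_group A.abelian_group_axioms h closed]) simp
      also have "\<dots> = (\<Oplus>\<^bsub>A\<^esub>j\<in>{..<n}. if i = j then v j else \<zero>\<^bsub>A\<^esub>)"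
        using i comp[OF v] by (intro A.finsum_cong') (auto simp: s e_def)
      also have "\<dots> = v i"
        using i comp[OF v] by (intro A.add.finprod_singleton[unfolded finsum_def[symmetric], simplified]) auto
      finally show ?thesis .
    qed
    then show ?thesis
      using V.M.finsum_closed[OF closed] v unfolding s by (intro PiE_ext) auto
  qed
  define \<gamma> where "\<gamma> j a = f (\<one>\<^bsub>A\<^esub> \<boxtimes> a) j" for j a
  define u where "u j = g (e j)" for j
  have fV: "f (\<one>\<^bsub>A\<^esub> \<boxtimes> a) \<in> carrier ?V" if "a \<in> carrier A" for a
    using that by (simp add: f_hom)
  have "\<gamma> j \<in> bimodule_End A B" if j: "j < n" for j
    unfolding bimodule_End_def
  proof (rule bimodule_homI)
    show "\<gamma> j \<in> hom (add_monoid (regular A)) (add_monoid (regular A))"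
      using j comp[OF fV j] homD(2)[OF square_right_hom[OF A.one_closed]]
      by (intro homI) (simp_all add: \<gamma>_def f_hom s)
  next
    fix b a assume "b \<in> carrier ?K" and "a \<in> carrier (regular A)"
    then have b: "b \<in> B" "b \<in> carrier A" and a: "a \<in> carrier A" by (simp_all add: B_in_A)
    have "\<one>\<^bsub>A\<^esub> \<boxtimes> (b \<otimes>\<^bsub>A\<^esub> a) = b \<odot>\<^bsub>Q\<^esub> (\<one>\<^bsub>A\<^esub> \<boxtimes> a)"
      using square_balanced[OF A.one_closed b(1) a] a b by (simp add: square_lsmult)
    then show "\<gamma> j (b \<odot>\<^bsub>regular A\<^esub> a) = b \<odot>\<^bsub>regular A\<^esub> \<gamma> j a"
      using a b j by (simp add: \<gamma>_def f_hom s)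
    have "\<one>\<^bsub>A\<^esub> \<boxtimes> (a \<otimes>\<^bsub>A\<^esub> b) = (\<one>\<^bsub>A\<^esub> \<boxtimes> a) \<bullet>\<^bsub>Q\<^esub> b" using a b by (simp add: square_rsmult)
    then show "\<gamma> j (a \<bullet>\<^bsub>regular A\<^esub> b) = \<gamma> j a \<bullet>\<^bsub>regular A\<^esub> b"
      using a b j by (simp add: \<gamma>_def f_hom s)
  qed
  \<comment> \<open>Standard basis vectors have entries \<open>0\<close> and \<open>1\<close>, so they commute with \<open>B\<close>.\<close>
  moreover have "u j \<in> carrier T" for j
  proof -
    have "b \<odot>\<^bsub>?V\<^esub> e j = e j \<bullet>\<^bsub>?V\<^esub> b" if "b \<in> B" for b
      using B_in_A[OF that] by (auto simp: s e_def intro!: restrict_ext)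
    then show ?thesis
      using eV g_hom(1) by (auto simp: T_iff u_def B_in_A g_hom(3)[symmetric] g_hom(4)[symmetric])
  qed
  moreover have "a \<boxtimes> a' = (\<Oplus>\<^bsub>Q\<^esub>j\<in>{..<n}. (a \<otimes>\<^bsub>A\<^esub> \<gamma> j a') \<odot>\<^bsub>Q\<^esub> u j)"
    if a: "a \<in> carrier A" and a': "a' \<in> carrier A" for a a'
  proof -
    \<comment> \<open>Embed \<open>a \<otimes> a'\<close> into the power, expand it in the standard basis there, and retract.\<close>
    let ?v = "a \<odot>\<^bsub>?V\<^esub> f (\<one>\<^bsub>A\<^esub> \<boxtimes> a')"
    have v: "?v \<in> carrier ?V" using a fV[OF a'] by (rule V.lsmult_closed)
    have vj: "?v j = a \<otimes>\<^bsub>A\<^esub> \<gamma> j a'" if "j < n" for j using that by (simp add: s \<gamma>_def)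
    have "a \<boxtimes> a' = g (f (a \<odot>\<^bsub>Q\<^esub> (\<one>\<^bsub>A\<^esub> \<boxtimes> a')))" using a a' by (simp add: gf square_lsmult)
    also have "\<dots> = g ?v" using a a' by (simp add: f_hom)
    also have "\<dots> = g (\<Oplus>\<^bsub>?V\<^esub>j\<in>{..<n}. ?v j \<odot>\<^bsub>?V\<^esub> e j)" by (simp only: expand[OF v])
    also have "\<dots> = (\<Oplus>\<^bsub>Q\<^esub>j\<in>{..<n}. g (?v j \<odot>\<^bsub>?V\<^esub> e j))"
      using comp[OF v] eV by (intro additive_finsum[OF V_group Q_group bimodule_homD(3)[OF gh]]) (auto intro: V.lsmult_closed)
    also have "\<dots> = (\<Oplus>\<^bsub>Q\<^esub>j\<in>{..<n}. (a \<otimes>\<^bsub>A\<^esub> \<gamma> j a') \<odot>\<^bsub>Q\<^esub> u j)"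
      using comp[OF v] eV by (intro Q.M.finsum_cong') (auto simp: g_hom u_def vj intro!: Q.lsmult_closed)
    finally show ?thesis .
  qed
  ultimately show ?thesis unfolding right_D2_quasibase_def by blast
qed

end

theorem theorem5p1:
  fixes A :: "('a, 'p) ring_scheme" and B :: "'a set"
  assumes "ring A" and "subring B A" and "D2_extension A B"
  shows "(\<exists>n \<gamma> u. right_D2_quasibase A B n \<gamma> u) \<and>
    (\<forall>n \<gamma> u. right_D2_quasibase A B n \<gamma> u \<longrightarrow>
       Galois_coring A B (canonical_coring A B n \<gamma> u) (canonical_element A B) \<and>
       (balanced_right A B \<or> faithfully_flat_right (A\<lparr>carrier := B\<rparr>) (regular A) \<longrightarrow>
          B = coinvariants A B n \<gamma> u))"
proof (intro conjI allI impI)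
  interpret subring_extension A B
    using assms(1,2) by (simp add: subring_extension_def subring_extension_axioms_def)
  show "\<exists>n \<gamma> u. right_D2_quasibase A B n \<gamma> u"
    using assms(3) right_D2_quasibase_exists by (simp add: D2_extension_def)
  fix n \<gamma> u assume "right_D2_quasibase A B n \<gamma> u"
  then interpret D2_quasibase A B n \<gamma> u
    by unfold_locales
  show "Galois_coring A B (canonical_coring A B n \<gamma> u) (canonical_element A B)"
    by (rule Galois_coring_canonical)
  assume "balanced_right A B \<or> faithfully_flat_right (A\<lparr>carrier := B\<rparr>) (regular A)"
  then have "a \<in> B" if "a \<in> coinvariants A B n \<gamma> u" for a
    using that square_commute_balanced square_commute_faithfully_flat by (auto simp: coinvariants_iff)
  moreover have "b \<in> coinvariants A B n \<gamma> u" if "b \<in> B" for b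
    using that square_balanced[of "\<one>\<^bsub>A\<^esub>" b "\<one>\<^bsub>A\<^esub>"] by (simp add: coinvariants_iff B_in_A)
  ultimately show "B = coinvariants A B n \<gamma> u" by blast
qed

end
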